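(* Let $s\in\mathbb{N}_0$, let $V:\mathbb{R}\to\mathbb{R}$, and let $B_\pm(x,y)$ be the Marchenko functions of $H=-\frac{d^2}{dx^2}+V$ (see context). (a) If $V\in L^1_{s+1}(\mathbb{R})$, then there exists $c=c(\|V\|_{L^1_{s+1}})$ such that for all $x\in\mathbb{R}$ $$\int_{-\infty}^\infty|y|^s|B_\pm(x,y)|\,dy\le c\,(1+\max(0,\mp x))^{s+1}.$$ (b) If $n\ge1$ and $V\in W^{n-1}_{1,s+1}$, then there exists $c=c(\|V\|_{W^{n-1}_{1,s+1}})$ such that for all $x\in\mathbb{R}$ $$\int_{-\infty}^\infty|y|^s|\partial_y^nB_\pm(x,y)|\,dy\le c\,(1+\max(0,\mp x))^s,$$ $$\int_{-\infty}^\infty|y|^s|\partial_x^nB_\pm(x,y)|\,dy\le c\,(1+\max(0,\mp x))^s.$$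
   Context: Weighted spaces: $L^1_\gamma=\{V:\int(1+|y|)^\gamma|V(y)|\,dy<\infty\}$ and $W^n_{1,\gamma}=\{V:\int(1+|y|)^\gamma|V^{(i)}(y)|\,dy<\infty,\ i=0,\dots,n\}$, with the natural norms. Jost functions: $f_\pm(x,k)$, $k\in\mathbb{R}$, solve $-f''+Vf=k^2f$ with $f_\pm(x,k)\sim e^{\pm ikx}$ as $x\to\pm\infty$; modified Jost functions: $m_\pm(x,k)=e^{\mp ikx}f_\pm(x,k)$. Marchenko functions: $B_\pm(x,\cdot)\in L^1(\mathbb{R})$ is supported in $\mathbb{R}_\pm$ (i.e. $B_+(x,y)=0$ for $y<0$, $B_-(x,y)=0$ for $y>0$) and $$m_+(x,k)=1+\int_0^{\infty}B_+(x,y)e^{2iky}\,dy,\qquad m_-(x,k)=1+\int_{-\infty}^0B_-(x,y)e^{-2iky}\,dy.$$ They satisfy the Marchenko equations $$B_+(x,y)=\int_{x+y}^\infty V(t)\,dt+\int_0^ydz\int_{x+y-z}^\infty V(t)B_+(t,z)\,dt\quad(y>0),$$ $$B_-(x,y)=\int_{-\infty}^{x+y}V(t)\,dt+\int_y^0dz\int_{-\infty}^{x+y-z}V(t)B_-(t,z)\,dt\quad(y<0).$$ In part (b) the derivatives of $B_\pm(x,y)$ are those on the open half-line $\pm y>0$ (the jump of $B_\pm(x,\cdot)$ at $y=0$ coming from the support restriction is not counted). The constant $c$ may also depend on $s$ and $n$. *)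

theory Defs
  imports "HOL-Analysis.Analysis" "HOL-Library.Landau_Symbols"
begin

section \<open>Derivatives and weighted spaces\<close>

text \<open>
  On the interval \<open>S\<close>, the functions \<open>W 0, \<dots>, W (n - 1)\<close> are locally absolutely continuous and
  \<open>W (i + 1)\<close> is the (almost everywhere defined) derivative of \<open>W i\<close>. Absolute continuity is expressed
  by being an indefinite integral of the derivative.
\<close>
definition ac_derivs ::
  "real set \<Rightarrow> nat \<Rightarrow> (nat \<Rightarrow> real \<Rightarrow> 'a :: {banach, second_countable_topology}) \<Rightarrow> bool" where
  "ac_derivs S n W \<longleftrightarrow>
     (\<forall>i<n. \<forall>a\<in>S. \<forall>b\<in>S. a \<le> b \<longrightarrow>
        set_integrable lebesgue {a..b} (W (Suc i)) \<and>
        W i b - W i a = (LINT t:{a..b}|lebesgue. W (Suc i) t))"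

definition weighted_L1 :: "real \<Rightarrow> (real \<Rightarrow> real) set" where
  "weighted_L1 \<gamma> = {V. integrable lebesgue (\<lambda>y. (1 + \<bar>y\<bar>) powr \<gamma> * V y)}"

definition norm_L1 :: "real \<Rightarrow> (real \<Rightarrow> real) \<Rightarrow> real" where
  "norm_L1 \<gamma> V = (LINT y|lebesgue. (1 + \<bar>y\<bar>) powr \<gamma> * \<bar>V y\<bar>)"

text \<open>
  \<open>W i\<close> is the \<open>i\<close>-th derivative of \<open>V\<close> in the Sobolev sense, for \<open>i \<le> n\<close>. As \<open>V\<close> represents a class
  of functions modulo null sets, \<open>W 0\<close> only has to agree with it almost everywhere.
\<close>
definition sobolev_derivs :: "nat \<Rightarrow> (real \<Rightarrow> real) \<Rightarrow> (nat \<Rightarrow> real \<Rightarrow> real) \<Rightarrow> bool" where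
  "sobolev_derivs n V W \<longleftrightarrow> (AE y in lebesgue. W 0 y = V y) \<and> ac_derivs UNIV n W"

definition weighted_W1 :: "nat \<Rightarrow> real \<Rightarrow> (real \<Rightarrow> real) set" where
  "weighted_W1 n \<gamma> =
     {V. \<exists>W. sobolev_derivs n V W \<and>
         (\<forall>i\<le>n. integrable lebesgue (\<lambda>y. (1 + \<bar>y\<bar>) powr \<gamma> * W i y))}"

text \<open>
  The choice of \<open>W\<close> is immaterial: \<open>W 0, \<dots>, W n\<close> are determined by \<open>V\<close> up to null sets.
\<close>
definition norm_W1 :: "nat \<Rightarrow> real \<Rightarrow> (real \<Rightarrow> real) \<Rightarrow> real" where
  "norm_W1 n \<gamma> V =
     (let W = (SOME W. sobolev_derivs n V W)
      in \<Sum>i\<le>n. LINT y|lebesgue. (1 + \<bar>y\<bar>) powr \<gamma> * \<bar>W i y\<bar>)"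


section \<open>Jost functions\<close>

text \<open>
  Solutions of \<open>- u'' + V u = k\<^sup>2 u\<close>, where \<open>u\<close> and \<open>u'\<close> are locally absolutely continuous and the
  equation holds almost everywhere.
\<close>
definition schroedinger_solution :: "(real \<Rightarrow> real) \<Rightarrow> real \<Rightarrow> (real \<Rightarrow> complex) \<Rightarrow> bool" where
  "schroedinger_solution V k u \<longleftrightarrow>
     (\<exists>W. W 0 = u \<and> ac_derivs UNIV 2 W \<and>
       (AE x in lebesgue.
          - W 2 x + complex_of_real (V x) * W 0 x = complex_of_real (k\<^sup>2) * W 0 x))"

definition jost_plus :: "(real \<Rightarrow> real) \<Rightarrow> (real \<Rightarrow> real \<Rightarrow> complex) \<Rightarrow> bool" where
  "jost_plus V f \<longleftrightarrow>
     (\<forall>k. schroedinger_solution V k (\<lambda>x. f x k) \<and> (\<lambda>x. f x k) \<sim>[at_top] (\<lambda>x. cis (k * x)))"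

definition jost_minus :: "(real \<Rightarrow> real) \<Rightarrow> (real \<Rightarrow> real \<Rightarrow> complex) \<Rightarrow> bool" where
  "jost_minus V f \<longleftrightarrow>
     (\<forall>k. schroedinger_solution V k (\<lambda>x. f x k) \<and> (\<lambda>x. f x k) \<sim>[at_bot] (\<lambda>x. cis (- k * x)))"


section \<open>Marchenko functions\<close>

text \<open>
  The integral representation of the modified Jost functions \<open>exp (\<mp>i k x) f\<^sub>\<plusminus>(x, k)\<close> determines
  \<open>B x\<close> up to null sets only. The Marchenko equation, which is required at every point of the open
  half-line and with an absolutely convergent double integral, singles out the representative that is
  continuous there; it is this representative that the derivatives of \<open>B\<close> refer to.
\<close>
definition marchenko_plus :: "(real \<Rightarrow> real) \<Rightarrow> (real \<Rightarrow> real \<Rightarrow> real) \<Rightarrow> bool" where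
  "marchenko_plus V B \<longleftrightarrow>
     (\<forall>x. integrable lebesgue (B x)) \<and>
     (\<forall>x y. y < 0 \<longrightarrow> B x y = 0) \<and>
     (\<exists>f. jost_plus V f \<and>
        (\<forall>x k. cis (- k * x) * f x k =
           1 + (LINT y:{0..}|lebesgue. complex_of_real (B x y) * cis (2 * k * y)))) \<and>
     (\<forall>x. \<forall>y>0.
        set_integrable lebesgue {(t, z). 0 < z \<and> z < y \<and> x + y - z < t} (\<lambda>(t, z). V t * B t z) \<and>
        B x y = (LINT t:{x + y..}|lebesgue. V t) +
                (LINT z:{0..y}|lebesgue. (LINT t:{x + y - z..}|lebesgue. V t * B t z)))"

definition marchenko_minus :: "(real \<Rightarrow> real) \<Rightarrow> (real \<Rightarrow> real \<Rightarrow> real) \<Rightarrow> bool" where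
  "marchenko_minus V B \<longleftrightarrow>
     (\<forall>x. integrable lebesgue (B x)) \<and>
     (\<forall>x y. y > 0 \<longrightarrow> B x y = 0) \<and>
     (\<exists>f. jost_minus V f \<and>
        (\<forall>x k. cis (k * x) * f x k =
           1 + (LINT y:{..0}|lebesgue. complex_of_real (B x y) * cis (- 2 * k * y)))) \<and>
     (\<forall>x. \<forall>y<0.
        set_integrable lebesgue {(t, z). y < z \<and> z < 0 \<and> t < x + y - z} (\<lambda>(t, z). V t * B t z) \<and>
        B x y = (LINT t:{..x + y}|lebesgue. V t) +
                (LINT z:{y..0}|lebesgue. (LINT t:{..x + y - z}|lebesgue. V t * B t z)))"

text \<open>
  Pointwise iterated derivatives. For \<open>y \<noteq> 0\<close> they only depend on \<open>B\<close> on the open half-line containing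
  \<open>y\<close>, so the jump of \<open>B x\<close> at \<open>0\<close> is not seen by integrals over \<open>y\<close>.
\<close>
definition dy :: "nat \<Rightarrow> (real \<Rightarrow> real \<Rightarrow> real) \<Rightarrow> real \<Rightarrow> real \<Rightarrow> real" where
  "dy n B x y = (deriv ^^ n) (\<lambda>y'. B x y') y"

definition dx :: "nat \<Rightarrow> (real \<Rightarrow> real \<Rightarrow> real) \<Rightarrow> real \<Rightarrow> real \<Rightarrow> real" where
  "dx n B x y = (deriv ^^ n) (\<lambda>x'. B x' y) x"

text \<open>
  Since \<open>deriv\<close> is total, the existence of the derivatives has to be stated separately: on the open
  half-line \<open>S\<close>, the derivatives up to order \<open>n - 1\<close> are locally absolutely continuous, and for every
  \<open>x\<close> the \<open>n\<close>-th one exists as a classical derivative at \<open>(x, y)\<close> for almost every \<open>y\<close>.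
\<close>
definition has_dy :: "real set \<Rightarrow> nat \<Rightarrow> (real \<Rightarrow> real \<Rightarrow> real) \<Rightarrow> bool" where
  "has_dy S n B \<longleftrightarrow>
     (\<forall>x. ac_derivs S n (\<lambda>i y. dy i B x y)) \<and>
     (\<forall>x. AE y in lebesgue. y \<in> S \<longrightarrow> (\<lambda>y'. dy (n - 1) B x y') differentiable (at y))"

definition has_dx :: "real set \<Rightarrow> nat \<Rightarrow> (real \<Rightarrow> real \<Rightarrow> real) \<Rightarrow> bool" where
  "has_dx S n B \<longleftrightarrow>
     (\<forall>y\<in>S. ac_derivs UNIV n (\<lambda>i x. dx i B x y)) \<and>
     (\<forall>x. AE y in lebesgue. y \<in> S \<longrightarrow> (\<lambda>x'. dx (n - 1) B x' y) differentiable (at x))"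

definition moment_le :: "nat \<Rightarrow> (real \<Rightarrow> real) \<Rightarrow> real \<Rightarrow> bool" where
  "moment_le s h C \<longleftrightarrow>
     integrable lebesgue (\<lambda>y. \<bar>y\<bar> ^ s * h y) \<and> (LINT y|lebesgue. \<bar>y\<bar> ^ s * \<bar>h y\<bar>) \<le> C"

end

theory Submission
  imports Defs
begin

text \<open>
  Write \<open>T v P x y\<close> (\<open>char_int\<close>) for the integral of \<open>v t * P t (x + y - t)\<close> and \<open>Q v P x y\<close> (\<open>tail_int\<close>) for the integral of
  \<open>v t * P t y\<close>, both over \<open>t \<ge> x\<close>. Differentiating the Marchenko equation gives
  \<open>\<partial>\<^sub>x B = - V (x + y) - T V B\<close> and \<open>\<partial>\<^sub>y B = - V (x + y) - T V B + Q V B\<close>. The operators respect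
  derivatives, \<open>\<partial>\<^sub>x T v P = T v' P + T v (\<partial>\<^sub>x P)\<close>, \<open>\<partial>\<^sub>y T v P = \<partial>\<^sub>x T v P + v P\<close>, \<open>\<partial>\<^sub>x Q v P = - v P\<close>
  and \<open>\<partial>\<^sub>y Q v P = Q v (\<partial>\<^sub>y P)\<close>, without boundary terms at \<open>y = 0\<close>. Hence the regularity of \<open>B\<close> and
  the bounds on its moments follow by bootstrapping, one derivative at a time. The bootstrap starts
  from the bound on the moments of \<open>B\<close> itself: after integration over \<open>y\<close> the Marchenko equation becomes
  a Volterra inequality, whose kernel is integrable after division by \<open>(1 + max 0 (- x)) ^ (s + 1)\<close>,
  and Gronwall's inequality applies. Applying \<open>T\<close> or \<open>Q\<close> gains one power of \<open>1 + max 0 (- x)\<close>, which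
  explains the exponent \<open>s\<close> for the derivatives. The case of \<open>B\<^sub>-\<close> follows by reflection.
\<close>

section \<open>Absolutely continuous functions\<close>

text \<open>The obstacle is the last derivative. The first derivatives of \<open>B\<close> contain
  \<open>V (x + y)\<close>, and the derivative of order \<open>n - 1\<close> of \<open>V\<close> is
  merely integrable. Hence the n-th derivative of \<open>B\<close> need not be continuous and exists
  only almost everywhere; an induction that treats all terms alike would stop at order
  \<open>n - 1\<close>. The integral operators behave better: if \<open>v\<close> has
  \<open>m\<close> weak derivatives and \<open>P\<close> is \<open>m\<close> times continuously
  differentiable, then so are \<open>T v P\<close> and \<open>Q v P\<close>, because the top
  derivative of \<open>v\<close> occurs only under an integral. So the bootstrap runs up to order
  \<open>m = n - 1\<close> among continuous kernels, and in the last step only the explicit term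
  \<open>V (x + y)\<close> is differentiated as an absolutely continuous function. Boundary terms
  are absent because, in the variable \<open>w = t - x\<close>, the jump of the kernel extended by
  zero sits at \<open>w = y\<close>, independently of \<open>x\<close>. Every constant depends on
  \<open>V\<close> only through one bound \<open>N\<close> for the weighted integrals of all its
  derivatives.\<close>

lemma ac_product_rule:
  fixes f g f' g' :: "real \<Rightarrow> real"
  assumes ab: "a \<le> b"
    and f': "set_integrable lborel {a..b} f'" and g': "set_integrable lborel {a..b} g'"
    and f: "\<And>c. c \<in> {a..b} \<Longrightarrow> f c - f a = (LINT t:{a..c}|lborel. f' t)"
    and g: "\<And>c. c \<in> {a..b} \<Longrightarrow> g c - g a = (LINT t:{a..c}|lborel. g' t)"
    and fm [measurable]: "f \<in> borel_measurable borel" and gm [measurable]: "g \<in> borel_measurable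
        borel"
  shows "f b * g b - f a * g a = (LINT t:{a..b}|lborel. f' t * g t + f t * g' t)"
proof -
  define F where "F t = indicator {a..b} t * f' t" for t
  define G where "G t = indicator {a..b} t * g' t" for t
  have F: "integrable lborel F" and G: "integrable lborel G"
    using f' g' by (simp_all add: F_def[abs_def] G_def[abs_def] set_integrable_def)
  have [measurable]: "F \<in> borel_measurable borel" "G \<in> borel_measurable borel"
    using F G by (auto dest: borel_measurable_integrable)
  have fF: "f c = f a + (\<integral>r. indicator {..c} r * F r \<partial>lborel)" if "c \<in> {a..b}" for c
  proof -
    have "(\<integral>r. indicator {..c} r * F r \<partial>lborel) = (LINT t:{a..c}|lborel. f' t)"
      unfolding set_lebesgue_integral_def using that
      by (intro Bochner_Integration.integral_cong) (auto simp: F_def indicator_def)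
    with f[OF that] show ?thesis by simp
  qed
  have gG: "g c = g a + (\<integral>r. indicator {..c} r * G r \<partial>lborel)" if "c \<in> {a..b}" for c
  proof -
    have "(\<integral>r. indicator {..c} r * G r \<partial>lborel) = (LINT t:{a..c}|lborel. g' t)"
      unfolding set_lebesgue_integral_def using that
      by (intro Bochner_Integration.integral_cong) (auto simp: G_def indicator_def)
    with g[OF that] show ?thesis by simp
  qed
  \<comment> \<open>Fubini on the square, cut along the diagonal: the triangle
    \<open>r \<le> t\<close> carries the integral of \<open>f' * (g - g a)\<close>, the triangle
    \<open>t \<le> r\<close> that of \<open>g' * (f - f a)\<close>, and the whole square has
    integral \<open>(f b - f a) * (g b - g a)\<close>.\<close>
  have FG: "integrable (lborel \<Otimes>\<^sub>M lborel) (\<lambda>(t,r). F t * G r)"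
  proof (rule lborel_pair.Fubini_integrable)
    show "integrable lborel (\<lambda>x. \<integral> y. norm (case (x, y) of (t, r) \<Rightarrow> F t * G r) \<partial>lborel)"
      using F by (simp add: abs_mult)
  qed (use G in auto)
  have FG1: "integrable (lborel \<Otimes>\<^sub>M lborel) (\<lambda>(t,r). indicator {r. r \<le> t} r * (F t * G r))"
    by (rule Bochner_Integration.integrable_bound[OF FG]) (auto simp: indicator_def abs_mult)
  have FG2: "integrable (lborel \<Otimes>\<^sub>M lborel) (\<lambda>(t,r). indicator {r. t \<le> r} r * (F t * G r))"
    by (rule Bochner_Integration.integrable_bound[OF FG]) (auto simp: indicator_def abs_mult)
  have bdF: "\<bar>\<integral>r. indicator {..c} r * F r \<partial>lborel\<bar> \<le> (\<integral>r. \<bar>F r\<bar> \<partial>lborel)" for c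
  proof -
    have "\<bar>\<integral>r. indicator {..c} r * F r \<partial>lborel\<bar> \<le> (\<integral>r. \<bar>indicator {..c} r * F r\<bar> \<partial>lborel)"
      by (rule integral_abs_bound)
    also have "\<dots> \<le> (\<integral>r. \<bar>F r\<bar> \<partial>lborel)"
      by (rule integral_mono_AE') (use F in \<open>auto simp: abs_mult indicator_def\<close>)
    finally show ?thesis .
  qed
  have bdG: "\<bar>\<integral>r. indicator {..c} r * G r \<partial>lborel\<bar> \<le> (\<integral>r. \<bar>G r\<bar> \<partial>lborel)" for c
  proof -
    have "\<bar>\<integral>r. indicator {..c} r * G r \<partial>lborel\<bar> \<le> (\<integral>r. \<bar>indicator {..c} r * G r\<bar> \<partial>lborel)"
      by (rule integral_abs_bound)
    also have "\<dots> \<le> (\<integral>r. \<bar>G r\<bar> \<partial>lborel)"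
      by (rule integral_mono_AE') (use G in \<open>auto simp: abs_mult indicator_def\<close>)
    finally show ?thesis .
  qed
  have [measurable]: "(\<lambda>t. \<integral>r. indicator {..t} r * G r \<partial>lborel) \<in> borel_measurable borel"
    "(\<lambda>t. \<integral>r. indicator {..t} r * F r \<partial>lborel) \<in> borel_measurable borel"
    by (simp_all add: indicator_def)
  have intFI: "integrable lborel (\<lambda>t. F t * (\<integral>r. indicator {..t} r * G r \<partial>lborel))"
    by (rule Bochner_Integration.integrable_bound[of _ "\<lambda>t. F t * (\<integral>r. \<bar>G r\<bar> \<partial>lborel)"])
       (use F bdG order_trans[OF bdG abs_ge_self] in \<open>auto simp: abs_mult intro!: mult_left_mono\<close>)
  have intGI: "integrable lborel (\<lambda>t. G t * (\<integral>r. indicator {..t} r * F r \<partial>lborel))"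
    by (rule Bochner_Integration.integrable_bound[of _ "\<lambda>t. G t * (\<integral>r. \<bar>F r\<bar> \<partial>lborel)"])
       (use G bdF order_trans[OF bdF abs_ge_self] in \<open>auto simp: abs_mult intro!: mult_left_mono\<close>)
  have "(LINT t:{a..b}|lborel. f' t * g t + f t * g' t) = (\<integral>t. F t * g t + G t * f t \<partial>lborel)"
    unfolding set_lebesgue_integral_def
    by (intro Bochner_Integration.integral_cong) (auto simp: F_def G_def indicator_def)
  also have "\<dots> = (\<integral>t. (F t * g a + F t * (\<integral>r. indicator {..t} r * G r \<partial>lborel)) +
      (G t * f a + G t * (\<integral>r. indicator {..t} r * F r \<partial>lborel)) \<partial>lborel)"
  proof (intro Bochner_Integration.integral_cong refl)
    fix t show "F t * g t + G t * f t = (F t * g a + F t * (\<integral>r. indicator {..t} r * G r \<partial>lborel)) +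
      (G t * f a + G t * (\<integral>r. indicator {..t} r * F r \<partial>lborel))"
    proof (cases "t \<in> {a..b}")
      case True then show ?thesis using fF[OF True] gG[OF True] by (simp add: algebra_simps)
    next
      case False then show ?thesis by (auto simp add: F_def G_def)
    qed
  qed
  also have "\<dots> = (\<integral>t. F t \<partial>lborel) * g a + (\<integral>t. F t * (\<integral>r. indicator {..t} r * G r \<partial>lborel) \<partial>lborel)
     + ((\<integral>t. G t \<partial>lborel) * f a + (\<integral>t. G t * (\<integral>r. indicator {..t} r * F r \<partial>lborel) \<partial>lborel))"
    using F G intFI intGI by simp
  also have "(\<integral>t. F t * (\<integral>r. indicator {..t} r * G r \<partial>lborel) \<partial>lborel)
     = (\<integral>t. \<integral>r. indicator {r. r \<le> t} r * (F t * G r) \<partial>lborel \<partial>lborel)"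
    unfolding Bochner_Integration.integral_mult_right_zero[symmetric]
    by (intro Bochner_Integration.integral_cong) (auto simp: indicator_def)
  also have "(\<integral>t. G t * (\<integral>r. indicator {..t} r * F r \<partial>lborel) \<partial>lborel)
     = (\<integral>r. \<integral>t. indicator {r. t \<le> r} r * (F t * G r) \<partial>lborel \<partial>lborel)"
    unfolding Bochner_Integration.integral_mult_right_zero[symmetric]
    by (intro Bochner_Integration.integral_cong) (auto simp: indicator_def)
  also have "\<dots> = (\<integral>t. \<integral>r. indicator {r. t \<le> r} r * (F t * G r) \<partial>lborel \<partial>lborel)"
    using lborel_pair.Fubini_integral[OF FG2] by simp
  also have "(\<integral>t. F t \<partial>lborel) * g a + (\<integral>t. \<integral>r. indicator {r. r \<le> t} r * (F t * G r) \<partial>lborel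
      \<partial>lborel)
     + ((\<integral>t. G t \<partial>lborel) * f a + \<dots>) =
     (\<integral>t. F t \<partial>lborel) * g a + (\<integral>t. G t \<partial>lborel) * f a + 
     ((\<integral>t. \<integral>r. indicator {r. r \<le> t} r * (F t * G r) \<partial>lborel \<partial>lborel) + 
      (\<integral>t. \<integral>r. indicator {r. t \<le> r} r * (F t * G r) \<partial>lborel \<partial>lborel))" by simp
  also have "((\<integral>t. \<integral>r. indicator {r. r \<le> t} r * (F t * G r) \<partial>lborel \<partial>lborel) + 
      (\<integral>t. \<integral>r. indicator {r. t \<le> r} r * (F t * G r) \<partial>lborel \<partial>lborel))
      = integral\<^sup>L (lborel \<Otimes>\<^sub>M lborel) (\<lambda>(t,r). indicator {r. r \<le> t} r * (F t * G r)) +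
        integral\<^sup>L (lborel \<Otimes>\<^sub>M lborel) (\<lambda>(t,r). indicator {r. t \<le> r} r * (F t * G r))"
    using lborel_pair.integral_fst'[OF FG1] lborel_pair.integral_fst'[OF FG2] by simp
  also have "\<dots> = integral\<^sup>L (lborel \<Otimes>\<^sub>M lborel) (\<lambda>p. (case p of (t,r) \<Rightarrow> indicator {r. r \<le> t} r * (F
      t * G r)) +
       (case p of (t,r) \<Rightarrow> indicator {r. t \<le> r} r * (F t * G r)))"
    by (rule Bochner_Integration.integral_add[symmetric]) (fact FG1 FG2)+
  also have "\<dots> = (\<integral>t. \<integral>r. indicator {r. r \<le> t} r * (F t * G r) + indicator {r. t \<le> r} r * (F t * G
      r) \<partial>lborel \<partial>lborel)"
    using lborel_pair.integral_fst'[OF Bochner_Integration.integrable_add[OF FG1 FG2]] by simp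
  also have "\<dots> = (\<integral>t. \<integral>r. F t * G r \<partial>lborel \<partial>lborel)"
  proof (rule Bochner_Integration.integral_cong[OF refl], rule integral_cong_AE)
    fix t show "AE r in lborel. indicator {r. r \<le> t} r * (F t * G r) + indicator {r. t \<le> r} r * (F t
        * G r) = F t * G r"
      using AE_lborel_singleton[of t] by eventually_elim (auto simp: indicator_def)
  qed (auto simp: indicator_def)
  also have "\<dots> = (\<integral>t. F t \<partial>lborel) * (\<integral>r. G r \<partial>lborel)" by simp
  also have "(\<integral>t. F t \<partial>lborel) = f b - f a"
    using f[of b] ab by (simp add: F_def set_lebesgue_integral_def)
  also have "(\<integral>t. G t \<partial>lborel) = g b - g a"
    using g[of b] ab by (simp add: G_def set_lebesgue_integral_def)
  finally show ?thesis by (simp add: algebra_simps)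
qed

lemma deriv_of_ac_continuous:
  fixes F G :: "real \<Rightarrow> real"
  assumes S: "open S" "x \<in> S" and cont: "continuous_on S G"
    and F: "\<And>a b. a \<le> b \<Longrightarrow> {a..b} \<subseteq> S \<Longrightarrow> F b - F a = (LINT t:{a..b}|lborel. G t)"
  shows "(F has_real_derivative G x) (at x)"
proof -
  obtain e where e: "e > 0" "cball x e \<subseteq> S" using S open_contains_cball by blast
  define a b where "a = x - e" and "b = x + e"
  have ab: "a < x" "x < b" "{a..b} \<subseteq> S" using e by (auto simp: a_def b_def cball_def dist_real_def
      subset_eq abs_le_iff)
  have c: "continuous_on {a..b} G" using cont ab(3) continuous_on_subset by blast
  have "((\<lambda>u. LBINT y=a..u. G y) has_vector_derivative (G x)) (at x within {a..b})"
    by (rule interval_integral_FTC2) (use ab c in auto)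
  then have "((\<lambda>u. LBINT y=a..u. G y) has_vector_derivative (G x)) (at x)"
    using ab by (simp add: at_within_Icc_at)
  then have "((\<lambda>u. F a + (LBINT y=a..u. G y)) has_real_derivative (G x)) (at x)"
    unfolding has_real_derivative_iff_has_vector_derivative
    by (auto intro!: derivative_eq_intros)
  then show ?thesis
  proof (rule has_field_derivative_transform_within_open[of _ _ _ "{a<..<b}"])
    fix y assume y: "y \<in> {a<..<b}"
    have "(LBINT t=a..y. G t) = (LINT t:{a..y}|lborel. G t)"
      using y by (simp add: interval_integral_Icc)
    then show "F a + (LBINT t=a..y. G t) = F y" using F[of a y] y ab(3) by fastforce
  qed (use ab in auto)
qed

text \<open>Lebesgue's differentiation theorem is applied to cubes with lower corner
  \<open>x\<close>, which gives the right quotients. The left quotients are right quotients of the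
  reflected function, at the cost of a second exceptional set, the reflection of
  \<open>N'\<close>.\<close>

lemma integral_quotient_tendsto_AE:
  fixes f :: "real \<Rightarrow> real"
  assumes f: "integrable lebesgue f"
  shows "AE x in lebesgue. \<forall>e>0. \<exists>d>0. \<forall>h. 0 < h \<and> h < d \<longrightarrow>
    \<bar>(LINT t:{x..x+h}|lebesgue. f t) / h - f x\<bar> < e \<and>
    \<bar>(LINT t:{x-h..x}|lebesgue. f t) / h - f x\<bar> < e"
proof -
  have ab: "f absolutely_integrable_on UNIV" using f by (simp add: set_integrable_def)
  have abs: "f absolutely_integrable_on {a..b}" for a b
    by (rule set_integrable_subset[OF ab]) auto
  have hk: "f integrable_on {a..b}" for a b
    using abs set_lebesgue_integral_eq_integral(1) by blast
  have hk': "(\<lambda>x. f (-x)) integrable_on {a..b}" for a b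
    using hk[of "-b" "-a"] by (metis Henstock_Kurzweil_Integration.integrable_reflect_real
        add.inverse_inverse)
  obtain N where N: "negligible N"
    "\<And>x e. \<lbrakk>x \<notin> N; 0 < e\<rbrakk> \<Longrightarrow> \<exists>d>0. \<forall>h. 0 < h \<and> h < d \<longrightarrow>
       norm (integral (cbox x (x + h *\<^sub>R One)) f /\<^sub>R h ^ DIM(real) - f x) < e"
    using integrable_ccontinuous_explicit[of f] hk by (metis box_real(2))
  obtain N' where N': "negligible N'"
    "\<And>x e. \<lbrakk>x \<notin> N'; 0 < e\<rbrakk> \<Longrightarrow> \<exists>d>0. \<forall>h. 0 < h \<and> h < d \<longrightarrow>
       norm (integral (cbox x (x + h *\<^sub>R One)) (\<lambda>x. f (-x)) /\<^sub>R h ^ DIM(real) - f (-x)) < e"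
    using integrable_ccontinuous_explicit[of "\<lambda>x. f (-x)"] hk' by (metis box_real(2))
  have neg: "negligible (N \<union> uminus ` N')"
    using N(1) negligible_differentiable_image_negligible[OF order_refl N'(1), of uminus]
    by (simp add: differentiable_on_minus)
  then have "AE x in lebesgue. x \<notin> N \<union> uminus ` N'"
    using AE_not_in negligible_iff_null_sets by blast
  then show ?thesis
  proof eventually_elim
    case (elim x)
    then have x: "x \<notin> N" "-x \<notin> N'" by (auto simp: image_iff)
    show ?case
    proof (intro allI impI)
      fix e :: real assume e: "e > 0"
      obtain d1 where d1: "d1 > 0" "\<And>h. 0 < h \<and> h < d1 \<Longrightarrow> \<bar>integral {x..x+h} f / h - f x\<bar> < e"
        using N(2)[OF x(1) e] by (auto simp: divide_inverse mult.commute)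
      obtain d2 where d2: "d2 > 0" "\<And>h. 0 < h \<and> h < d2 \<Longrightarrow> \<bar>integral {-x..-x+h} (\<lambda>x. f (-x)) / h - f
          x\<bar> < e"
        using N'(2)[OF x(2) e] by (auto simp: divide_inverse mult.commute)
      have r: "integral {-x..h-x} (\<lambda>x. f (-x)) = integral {x-h..x} f" for h
        using Henstock_Kurzweil_Integration.integral_reflect_real[of x "x-h" f] by simp
      have l: "(LINT t:{a..b}|lebesgue. f t) = integral {a..b} f" for a b
        using abs set_lebesgue_integral_eq_integral(2) by blast
      show "\<exists>d>0. \<forall>h. 0 < h \<and> h < d \<longrightarrow> \<bar>(LINT t:{x..x+h}|lebesgue. f t) / h - f x\<bar> < e \<and>
          \<bar>(LINT t:{x-h..x}|lebesgue. f t) / h - f x\<bar> < e"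
        using d1 d2 by (intro exI[of _ "min d1 d2"]) (auto simp: l r)
    qed
  qed
qed

text \<open>\<open>G\<close> is only locally integrable on \<open>S\<close>, so Lebesgue
  differentiation is applied to its restrictions to compact intervals. Rational end points suffice
  to exhaust the open set \<open>S\<close>, so that only countably many null sets are
  discarded.\<close>

lemma ac_has_derivative_AE:
  fixes F G :: "real \<Rightarrow> real"
  assumes S: "open S" "is_interval S"
    and F: "\<And>a b. a \<in> S \<Longrightarrow> b \<in> S \<Longrightarrow> a \<le> b \<Longrightarrow> set_integrable lebesgue {a..b} G \<and> 
       F b - F a = (LINT t:{a..b}|lebesgue. G t)"
  shows "AE x in lebesgue. x \<in> S \<longrightarrow> (F has_real_derivative G x) (at x)"
proof -
  have *: "AE x in lebesgue. p < x \<and> x < q \<longrightarrow> (F has_real_derivative G x) (at x)"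
    if pq: "p \<in> S" "q \<in> S" for p q
  proof (cases "p < q")
    case True
    define g where "g x = indicator {p..q} x * G x" for x
    have "integrable lebesgue g" using F[OF pq] True by (simp add: g_def[abs_def]
        set_integrable_def)
    from integral_quotient_tendsto_AE[OF this] show ?thesis
    proof eventually_elim
      case (elim x)
      have gG: "(LINT t:{a..b}|lebesgue. g t) = F b - F a" if "p \<le> a" "a \<le> b" "b \<le> q" for a b
      proof -
        have "a \<in> S" "b \<in> S" using that pq S(2) by (meson mem_is_interval_1_I order_trans)+
        then have "F b - F a = (LINT t:{a..b}|lebesgue. G t)" using F that by blast
        also have "\<dots> = (LINT t:{a..b}|lebesgue. g t)" unfolding set_lebesgue_integral_def
          by (intro Bochner_Integration.integral_cong) (use that in \<open>auto simp: g_def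
              indicator_def\<close>)
        finally show ?thesis by simp
      qed
      show ?case
      proof
        assume x: "p < x \<and> x < q"
        then have gx: "g x = G x" by (simp add: g_def)
        show "(F has_real_derivative G x) (at x)"
          unfolding has_field_derivative_iff Lim_at dist_real_def
        proof (intro allI impI)
          fix e :: real assume e: "e > 0"
          obtain d where d: "d > 0" "\<And>h. 0 < h \<Longrightarrow> h < d \<Longrightarrow>
            \<bar>(LINT t:{x..x+h}|lebesgue. g t) / h - g x\<bar> < e \<and>
            \<bar>(LINT t:{x-h..x}|lebesgue. g t) / h - g x\<bar> < e"
            using elim e by blast
          show "\<exists>d>0. \<forall>y. 0 < \<bar>y - x\<bar> \<and> \<bar>y - x\<bar> < d \<longrightarrow> \<bar>(F y - F x) / (y - x) - G x\<bar> < e"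
          proof (intro exI[of _ "min d (min (x - p) (q - x))"] conjI allI impI)
            fix y assume y: "0 < \<bar>y - x\<bar> \<and> \<bar>y - x\<bar> < min d (min (x - p) (q - x))"
            show "\<bar>(F y - F x) / (y - x) - G x\<bar> < e"
            proof (cases "x < y")
              case True
              then show ?thesis using d(2)[of "y - x"] gG[of x y] y x gx by (auto simp: abs_if)
            next
              case False
              then have "x > y" using y by auto
              then have "\<bar>(F x - F y) / (x - y) - G x\<bar> < e" 
                using d(2)[of "x - y"] gG[of y x] y x gx by (auto simp: abs_if)
              moreover have "(F x - F y) / (x - y) = (F y - F x) / (y - x)"
                by (metis minus_diff_eq minus_divide_divide)
              ultimately show ?thesis by simp
            qed
          qed (use d x in auto)
        qed
      qed
    qed
  qed auto
  have "AE x in lebesgue. \<forall>p\<in>\<rat>\<inter>S. \<forall>q\<in>\<rat>\<inter>S. p < x \<and> x < q \<longrightarrow> (F has_real_derivative G x) (at x)"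
    using * by (intro AE_ball_countable[THEN iffD2] ballI) (auto simp: countable_rat countable_Int1)
  then show ?thesis
  proof eventually_elim
    case (elim x)
    show ?case
    proof
      assume "x \<in> S"
      then obtain e where e: "e > 0" "ball x e \<subseteq> S" using S(1) open_contains_ball by blast
      obtain p where p: "p \<in> \<rat>" "x - e < p" "p < x" using Rats_dense_in_real[of "x-e" x] e by auto
      obtain q where q: "q \<in> \<rat>" "x < q" "q < x + e" using Rats_dense_in_real[of x "x+e"] e by auto
      have "p \<in> S" "q \<in> S" using p q e by (auto simp: subset_eq dist_real_def)
      then show "(F has_real_derivative G x) (at x)" using elim p q by blast
    qed
  qed
qed

section \<open>Kernels on the half-plane and their moments\<close>

text \<open>The growth factor of the theorem for the plus case; the minus case evaluates it at
  \<open>- x\<close>.\<close>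

definition left_weight :: "real \<Rightarrow> real" where "left_weight x = 1 + max 0 (- x)"

lemma left_weight_ge_1: "1 \<le> left_weight x" by (simp add: left_weight_def)

lemma left_weight_le: "left_weight x \<le> 1 + \<bar>x\<bar>" by (simp add: left_weight_def)

text \<open>
  This trades the growth of the moments as \<open>x \<rightarrow> -\<infinity>\<close> for the weight
  of the potential.
\<close>
lemma left_weight_shift: "x \<le> t \<Longrightarrow> (1 + (t - x)) * left_weight t \<le> left_weight x * (1 + \<bar>t\<bar>)"
proof (cases "t < 0")
  case True
  assume "x \<le> t"
  with True have "(1 + (t - x)) * (1 - t) \<le> (1 - x) * (1 - t)" by (intro mult_right_mono) auto
  with True \<open>x \<le> t\<close> show ?thesis by (simp add: left_weight_def)
next
  case False
  assume "x \<le> t"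
  have "1 + (t - x) \<le> (1 + max 0 (-x)) * (1 + t)"
    using False by (simp add: max_def algebra_simps mult_nonneg_nonpos)
  with False show ?thesis by (simp add: left_weight_def)
qed

text \<open>Only \<open>s\<close> of the \<open>s + 1\<close> factors \<open>left_weight t\<close>
  are paired with a factor \<open>1 + (t - x)\<close> and so cost a factor
  \<open>left_weight x\<close>. The last one is absorbed by the weight of the potential alone; this
  is where one power of \<open>left_weight\<close> is gained.\<close>

lemma left_weight_shift_power:
  assumes "x \<le> t"
  shows "(1 + (t - x)) ^ s * left_weight t ^ (s + 1) \<le> left_weight x ^ s * (1 + \<bar>t\<bar>) ^ (s + 1)"
proof -
  have "(1 + (t - x)) ^ s * left_weight t ^ (s + 1) = ((1 + (t - x)) * left_weight t) ^ s *
      left_weight t"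
    by (simp add: power_mult_distrib)
  also have "\<dots> \<le> (left_weight x * (1 + \<bar>t\<bar>)) ^ s * (1 + \<bar>t\<bar>)"
    using assms left_weight_ge_1[of t] left_weight_ge_1[of x]
    by (intro mult_mono[OF power_mono[OF left_weight_shift] left_weight_le]) (auto intro!:
        mult_nonneg_nonneg)
  finally show ?thesis by (simp add: power_mult_distrib mult_ac)
qed

text \<open>\<open>N\<close> is any bound rather than the integral itself, so that one number serves
  a potential and all its derivatives. Borel measurability is demanded because Fubini is used for
  products of \<open>lborel\<close>.\<close>

definition weighted :: "nat \<Rightarrow> real \<Rightarrow> (real \<Rightarrow> real) \<Rightarrow> bool" where
  "weighted s N v \<longleftrightarrow> v \<in> borel_measurable borel \<and> 0 \<le> N \<and>
     (\<integral>\<^sup>+t. ennreal ((1 + \<bar>t\<bar>) ^ (s + 1) * \<bar>v t\<bar>) \<partial>lborel) \<le> ennreal N"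

text \<open>The weight is a power of \<open>1 + \<bar>y\<bar>\<close> instead of
  \<open>\<bar>y\<bar>\<close>: it is submultiplicative, \<open>1 + \<bar>a + b\<bar> \<le> (1 +
  \<bar>a\<bar>) * (1 + \<bar>b\<bar>)\<close>, as the shift along characteristics requires. With
  values in \<open>ennreal\<close> the moment makes sense before its finiteness is known.\<close>

definition nn_moment :: "nat \<Rightarrow> (real \<Rightarrow> real) \<Rightarrow> ennreal" where
  "nn_moment s h = (\<integral>\<^sup>+y. ennreal ((1 + \<bar>y\<bar>) ^ s * \<bar>h y\<bar>) \<partial>lborel)"

text \<open>
  Kernels are extended by zero to \<open>y \<le> 0\<close>. The local bound carries no constant: it
  only serves to make integrals converge.
\<close>
definition admissible :: "(real \<Rightarrow> real \<Rightarrow> real) \<Rightarrow> bool" where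
  "admissible P \<longleftrightarrow> (\<forall>x y. y \<le> 0 \<longrightarrow> P x y = 0) \<and>
     continuous_on {q. 0 < snd q} (\<lambda>q. P (fst q) (snd q)) \<and>
     (\<forall>x0 Y. \<exists>K. \<forall>x\<ge>x0. \<forall>y\<le>Y. \<bar>P x y\<bar> \<le> K)"

text \<open>
  Since \<open>P\<close> vanishes below the axis, only \<open>x \<le> t < x + y\<close> contributes:
  the integral runs along the characteristic through \<open>(x, y)\<close>.
\<close>
definition char_int :: "(real \<Rightarrow> real) \<Rightarrow> (real \<Rightarrow> real \<Rightarrow> real) \<Rightarrow> real \<Rightarrow> real \<Rightarrow> real" where
  "char_int v P x y = (\<integral>t. indicator {x..} t * (v t * P t (x + y - t)) \<partial>lborel)"

definition tail_int :: "(real \<Rightarrow> real) \<Rightarrow> (real \<Rightarrow> real \<Rightarrow> real) \<Rightarrow> real \<Rightarrow> real \<Rightarrow> real" where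
  "tail_int v P x y = (\<integral>t. indicator {x..} t * (v t * P t y) \<partial>lborel)"

text \<open>Up to sign, the free term of the differentiated Marchenko equation, cut off at the axis
  like all other kernels.\<close>

definition shift :: "(real \<Rightarrow> real) \<Rightarrow> real \<Rightarrow> real \<Rightarrow> real" where
  "shift v x y = indicator {0<..} y * v (x + y)"

lemma weighted_measurable: "weighted s N v \<Longrightarrow> v \<in> borel_measurable borel"
  by (simp add: weighted_def)

lemma weighted_integrable:
  assumes "weighted s N v" shows "integrable lborel v"
proof (rule integrableI_bounded)
  have "(\<integral>\<^sup>+t. ennreal (norm (v t)) \<partial>lborel) \<le> (\<integral>\<^sup>+t. ennreal ((1 + \<bar>t\<bar>) ^ (s + 1) * \<bar>v t\<bar>)
      \<partial>lborel)"
  proof (intro nn_integral_mono ennreal_leI)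
    fix t have "1 * \<bar>v t\<bar> \<le> (1 + \<bar>t\<bar>) ^ (s + 1) * \<bar>v t\<bar>"
      by (intro mult_right_mono one_le_power) auto
    then show "norm (v t) \<le> (1 + \<bar>t\<bar>) ^ (s + 1) * \<bar>v t\<bar>" by simp
  qed
  also have "\<dots> \<le> ennreal N" using assms by (simp add: weighted_def)
  finally show "(\<integral>\<^sup>+t. ennreal (norm (v t)) \<partial>lborel) < \<infinity>" using order_le_less_trans by fastforce
qed (use assms in \<open>simp add: weighted_def\<close>)

text \<open>The moment bounds of the kernels built from \<open>v\<close> end in this form: Tonelli
  leaves an integral over \<open>t\<close> whose factor \<open>g t\<close> grows at most like the
  weight of the potential.\<close>

lemma weighted_nn_integral_le:
  assumes v: "weighted s N v" and C: "0 \<le> C"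
    and g: "\<And>t. x \<le> t \<Longrightarrow> g t \<le> ennreal (C * (1 + \<bar>t\<bar>) ^ (s + 1))"
  shows "(\<integral>\<^sup>+t. indicator {x..} t * (ennreal \<bar>v t\<bar> * g t) \<partial>lborel) \<le> ennreal (C * N)"
proof -
  have [measurable]: "v \<in> borel_measurable borel" using v by (rule weighted_measurable)
  have "(\<integral>\<^sup>+t. indicator {x..} t * (ennreal \<bar>v t\<bar> * g t) \<partial>lborel)
      \<le> (\<integral>\<^sup>+t. ennreal C * ennreal ((1 + \<bar>t\<bar>) ^ (s + 1) * \<bar>v t\<bar>) \<partial>lborel)"
  proof (intro nn_integral_mono)
    fix t
    show "indicator {x..} t * (ennreal \<bar>v t\<bar> * g t) \<le> ennreal C * ennreal ((1 + \<bar>t\<bar>) ^ (s + 1) * \<bar>v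
        t\<bar>)"
    proof (cases "x \<le> t")
      case True
      have "ennreal \<bar>v t\<bar> * g t \<le> ennreal \<bar>v t\<bar> * ennreal (C * (1 + \<bar>t\<bar>) ^ (s + 1))"
        using g[OF True] by (intro mult_left_mono) auto
      also have "\<dots> = ennreal C * ennreal ((1 + \<bar>t\<bar>) ^ (s + 1) * \<bar>v t\<bar>)"
        using C by (simp add: ennreal_mult[symmetric] mult_ac)
      finally show ?thesis using True by simp
    qed simp
  qed
  also have "\<dots> = ennreal C * (\<integral>\<^sup>+t. ennreal ((1 + \<bar>t\<bar>) ^ (s + 1) * \<bar>v t\<bar>) \<partial>lborel)"
    by (intro nn_integral_cmult) auto
  also have "\<dots> \<le> ennreal C * ennreal N"
    using v by (intro mult_left_mono) (auto simp: weighted_def)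
  also have "\<dots> = ennreal (C * N)" using C v by (simp add: ennreal_mult weighted_def)
  finally show ?thesis .
qed

section \<open>Admissible kernels and their closure properties\<close>

lemma admissible_zero: "admissible P \<Longrightarrow> y \<le> 0 \<Longrightarrow> P x y = 0" by (simp add: admissible_def)

lemma admissible_bounded:
  assumes "admissible P" obtains K where "0 \<le> K" "\<And>x y. x0 \<le> x \<Longrightarrow> y \<le> Y \<Longrightarrow> \<bar>P x y\<bar> \<le> K"
proof -
  obtain K where "\<forall>x\<ge>x0. \<forall>y\<le>Y. \<bar>P x y\<bar> \<le> K" using assms unfolding admissible_def by meson
  then show ?thesis by (intro that[of "max 0 K"]) (auto simp: le_max_iff_disj)
qed

lemma open_upper: "open {q::real\<times>real. 0 < snd q}"
  by (intro open_Collect_less continuous_intros)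

text \<open>\<open>y = 0\<close> is excluded because a kernel may jump there. For
  \<open>y < 0\<close> the points eventually lie where the kernel vanishes.\<close>

lemma admissible_tendsto:
  assumes P: "admissible P" and X: "(X \<longlongrightarrow> x) F" and Y: "(Y \<longlongrightarrow> y) F" and y: "y \<noteq> 0"
  shows "((\<lambda>n. P (X n) (Y n)) \<longlongrightarrow> P x y) F"
proof (cases "y > 0")
  case True
  then have "isCont (\<lambda>q. P (fst q) (snd q)) (x, y)"
    using P open_upper by (auto simp: admissible_def continuous_on_eq_continuous_at)
  from isCont_tendsto_compose[OF this tendsto_Pair[OF X Y]] show ?thesis by simp
next
  case False
  then have "eventually (\<lambda>n. Y n < 0) F" using order_tendstoD(2)[OF Y, of 0] y by simp
  then have "eventually (\<lambda>n. P (X n) (Y n) = P x y) F"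
    by eventually_elim (use False admissible_zero[OF P] in auto)
  then show ?thesis by (rule tendsto_eventually)
qed

lemma admissible_measurable_prod: 
  assumes "admissible P" shows "case_prod P \<in> borel_measurable (borel \<Otimes>\<^sub>M borel)"
proof -
  have "(\<lambda>q. if q \<in> {q. 0 < snd q} then P (fst q) (snd q) else 0) \<in> borel_measurable borel"
    using assms open_upper
    by (intro borel_measurable_continuous_on_if) (auto simp: admissible_def)
  also have "(\<lambda>q. if q \<in> {q. 0 < snd q} then P (fst q) (snd q) else 0) = case_prod P"
    using admissible_zero[OF assms] by (auto simp: fun_eq_iff)
  finally show ?thesis by (simp add: borel_prod)
qed

lemma admissibleI:
  assumes "\<And>x y. y \<le> 0 \<Longrightarrow> P x y = 0"
    and "\<And>X Y x y. X \<longlonglongrightarrow> x \<Longrightarrow> Y \<longlonglongrightarrow> y \<Longrightarrow> (\<And>n. 0 < Y n) \<Longrightarrow> 0 < y \<Longrightarrow> (\<lambda>n. P (X n) (Y n)) \<longlonglongrightarrow> P x y"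
    and "\<And>x0 Y. \<exists>K. \<forall>x\<ge>x0. \<forall>y\<le>Y. \<bar>P x y\<bar> \<le> K"
  shows "admissible P"
  unfolding admissible_def
proof (intro conjI)
  show "continuous_on {q. 0 < snd q} (\<lambda>q. P (fst q) (snd q))"
  proof (rule continuous_on_sequentiallyI)
    fix u a assume u: "\<forall>n. u n \<in> {q::real\<times>real. 0 < snd q}" "a \<in> {q::real\<times>real. 0 < snd q}" "u \<longlonglongrightarrow> a"
    show "(\<lambda>n. P (fst (u n)) (snd (u n))) \<longlonglongrightarrow> P (fst a) (snd a)"
      by (rule assms(2)) (use u in \<open>auto intro: tendsto_fst tendsto_snd\<close>)
  qed
qed (use assms in auto)

lemma admissible_add: "admissible P \<Longrightarrow> admissible R \<Longrightarrow> admissible (\<lambda>x y. P x y + R x y)"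
proof (rule admissibleI)
  assume P: "admissible P" and R: "admissible R"
  show "P x y + R x y = 0" if "y \<le> 0" for x y using that P R by (simp add: admissible_zero)
  show "(\<lambda>n. P (X n) (Y n) + R (X n) (Y n)) \<longlonglongrightarrow> P x y + R x y"
    if "X \<longlonglongrightarrow> x" "Y \<longlonglongrightarrow> y" "0 < y" for X Y x y
    using that by (intro tendsto_add[OF admissible_tendsto[OF P that(1,2)] admissible_tendsto[OF R
        that(1,2)]]) auto
  fix x0 Y
  obtain K where K: "\<And>x y. x0 \<le> x \<Longrightarrow> y \<le> Y \<Longrightarrow> \<bar>P x y\<bar> \<le> K" using admissible_bounded[OF P] by blast
  obtain L where L: "\<And>x y. x0 \<le> x \<Longrightarrow> y \<le> Y \<Longrightarrow> \<bar>R x y\<bar> \<le> L" using admissible_bounded[OF R] by blast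
  show "\<exists>K. \<forall>x\<ge>x0. \<forall>y\<le>Y. \<bar>P x y + R x y\<bar> \<le> K"
    by (intro exI[of _ "K + L"] allI impI order_trans[OF abs_triangle_ineq add_mono[OF K L]])
qed

lemma admissible_uminus: "admissible P \<Longrightarrow> admissible (\<lambda>x y. - P x y)"
  by (auto simp: admissible_def intro: continuous_on_minus)

lemma admissible_mult_left:
  assumes P: "admissible P" and v: "continuous_on UNIV v" and K: "\<And>x. \<bar>v x\<bar> \<le> K"
  shows "admissible (\<lambda>x y. v x * P x y)"
proof (rule admissibleI)
  fix X Y :: "nat \<Rightarrow> real" and x y assume *: "X \<longlonglongrightarrow> x" "Y \<longlonglongrightarrow> y" "\<And>n. 0 < Y n" "0 < (y::real)"
  then have "(\<lambda>n. v (X n)) \<longlonglongrightarrow> v x"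
    using v continuous_on_tendsto_compose[of UNIV v X x] by auto
  with * show "(\<lambda>n. v (X n) * P (X n) (Y n)) \<longlonglongrightarrow> v x * P x y"
    by (intro tendsto_mult admissible_tendsto[OF P]) auto
next
  fix x0 Y
  obtain L where "0 \<le> L" "\<And>x y. x0 \<le> x \<Longrightarrow> y \<le> Y \<Longrightarrow> \<bar>P x y\<bar> \<le> L" using admissible_bounded[OF P] by
      blast
  then show "\<exists>K. \<forall>x\<ge>x0. \<forall>y\<le>Y. \<bar>v x * P x y\<bar> \<le> K"
    using K by (intro exI[of _ "K * L"]) (auto simp: abs_mult intro!: mult_mono order_trans[OF
        abs_ge_zero K])
qed (use admissible_zero[OF P] in auto)

lemma admissible_shift:
  assumes v: "continuous_on UNIV v" and K: "\<And>x. \<bar>v x\<bar> \<le> K"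
  shows "admissible (shift v)"
proof (rule admissibleI)
  fix X Y :: "nat \<Rightarrow> real" and x y assume *: "X \<longlonglongrightarrow> x" "Y \<longlonglongrightarrow> y" "\<And>n. 0 < Y n" "0 < (y::real)"
  then have "(\<lambda>n. v (X n + Y n)) \<longlonglongrightarrow> v (x + y)"
    using v continuous_on_tendsto_compose[of UNIV v "\<lambda>n. X n + Y n" "x + y"] by (auto intro!:
        tendsto_add)
  with * show "(\<lambda>n. shift v (X n) (Y n)) \<longlonglongrightarrow> shift v x y" by (simp add: shift_def)
next
  fix x0 Y show "\<exists>K. \<forall>x\<ge>x0. \<forall>y\<le>Y. \<bar>shift v x y\<bar> \<le> K"
    using K by (intro exI[of _ K]) (auto simp: shift_def indicator_def intro: order_trans[OF
        abs_ge_zero K])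
qed (auto simp: shift_def)

section \<open>Integration of a kernel along lines\<close>

lemma abs_mult_le: "0 \<le> K \<Longrightarrow> \<bar>p\<bar> \<le> K \<Longrightarrow> \<bar>v * p\<bar> \<le> K * \<bar>v::real\<bar>"
  by (simp add: abs_mult mult.commute mult_right_mono)

lemma dominated_integrable:
  fixes g v :: "real \<Rightarrow> real"
  assumes v: "integrable lborel v" and g: "g \<in> borel_measurable borel"
    and le: "\<And>t. \<bar>g t\<bar> \<le> K * \<bar>v t\<bar>"
  shows "integrable lborel g" "\<bar>integral\<^sup>L lborel g\<bar> \<le> K * (\<integral>t. \<bar>v t\<bar> \<partial>lborel)"
proof -
  have Kv: "integrable lborel (\<lambda>t. K * \<bar>v t\<bar>)" using v by simp
  have nn: "0 \<le> K * \<bar>v t\<bar>" for t using le[of t] by linarith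
  show i: "integrable lborel g"
    by (rule Bochner_Integration.integrable_bound[OF Kv]) (use g le in \<open>auto intro!: AE_I2
        order_trans[OF le abs_ge_self]\<close>)
  have "\<bar>integral\<^sup>L lborel g\<bar> \<le> (\<integral>t. \<bar>g t\<bar> \<partial>lborel)" by (rule integral_abs_bound)
  also have "\<dots> \<le> (\<integral>t. K * \<bar>v t\<bar> \<partial>lborel)" using i Kv le by (intro integral_mono) auto
  finally show "\<bar>integral\<^sup>L lborel g\<bar> \<le> K * (\<integral>t. \<bar>v t\<bar> \<partial>lborel)" by simp
qed

text \<open>\<open>c = 1\<close> follows the characteristics and \<open>c = 0\<close> the horizontal
  lines, so that both integral operators share one proof of admissibility. For
  \<open>0 \<le> c\<close> the second argument never exceeds \<open>y\<close>, which makes the local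
  bound of \<open>P\<close> applicable on the whole unbounded range of \<open>t\<close>.\<close>

definition slope_int :: "real \<Rightarrow> (real \<Rightarrow> real) \<Rightarrow> (real \<Rightarrow> real \<Rightarrow> real) \<Rightarrow> real \<Rightarrow> real \<Rightarrow> real" where
  "slope_int c v P x y = (\<integral>t. indicator {x..} t * (v t * P t (y + c * (x - t))) \<partial>lborel)"

lemma char_int_slope_int: "char_int v P = slope_int 1 v P"
  by (intro ext) (simp add: char_int_def slope_int_def algebra_simps)

lemma tail_int_slope_int: "tail_int v P = slope_int 0 v P"
  by (intro ext) (simp add: tail_int_def slope_int_def)

lemma slope_int_integrable:
  assumes P: "admissible P" and v: "integrable lborel v" and c: "0 \<le> c"
  shows "integrable lborel (\<lambda>t. indicator {x..} t * (v t * P t (y + c * (x - t))))"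
proof -
  have [measurable]: "case_prod P \<in> borel_measurable (borel \<Otimes>\<^sub>M borel)" using P by (rule
      admissible_measurable_prod)
  have [measurable]: "v \<in> borel_measurable borel" using v by (simp add: borel_measurable_integrable)
  obtain K where K: "0 \<le> K" "\<And>t z. x \<le> t \<Longrightarrow> z \<le> y \<Longrightarrow> \<bar>P t z\<bar> \<le> K" using admissible_bounded[OF P] by
      blast
  show ?thesis
    by (rule dominated_integrable(1)[OF v, of _ K])
       (use K c in \<open>auto simp: indicator_def mult_nonneg_nonpos intro!: abs_mult_le\<close>)
qed

lemma char_int_integrable:
  "admissible P \<Longrightarrow> integrable lborel v \<Longrightarrow> integrable lborel (\<lambda>t. indicator {x..} t * (v t * P t (x + y
      - t)))"
  using slope_int_integrable[of P v 1 x y] by (simp add: algebra_simps)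

lemma tail_int_integrable:
  "admissible P \<Longrightarrow> integrable lborel v \<Longrightarrow> integrable lborel (\<lambda>t. indicator {x..} t * (v t * P t y))"
  using slope_int_integrable[of P v 0 x y] by simp

lemma indicator_atLeast_tendsto:
  fixes X :: "nat \<Rightarrow> real"
  assumes "X \<longlonglongrightarrow> x" "t \<noteq> x"
  shows "(\<lambda>n. indicator {X n..} t :: real) \<longlonglongrightarrow> indicator {x..} t"
proof (rule tendsto_eventually)
  show "eventually (\<lambda>n. indicator {X n..} t = (indicator {x..} t :: real)) sequentially"
  proof (cases "x < t")
    case True
    show ?thesis using order_tendstoD(2)[OF assms(1) True]
      by (rule eventually_mono) (use True in auto)
  next
    case False
    with assms have "t < x" by simp
    show ?thesis using order_tendstoD(1)[OF assms(1) \<open>t < x\<close>]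
      by (rule eventually_mono) (use \<open>t < x\<close> in auto)
  qed
qed

lemma bounded_sequences:
  fixes X :: "nat \<Rightarrow> real"
  assumes "X \<longlonglongrightarrow> x" obtains L where "\<And>n. \<bar>X n\<bar> \<le> L"
  using convergent_imp_Bseq[OF convergentI[OF assms]] by (auto simp: Bseq_def)

lemma admissible_slope_int:
  assumes P: "admissible P" and v: "integrable lborel v" and c: "0 \<le> c"
  shows "admissible (slope_int c v P)"
proof (rule admissibleI)
  have [measurable]: "case_prod P \<in> borel_measurable (borel \<Otimes>\<^sub>M borel)" using P by (rule
      admissible_measurable_prod)
  have [measurable]: "v \<in> borel_measurable borel" using v by (simp add: borel_measurable_integrable)
  have below: "y + c * (x - t) \<le> y" if "x \<le> t" for x y t
    using that c by (simp add: mult_nonneg_nonpos)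
  {
    fix x y :: real assume y: "y \<le> 0"
    have "(\<lambda>t. indicator {x..} t * (v t * P t (y + c * (x - t)))) = (\<lambda>t. 0)"
      using admissible_zero[OF P order_trans[OF below y]] by (auto simp: indicator_def)
    then show "slope_int c v P x y = 0" by (simp add: slope_int_def)
  next
    fix X Y :: "nat \<Rightarrow> real" and x y assume *: "X \<longlonglongrightarrow> x" "Y \<longlonglongrightarrow> y" "\<And>n. 0 < Y n" "0 < (y::real)"
    obtain x0 where x0: "\<And>n. \<bar>X n\<bar> \<le> x0" using bounded_sequences[OF *(1)] by blast
    obtain y0 where y0: "\<And>n. \<bar>Y n\<bar> \<le> y0" using bounded_sequences[OF *(2)] by blast
    obtain K where K: "0 \<le> K" "\<And>t z. -x0 \<le> t \<Longrightarrow> z \<le> y0 \<Longrightarrow> \<bar>P t z\<bar> \<le> K" using admissible_bounded[OF P]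
        by blast
    show "(\<lambda>n. slope_int c v P (X n) (Y n)) \<longlonglongrightarrow> slope_int c v P x y"
      unfolding slope_int_def
    proof (rule integral_dominated_convergence[where w="\<lambda>t. K * \<bar>v t\<bar>"])
      show "AE t in lborel. (\<lambda>n. indicator {X n..} t * (v t * P t (Y n + c * (X n - t)))) \<longlonglongrightarrow>
          indicator {x..} t * (v t * P t (y + c * (x - t)))"
        \<comment> \<open>Two exceptional points: the end point \<open>t = x\<close> of the
          integration and the point \<open>t = x + y / c\<close> where the line meets the axis and
          \<open>P\<close> may jump. For \<open>c = 0\<close> the line stays at height
          \<open>y > 0\<close> and never meets it.\<close>
        using AE_lborel_singleton[of x] AE_lborel_singleton[of "x + y / c"]
      proof eventually_elim
        case (elim t)
        have "y + c * (x - t) \<noteq> 0" using elim(2) *(4) by (cases "c = 0") (auto simp: field_simps)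
        then show ?case
          by (intro tendsto_mult indicator_atLeast_tendsto tendsto_const admissible_tendsto[OF P]
              tendsto_diff tendsto_add *)
             (use elim in auto)
      qed
      show "AE t in lborel. norm (indicator {X n..} t * (v t * P t (Y n + c * (X n - t)))) \<le> K * \<bar>v
          t\<bar>" for n
      proof (intro AE_I2)
        fix t
        have "\<bar>P t (Y n + c * (X n - t))\<bar> \<le> K" if "X n \<le> t"
          using that x0[of n] y0[of n] below[OF that, of "Y n"] by (intro K) auto
        then show "norm (indicator {X n..} t * (v t * P t (Y n + c * (X n - t)))) \<le> K * \<bar>v t\<bar>"
          using K(1) by (auto simp: indicator_def intro!: abs_mult_le)
      qed
    qed (use v in auto)
  next
    fix x0 Y
    obtain K where K: "0 \<le> K" "\<And>t z. x0 \<le> t \<Longrightarrow> z \<le> Y \<Longrightarrow> \<bar>P t z\<bar> \<le> K" using admissible_bounded[OF P] by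
        blast
    show "\<exists>K. \<forall>x\<ge>x0. \<forall>y\<le>Y. \<bar>slope_int c v P x y\<bar> \<le> K"
    proof (intro exI allI impI)
      fix x y assume xy: "x0 \<le> x" "y \<le> Y"
      have "\<bar>P t (y + c * (x - t))\<bar> \<le> K" if "x \<le> t" for t
        using that xy below[OF that, of y] by (intro K) auto
      then show "\<bar>slope_int c v P x y\<bar> \<le> K * (\<integral>t. \<bar>v t\<bar> \<partial>lborel)"
        unfolding slope_int_def
        by (intro dominated_integrable(2)[OF v]) (use K in \<open>auto simp: indicator_def intro!:
            abs_mult_le\<close>)
    qed
  }
qed

lemma admissible_char_int: "admissible P \<Longrightarrow> integrable lborel v \<Longrightarrow> admissible (char_int v P)"
  by (simp add: char_int_slope_int admissible_slope_int)

lemma admissible_tail_int: "admissible P \<Longrightarrow> integrable lborel v \<Longrightarrow> admissible (tail_int v P)"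
  by (simp add: tail_int_slope_int admissible_slope_int)

lemma tail_integral_diff:
  fixes g :: "real \<Rightarrow> real"
  assumes int: "integrable lborel (\<lambda>t. indicator {a..} t * g t)" and ab: "a \<le> b"
  shows "(\<integral>t. indicator {b..} t * g t \<partial>lborel) - (\<integral>t. indicator {a..} t * g t \<partial>lborel) = (LINT
      t:{a..b}|lborel. - g t)"
proof -
  have sub: "indicator A t * (indicator {a..} t * g t) = indicator A t * g t" if "A \<subseteq> {a..}" for A t
    using that by (auto simp: indicator_def)
  have m: "(\<lambda>t. indicator {b..} t * g t) \<in> borel_measurable lborel" "(\<lambda>t. indicator {a..} t * g t) \<in>
      borel_measurable lborel"
    "(\<lambda>t. indicator {a..b} t *\<^sub>R - g t) \<in> borel_measurable lborel" and intb: "integrable lborel (\<lambda>t.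
        indicator {b..} t * g t)"
    using int integrable_mult_indicator[OF _ int, of "{b..}"] integrable_mult_indicator[OF _ int, of
        "{a..b}"] ab
    by (auto simp: sub dest!: borel_measurable_integrable)
  have "(\<integral>t. indicator {b..} t * g t \<partial>lborel) - (\<integral>t. indicator {a..} t * g t \<partial>lborel) =
      (\<integral>t. indicator {b..} t * g t - indicator {a..} t * g t \<partial>lborel)"
    by (rule Bochner_Integration.integral_diff[symmetric, OF intb int])
  also have "\<dots> = (LINT t:{a..b}|lborel. - g t)"
    unfolding set_lebesgue_integral_def
  proof (rule integral_cong_AE)
    show "AE t in lborel. indicator {b..} t * g t - indicator {a..} t * g t = indicator {a..b} t *\<^sub>R
        - g t"
      using AE_lborel_singleton[of b] by eventually_elim (use ab in \<open>auto simp: indicator_def\<close>)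
  qed (use m in \<open>auto intro: borel_measurable_diff\<close>)
  finally show ?thesis .
qed

section \<open>Moment bounds for the integral operators\<close>

lemma ennreal_abs_integral_le:
  fixes f :: "'a \<Rightarrow> real"
  shows "ennreal \<bar>integral\<^sup>L M f\<bar> \<le> (\<integral>\<^sup>+x. ennreal \<bar>f x\<bar> \<partial>M)"
  using integral_norm_bound_ennreal[of M f] 
  \<comment> \<open>Without integrability the left-hand side is zero, by the convention for
    \<open>integral\<close>.\<close>
  by (cases "integrable M f") (auto simp: not_integrable_integral_eq)

text \<open>Tonelli and the substitution \<open>y = (t - x) + z\<close> turn the moment of the
  characteristic integral into moments of \<open>P t\<close>, multiplied by
  \<open>(1 + (t - x)) ^ s\<close>. Then \<open>left_weight_shift_power\<close> trades the growth of
  both factors for the weight of \<open>v\<close>.\<close>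

lemma nn_moment_char_int:
  assumes P: "admissible P" and v: "weighted s N v" and C: "0 \<le> C"
    and PC: "\<And>t. nn_moment s (P t) \<le> ennreal (C * left_weight t ^ (s + 1))"
  shows "nn_moment s (char_int v P x) \<le> ennreal (C * N * left_weight x ^ s)"
proof -
  have [measurable]: "case_prod P \<in> borel_measurable (borel \<Otimes>\<^sub>M borel)" using P by (rule
      admissible_measurable_prod)
  have [measurable]: "v \<in> borel_measurable borel" using v by (rule weighted_measurable)
  have "nn_moment s (char_int v P x) \<le> (\<integral>\<^sup>+y. ennreal ((1 + \<bar>y\<bar>) ^ s) * 
      (\<integral>\<^sup>+t. ennreal \<bar>indicator {x..} t * (v t * P t (x + y - t))\<bar> \<partial>lborel) \<partial>lborel)"
    unfolding nn_moment_def char_int_def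
    by (intro nn_integral_mono, subst ennreal_mult) (auto intro!: mult_left_mono
        ennreal_abs_integral_le)
  also have "\<dots> = (\<integral>\<^sup>+y. \<integral>\<^sup>+t. ennreal ((1 + \<bar>y\<bar>) ^ s) * 
      ennreal \<bar>indicator {x..} t * (v t * P t (x + y - t))\<bar> \<partial>lborel \<partial>lborel)"
    by (intro nn_integral_cong nn_integral_cmult[symmetric]) auto
  also have "\<dots> = (\<integral>\<^sup>+t. \<integral>\<^sup>+y. ennreal ((1 + \<bar>y\<bar>) ^ s) * 
      ennreal \<bar>indicator {x..} t * (v t * P t (x + y - t))\<bar> \<partial>lborel \<partial>lborel)"
    by (rule lborel_pair.Fubini') (auto simp: indicator_def)
  also have "\<dots> \<le> (\<integral>\<^sup>+t. indicator {x..} t * (ennreal \<bar>v t\<bar> * (ennreal ((1 + (t - x)) ^ s) *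
      nn_moment s (P t))) \<partial>lborel)"
  proof (intro nn_integral_mono)
    fix t
    have "(\<integral>\<^sup>+y. ennreal ((1 + \<bar>y\<bar>) ^ s) * ennreal \<bar>indicator {x..} t * (v t * P t (x + y - t))\<bar>
        \<partial>lborel)
       = (\<integral>\<^sup>+z. ennreal ((1 + \<bar>(t - x) + z\<bar>) ^ s) * ennreal \<bar>indicator {x..} t * (v t * P t z)\<bar>
           \<partial>lborel)"
      by (subst nn_integral_real_affine[where c=1 and t="t - x"]) auto
    also have "\<dots> \<le> (\<integral>\<^sup>+z. indicator {x..} t * (ennreal \<bar>v t\<bar> * (ennreal ((1 + (t - x)) ^ s))) *
        ennreal ((1 + \<bar>z\<bar>) ^ s * \<bar>P t z\<bar>) \<partial>lborel)"
    proof (intro nn_integral_mono)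
      fix z
      show "ennreal ((1 + \<bar>(t - x) + z\<bar>) ^ s) * ennreal \<bar>indicator {x..} t * (v t * P t z)\<bar> \<le>
        indicator {x..} t * (ennreal \<bar>v t\<bar> * (ennreal ((1 + (t - x)) ^ s))) * ennreal ((1 + \<bar>z\<bar>) ^ s
            * \<bar>P t z\<bar>)"
      proof (cases "x \<le> t")
        case True
        have "1 + \<bar>(t - x) + z\<bar> \<le> (1 + (t - x)) * (1 + \<bar>z\<bar>)"
        proof -
          have "0 \<le> (t - x) * \<bar>z\<bar>" using True by auto
          moreover have "1 + \<bar>(t - x) + z\<bar> \<le> 1 + (t - x) + \<bar>z\<bar>" using True by linarith
          moreover have "(1 + (t - x)) * (1 + \<bar>z\<bar>) = 1 + (t - x) + \<bar>z\<bar> + (t - x) * \<bar>z\<bar>"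
            by (simp add: algebra_simps)
          ultimately show ?thesis by linarith
        qed
        then have "(1 + \<bar>(t - x) + z\<bar>) ^ s \<le> ((1 + (t - x)) * (1 + \<bar>z\<bar>)) ^ s" by (intro power_mono)
            auto
        then have "(1 + \<bar>(t - x) + z\<bar>) ^ s * \<bar>v t * P t z\<bar> \<le> ((1 + (t - x)) * (1 + \<bar>z\<bar>)) ^ s * \<bar>v t
            * P t z\<bar>"
          by (intro mult_right_mono) auto
        then have "ennreal ((1 + \<bar>(t - x) + z\<bar>) ^ s * \<bar>v t * P t z\<bar>) \<le> ennreal (\<bar>v t\<bar> * (1 + (t -
            x)) ^ s * ((1 + \<bar>z\<bar>) ^ s * \<bar>P t z\<bar>))"
          by (intro ennreal_leI) (simp add: abs_mult power_mult_distrib mult_ac)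
        then show ?thesis using True by (simp add: ennreal_mult[symmetric])
      qed simp
    qed
    also have "\<dots> = indicator {x..} t * (ennreal \<bar>v t\<bar> * (ennreal ((1 + (t - x)) ^ s))) * nn_moment s
        (P t)"
      unfolding nn_moment_def by (intro nn_integral_cmult) auto
    finally show "(\<integral>\<^sup>+y. ennreal ((1 + \<bar>y\<bar>) ^ s) * ennreal \<bar>indicator {x..} t * (v t * P t (x + y -
        t))\<bar> \<partial>lborel)
      \<le> indicator {x..} t * (ennreal \<bar>v t\<bar> * (ennreal ((1 + (t - x)) ^ s) * nn_moment s (P t)))"
      by (simp add: mult.assoc)
  qed
  also have "\<dots> \<le> ennreal ((C * left_weight x ^ s) * N)"
  proof (rule weighted_nn_integral_le[OF v])
    fix t assume t: "x \<le> t"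
    have "ennreal ((1 + (t - x)) ^ s) * nn_moment s (P t) \<le> ennreal ((1 + (t - x)) ^ s) * ennreal (C
        * left_weight t ^ (s + 1))"
      by (intro mult_left_mono PC) auto
    also have "\<dots> = ennreal (C * ((1 + (t - x)) ^ s * left_weight t ^ (s + 1)))"
      using t C left_weight_ge_1[of t] by (subst ennreal_mult[symmetric]) (auto simp: mult_ac)
    also have "\<dots> \<le> ennreal (C * (left_weight x ^ s * (1 + \<bar>t\<bar>) ^ (s + 1)))"
      using C t by (intro ennreal_leI mult_left_mono left_weight_shift_power) auto
    finally show "ennreal ((1 + (t - x)) ^ s) * nn_moment s (P t) \<le> ennreal (C * left_weight x ^ s *
        (1 + \<bar>t\<bar>) ^ (s + 1))"
      by (simp add: mult.assoc)
  qed (use C left_weight_ge_1[of x] in auto)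
  finally show ?thesis by (simp add: mult_ac)
qed

lemma nn_moment_tail_int:
  assumes P: "admissible P" and v: "weighted s N v" and C: "0 \<le> C"
    and PC: "\<And>t. nn_moment s (P t) \<le> ennreal (C * left_weight t ^ (s + 1))"
  shows "nn_moment s (tail_int v P x) \<le> ennreal (C * N * left_weight x ^ s)"
proof -
  have [measurable]: "case_prod P \<in> borel_measurable (borel \<Otimes>\<^sub>M borel)" using P by (rule
      admissible_measurable_prod)
  have [measurable]: "v \<in> borel_measurable borel" using v by (rule weighted_measurable)
  have "nn_moment s (tail_int v P x) \<le> (\<integral>\<^sup>+y. ennreal ((1 + \<bar>y\<bar>) ^ s) * 
      (\<integral>\<^sup>+t. ennreal \<bar>indicator {x..} t * (v t * P t y)\<bar> \<partial>lborel) \<partial>lborel)"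
    unfolding nn_moment_def tail_int_def
    by (intro nn_integral_mono, subst ennreal_mult) (auto intro!: mult_left_mono
        ennreal_abs_integral_le)
  also have "\<dots> = (\<integral>\<^sup>+y. \<integral>\<^sup>+t. ennreal ((1 + \<bar>y\<bar>) ^ s) * 
      ennreal \<bar>indicator {x..} t * (v t * P t y)\<bar> \<partial>lborel \<partial>lborel)"
    by (intro nn_integral_cong nn_integral_cmult[symmetric]) auto
  also have "\<dots> = (\<integral>\<^sup>+t. \<integral>\<^sup>+y. ennreal ((1 + \<bar>y\<bar>) ^ s) * 
      ennreal \<bar>indicator {x..} t * (v t * P t y)\<bar> \<partial>lborel \<partial>lborel)"
    by (rule lborel_pair.Fubini') (auto simp: indicator_def)
  also have "\<dots> = (\<integral>\<^sup>+t. indicator {x..} t * (ennreal \<bar>v t\<bar> * nn_moment s (P t)) \<partial>lborel)"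
    unfolding nn_moment_def 
    by (intro nn_integral_cong, subst nn_integral_cmult[symmetric], simp, subst
        nn_integral_cmult[symmetric], simp,
        intro nn_integral_cong) (auto simp: indicator_def ennreal_mult[symmetric] abs_mult mult_ac)
  also have "\<dots> \<le> ennreal (C * N)"
  proof (rule weighted_nn_integral_le[OF v C])
    fix t
    have "C * left_weight t ^ (s + 1) \<le> C * (1 + \<bar>t\<bar>) ^ (s + 1)"
      using C left_weight_ge_1[of t] by (intro mult_left_mono power_mono left_weight_le) auto
    then show "nn_moment s (P t) \<le> ennreal (C * (1 + \<bar>t\<bar>) ^ (s + 1))"
      using PC[of t] ennreal_leI order_trans by blast
  qed
  \<comment> \<open>The argument \<open>y\<close> is not shifted here, so the moment stays bounded
    in \<open>x\<close>. The power of \<open>left_weight\<close> is inserted to match the bound for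
    \<open>char_int\<close>.\<close>
  also have "\<dots> \<le> ennreal (C * N * left_weight x ^ s)"
  proof (rule ennreal_leI)
    have "C * N * 1 \<le> C * N * left_weight x ^ s"
      using C v left_weight_ge_1[of x] by (intro mult_left_mono one_le_power) (auto simp:
          weighted_def)
    then show "C * N \<le> C * N * left_weight x ^ s" by simp
  qed
  finally show ?thesis .
qed

lemma nn_moment_shift:
  assumes v: "weighted s N v"
  shows "nn_moment s (shift v x) \<le> ennreal (N * left_weight x ^ s)"
proof -
  have [measurable]: "v \<in> borel_measurable borel" using v by (rule weighted_measurable)
  have "nn_moment s (shift v x) = (\<integral>\<^sup>+t. ennreal ((1 + \<bar>t - x\<bar>) ^ s * \<bar>shift v x (t - x)\<bar>) \<partial>lborel)"
    unfolding nn_moment_def by (subst nn_integral_real_affine[where c=1 and t="-x"]) (auto simp: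
        shift_def)
  also have "\<dots> \<le> (\<integral>\<^sup>+t. indicator {x..} t * (ennreal \<bar>v t\<bar> * ennreal ((1 + (t - x)) ^ s)) \<partial>lborel)"
    by (intro nn_integral_mono) (auto simp: shift_def indicator_def ennreal_mult[symmetric] mult_ac)
  also have "\<dots> \<le> ennreal (left_weight x ^ s * N)"
  proof (rule weighted_nn_integral_le[OF v])
    fix t assume t: "x \<le> t"
    \<comment> \<open>The free term carries no kernel; the factor
      \<open>left_weight t ^ (s + 1)\<close> is inserted only to reuse the same exchange of
      weights.\<close>
    have "(1 + (t - x)) ^ s * 1 \<le> (1 + (t - x)) ^ s * left_weight t ^ (s + 1)"
      using t left_weight_ge_1[of t] by (intro mult_left_mono one_le_power) auto
    also have "\<dots> \<le> left_weight x ^ s * (1 + \<bar>t\<bar>) ^ (s + 1)" by (rule left_weight_shift_power[OF t])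
    finally show "ennreal ((1 + (t - x)) ^ s) \<le> ennreal (left_weight x ^ s * (1 + \<bar>t\<bar>) ^ (s + 1))"
      by (intro ennreal_leI) simp
  qed (use left_weight_ge_1[of x] in auto)
  finally show ?thesis by (simp add: mult.commute)
qed

text \<open>Here the potential is evaluated instead of integrated, so its weighted integral is of no
  help and pointwise decay is required. \<open>weighted_ac_bound\<close> extracts this decay from
  the weighted integrability of the potential and its derivative.\<close>

lemma nn_moment_mult_left:
  assumes P: "admissible P" and C: "0 \<le> C" and N: "0 \<le> N" and v: "\<bar>v\<bar> * (1 + \<bar>x\<bar>) ^ (s + 1) \<le> N"
    and PC: "nn_moment s (P x) \<le> ennreal (C * left_weight x ^ (s + 1))"
  shows "nn_moment s (\<lambda>y. v * P x y) \<le> ennreal (C * N * left_weight x ^ s)"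
proof -
  have [measurable]: "case_prod P \<in> borel_measurable (borel \<Otimes>\<^sub>M borel)" using P by (rule
      admissible_measurable_prod)
  have "nn_moment s (\<lambda>y. v * P x y) = ennreal \<bar>v\<bar> * nn_moment s (P x)"
    unfolding nn_moment_def by (subst nn_integral_cmult[symmetric]) (auto simp:
        ennreal_mult[symmetric] abs_mult mult_ac)
  also have "\<dots> \<le> ennreal \<bar>v\<bar> * ennreal (C * left_weight x ^ (s + 1))" by (intro mult_left_mono PC)
      auto
  also have "\<dots> = ennreal (C * (\<bar>v\<bar> * left_weight x ^ (s + 1)))" using C left_weight_ge_1[of x] by
      (subst ennreal_mult[symmetric]) (auto simp: mult_ac)
  also have "\<dots> \<le> ennreal (C * N * left_weight x ^ s)"
  proof (rule ennreal_leI)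
    have "\<bar>v\<bar> * left_weight x ^ (s + 1) \<le> \<bar>v\<bar> * (1 + \<bar>x\<bar>) ^ (s + 1)"
      using left_weight_ge_1[of x] by (intro mult_left_mono power_mono left_weight_le) auto
    also have "\<dots> \<le> N * 1" using v by simp
    also have "\<dots> \<le> N * left_weight x ^ s" using left_weight_ge_1[of x] N by (intro mult_left_mono
        one_le_power)
    finally show "C * (\<bar>v\<bar> * left_weight x ^ (s + 1)) \<le> C * N * left_weight x ^ s" using C by (simp
        add: mult.assoc mult_left_mono)
  qed
  finally show ?thesis .
qed

lemma nn_moment_add:
  assumes [measurable]: "f \<in> borel_measurable borel" "g \<in> borel_measurable borel"
  shows "nn_moment s (\<lambda>y. f y + g y) \<le> nn_moment s f + nn_moment s g"
proof -
  have "nn_moment s (\<lambda>y. f y + g y) \<le> (\<integral>\<^sup>+y. ennreal ((1 + \<bar>y\<bar>) ^ s * \<bar>f y\<bar>) + ennreal ((1 + \<bar>y\<bar>) ^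
      s * \<bar>g y\<bar>) \<partial>lborel)"
    unfolding nn_moment_def
  proof (intro nn_integral_mono)
    fix y :: real
    have "(1 + \<bar>y\<bar>) ^ s * \<bar>f y + g y\<bar> \<le> (1 + \<bar>y\<bar>) ^ s * (\<bar>f y\<bar> + \<bar>g y\<bar>)" by (intro mult_left_mono)
        auto
    then have "ennreal ((1 + \<bar>y\<bar>) ^ s * \<bar>f y + g y\<bar>) \<le> ennreal ((1 + \<bar>y\<bar>) ^ s * \<bar>f y\<bar> + (1 + \<bar>y\<bar>) ^
        s * \<bar>g y\<bar>)"
      by (intro ennreal_leI) (simp only: distrib_left)
    also have "\<dots> = ennreal ((1 + \<bar>y\<bar>) ^ s * \<bar>f y\<bar>) + ennreal ((1 + \<bar>y\<bar>) ^ s * \<bar>g y\<bar>)"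
      by (rule ennreal_plus) auto
    finally show "ennreal ((1 + \<bar>y\<bar>) ^ s * \<bar>f y + g y\<bar>) \<le> ennreal ((1 + \<bar>y\<bar>) ^ s * \<bar>f y\<bar>) + ennreal
        ((1 + \<bar>y\<bar>) ^ s * \<bar>g y\<bar>)" .
  qed
  also have "\<dots> = nn_moment s f + nn_moment s g" unfolding nn_moment_def by (rule nn_integral_add)
      auto
  finally show ?thesis .
qed

section \<open>Derivatives of the integral operators\<close>

lemma integrable_indicator_Icc [simp]: "integrable lborel (indicat_real {a..b::real})"
  by (intro integrable_real_indicator) (cases "a \<le> b"; simp)+

text \<open>The \<open>lborel\<close> counterpart of one step of \<open>ac_derivs\<close>. Set
  integrals being total, integrability of \<open>f'\<close> is stated separately wherever it
  matters.\<close>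

definition ac_pair :: "(real \<Rightarrow> real) \<Rightarrow> (real \<Rightarrow> real) \<Rightarrow> bool" where
  "ac_pair f f' \<longleftrightarrow> (\<forall>a b. a \<le> b \<longrightarrow> f b - f a = (LINT t:{a..b}|lborel. f' t))"

lemma ac_pair_continuous:
  assumes f: "ac_pair f f'" and f': "integrable lborel f'"
  shows "continuous_on UNIV f"
proof -
  have [measurable]: "f' \<in> borel_measurable borel" using f' by (simp add:
      borel_measurable_integrable)
  define F where "F x = (\<integral>t. indicator {..x} t * f' t \<partial>lborel)" for x
  have int: "integrable lborel (\<lambda>t. indicator {..x} t * f' t)" for x :: real
    by (rule Bochner_Integration.integrable_bound[OF f']) (auto simp: indicator_def)
  have diff: "f b - f a = F b - F a" if ab: "a \<le> b" for a b
  proof -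
    have "F b - F a = (\<integral>t. indicator {..b} t * f' t - indicator {..a} t * f' t \<partial>lborel)"
      unfolding F_def by (simp add: int)
    also have "\<dots> = (LINT t:{a..b}|lborel. f' t)"
      unfolding set_lebesgue_integral_def
    proof (rule integral_cong_AE)
      show "AE t in lborel. indicator {..b} t * f' t - indicator {..a} t * f' t = indicator {a..b} t
          *\<^sub>R f' t"
        using AE_lborel_singleton[of a] by eventually_elim (use ab in \<open>auto simp: indicator_def\<close>)
    qed auto
    finally show ?thesis using f ab by (simp add: ac_pair_def)
  qed
  have f_eq: "f x = F x + (f 0 - F 0)" for x
    using diff[of 0 x] diff[of x 0] by (cases "0 \<le> x") auto
  have "continuous_on UNIV F"
  proof (rule continuous_on_sequentiallyI)
    fix u :: "nat \<Rightarrow> real" and a assume u: "u \<longlonglongrightarrow> a"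
    show "(\<lambda>n. F (u n)) \<longlonglongrightarrow> F a"
      unfolding F_def
    proof (rule integral_dominated_convergence[where w="\<lambda>t. \<bar>f' t\<bar>"])
      show "AE t in lborel. (\<lambda>n. indicator {..u n} t * f' t) \<longlonglongrightarrow> indicator {..a} t * f' t"
        using AE_lborel_singleton[of a]
      proof eventually_elim
        case (elim t)
        have "eventually (\<lambda>n. indicator {..u n} t * f' t = indicator {..a} t * f' t) sequentially"
        proof (cases "t < a")
          case True
          show ?thesis using order_tendstoD(1)[OF u True]
            by (rule eventually_mono) (use True in auto)
        next
          case False
          with elim have "a < t" by simp
          show ?thesis using order_tendstoD(2)[OF u \<open>a < t\<close>]
            by (rule eventually_mono) (use \<open>a < t\<close> in auto)
        qed
        then show ?case by (rule tendsto_eventually)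
      qed
    qed (use f' in \<open>auto simp: indicator_def\<close>)
  qed
  then have "continuous_on UNIV (\<lambda>x. F x + (f 0 - F 0))" by (intro continuous_intros)
  then show ?thesis using f_eq by (metis (no_types, lifting) continuous_on_cong)
qed

text \<open>An interval of length \<open>L = (J + 1) / e\<close> on which
  \<open>e \<le> \<bar>f\<bar>\<close> would contribute at least \<open>J + 1\<close>, more than the
  whole integral \<open>J\<close> of \<open>\<bar>f\<bar>\<close>. Such intervals can be placed
  arbitrarily far on either side.\<close>

lemma integrable_small_value:
  fixes f :: "real \<Rightarrow> real"
  assumes f: "integrable lborel f" and e: "e > 0"
  shows "\<exists>a<x. \<bar>f a\<bar> < e" "\<exists>a>x. \<bar>f a\<bar> < e"
proof -
  define J where "J = (\<integral>t. \<bar>f t\<bar> \<partial>lborel)"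
  define L where "L = (J + 1) / e"
  have J: "0 \<le> J" by (simp add: J_def)
  then have L: "0 \<le> L" using e by (simp add: L_def)
  have False if ge: "\<And>a. a \<in> {c..c + L} \<Longrightarrow> e \<le> \<bar>f a\<bar>" for c
  proof -
    have "J + 1 = e * measure lborel {c..c + L}" using e L by (simp add: L_def)
    also have "\<dots> = (\<integral>t. indicator {c..c + L} t * e \<partial>lborel)" by simp
    also have "\<dots> \<le> J" unfolding J_def
    proof (rule integral_mono)
      show "indicator {c..c + L} t * e \<le> \<bar>f t\<bar>" for t using ge[of t] by (cases "t \<in> {c..c + L}")
          auto
    qed (use f in auto)
    finally show False by simp
  qed
  then have *: "\<exists>a\<in>{c..c + L}. \<bar>f a\<bar> < e" for c by (meson not_le)
  show "\<exists>a<x. \<bar>f a\<bar> < e" using *[of "x - L - 1"] by force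
  show "\<exists>a>x. \<bar>f a\<bar> < e" using *[of "x + 1"] by force
qed

text \<open>
  As \<open>f\<close> is integrable, it is arbitrarily small at suitable points far out on the side of
  \<open>x\<close>, from where \<open>f'\<close> is integrated.
\<close>
lemma weighted_ac_bound:
  assumes f: "weighted s N f" and f': "weighted s N f'" and ac: "ac_pair f f'"
  shows "\<bar>f x\<bar> * (1 + \<bar>x\<bar>) ^ (s + 1) \<le> N"
proof (rule field_le_epsilon)
  fix e :: real assume e: "e > 0"
  define A where "A = (1 + \<bar>x\<bar>) ^ (s + 1)"
  have A: "A > 0" by (simp add: A_def)
  have [measurable]: "f' \<in> borel_measurable borel" using f' by (rule weighted_measurable)
  have intf': "integrable lborel f'" using f' by (rule weighted_integrable)
  have N: "0 \<le> N" using f by (simp add: weighted_def)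
  \<comment> \<open>The segment between \<open>a\<close> and \<open>x\<close> lies at least as far
    from the origin as \<open>x\<close>, so the weight at \<open>x\<close> may be moved under the
    integral of \<open>f'\<close>. The pair \<open>p\<close>, \<open>q\<close> covers both orders of
    \<open>a\<close> and \<open>x\<close>.\<close>
  have *: "\<bar>f x\<bar> * A \<le> N + e"
    if a: "\<bar>f a\<bar> < e / A" and pq: "p \<le> q" "{p, q} = {a, x}" and ge: "\<And>t. t \<in> {p..q} \<Longrightarrow> \<bar>x\<bar> \<le> \<bar>t\<bar>" for
        a p q
  proof -
    have eq: "f q - f p = (\<integral>t. indicator {p..q} t * f' t \<partial>lborel)" 
      using ac pq(1) by (simp add: ac_pair_def set_lebesgue_integral_def)
    have "ennreal (A * \<bar>f q - f p\<bar>) = ennreal A * ennreal \<bar>\<integral>t. indicator {p..q} t * f' t \<partial>lborel\<bar>"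
      unfolding eq using A by (simp add: ennreal_mult)
    also have "\<dots> \<le> ennreal A * (\<integral>\<^sup>+t. ennreal \<bar>indicator {p..q} t * f' t\<bar> \<partial>lborel)"
      by (intro mult_left_mono ennreal_abs_integral_le) auto
    also have "\<dots> = (\<integral>\<^sup>+t. ennreal A * ennreal \<bar>indicator {p..q} t * f' t\<bar> \<partial>lborel)"
      by (rule nn_integral_cmult[symmetric]) auto
    also have "\<dots> \<le> (\<integral>\<^sup>+t. ennreal ((1 + \<bar>t\<bar>) ^ (s + 1) * \<bar>f' t\<bar>) \<partial>lborel)"
    proof (intro nn_integral_mono)
      fix t
      have "A * \<bar>f' t\<bar> \<le> (1 + \<bar>t\<bar>) ^ (s + 1) * \<bar>f' t\<bar>" if "t \<in> {p..q}"
        unfolding A_def using ge[OF that] by (intro mult_right_mono power_mono) auto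
      then show "ennreal A * ennreal \<bar>indicator {p..q} t * f' t\<bar> \<le> ennreal ((1 + \<bar>t\<bar>) ^ (s + 1) *
          \<bar>f' t\<bar>)"
        using A by (auto simp: indicator_def ennreal_mult[symmetric] intro!: ennreal_leI)
    qed
    also have "\<dots> \<le> ennreal N" using f' by (simp add: weighted_def)
    finally have "A * \<bar>f q - f p\<bar> \<le> N" using N by simp
    moreover have "\<bar>f q - f p\<bar> = \<bar>f x - f a\<bar>" using pq(2) by (auto simp: doubleton_eq_iff
        abs_minus_commute)
    moreover have "A * \<bar>f x\<bar> \<le> A * \<bar>f x - f a\<bar> + A * \<bar>f a\<bar>"
      using A by (simp add: distrib_left[symmetric])
    moreover have "A * \<bar>f a\<bar> \<le> e" using a A by (simp add: field_simps)
    ultimately show ?thesis by (simp add: mult.commute)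
  qed
  have eA: "0 < e / A" using e A by simp
  show "\<bar>f x\<bar> * (1 + \<bar>x\<bar>) ^ (s + 1) \<le> N + e"
  proof (cases "x < 0")
    case True
    obtain a where "a < x" "\<bar>f a\<bar> < e / A" using integrable_small_value(1)[OF weighted_integrable[OF
        f] eA] by blast
    then show ?thesis using *[of a a x] True by (auto simp: A_def)
  next
    case False
    obtain a where "x < a" "\<bar>f a\<bar> < e / A" using integrable_small_value(2)[OF weighted_integrable[OF
        f] eA] by blast
    then show ?thesis using *[of a x a] False by (auto simp: A_def)
  qed
qed

section \<open>Derivatives of \<open>char_int\<close> and \<open>tail_int\<close>\<close>

lemma char_int_affine:
  "char_int v P x y = (\<integral>w. indicator {0..} w * (v (x + w) * P (x + w) (y - w)) \<partial>lborel)"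
  unfolding char_int_def by (subst lborel_integral_real_affine[where c=1 and t=x])
    (auto simp: indicator_def intro!: Bochner_Integration.integral_cong)

lemma char_int_affine_integrable:
  assumes "admissible P" "integrable lborel v"
  shows "integrable lborel (\<lambda>w. indicator {0..} w * (v (x + w) * P (x + w) (y - w)))"
proof -
  have "integrable lborel (\<lambda>w. indicator {x..} (x + 1 * w) * (v (x + 1 * w) * P (x + 1 * w) (x + y -
      (x + 1 * w))))"
    by (rule lborel_integrable_real_affine[OF char_int_integrable[OF assms]]) simp
  also have "(\<lambda>w. indicator {x..} (x + 1 * w) * (v (x + 1 * w) * P (x + 1 * w) (x + y - (x + 1 *
      w))))
     = (\<lambda>w. indicator {0..} w * (v (x + w) * P (x + w) (y - w)))"
    by (auto simp: indicator_def fun_eq_iff)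
  finally show ?thesis .
qed

text \<open>By translation invariance the integral over \<open>w\<close> does not depend on
  \<open>x\<close>. Multiples of this function dominate when an \<open>x\<close>-interval is
  exchanged with the variable \<open>w = t - x\<close>.\<close>

lemma strip_integrable:
  fixes v :: "real \<Rightarrow> real"
  assumes v: "integrable lborel v"
  shows "integrable (lborel \<Otimes>\<^sub>M lborel) (\<lambda>(x,w). indicator {a..b} x * \<bar>v (x + w)\<bar>)"
proof (rule lborel_pair.Fubini_integrable)
  have [measurable]: "v \<in> borel_measurable borel" using v by (simp add: borel_measurable_integrable)
  show "(\<lambda>(x, w). indicat_real {a..b} x * \<bar>v (x + w)\<bar>) \<in> borel_measurable (lborel \<Otimes>\<^sub>M lborel)" by
      measurable
  have sh: "integrable lborel (\<lambda>w. v (x + w))" for x 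
    using lborel_integrable_real_affine[OF v, of 1 x] by simp
  have eq: "(\<integral>w. \<bar>v (x + w)\<bar> \<partial>lborel) = (\<integral>w. \<bar>v w\<bar> \<partial>lborel)" for x
    using lborel_integral_real_affine[of 1 "\<lambda>w. \<bar>v w\<bar>" x] by simp
  show "integrable lborel (\<lambda>x. \<integral>w. norm (case (x, w) of (x, w) \<Rightarrow> indicat_real {a..b} x * \<bar>v (x +
      w)\<bar>) \<partial>lborel)"
    by (simp add: abs_mult eq)
  show "AE x in lborel. integrable lborel (\<lambda>w. case (x, w) of (x, w) \<Rightarrow> indicat_real {a..b} x * \<bar>v (x
      + w)\<bar>)"
    using sh by (auto intro!: AE_I2)
qed

lemma admissible_section_continuous:
  assumes "admissible P" "0 < y"
  shows "continuous_on UNIV (\<lambda>x. P (x + c) y)"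
  by (rule continuous_on_sequentiallyI) (use assms in \<open>auto intro!: admissible_tendsto[OF assms(1)]
      tendsto_add\<close>)

lemma admissible_section_continuous':
  assumes "admissible P"
  shows "continuous_on {0<..} (P x)"
  by (rule continuous_on_sequentiallyI) (use assms in \<open>auto intro!: admissible_tendsto[OF
      assms(1)]\<close>)

text \<open>In the variable \<open>w = t - x\<close> neither the range of integration nor the second
  argument \<open>y - w\<close> depends on \<open>x\<close>, so the jump of \<open>P\<close> at the
  axis is never differentiated. For fixed \<open>w\<close> the product rule applies, with
  \<open>v\<close> absolutely continuous and \<open>P\<close> differentiable in \<open>x\<close>;
  Fubini over the strip then produces the two operators.\<close>

lemma char_int_x_ac:
  assumes P: "admissible P" and Px: "admissible Px" and v: "integrable lborel v" and v': "integrable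
      lborel v'"
    and ac: "ac_pair v v'"
    and D: "\<And>x y. 0 < y \<Longrightarrow> ((\<lambda>x. P x y) has_real_derivative Px x y) (at x)"
    and ab: "a \<le> b"
  shows "char_int v P b y - char_int v P a y = (LINT x:{a..b}|lborel. char_int v' P x y + char_int v
      Px x y)"
proof -
  have [measurable]: "v \<in> borel_measurable borel" "v' \<in> borel_measurable borel"
    using v v' by (simp_all add: borel_measurable_integrable)
  have [measurable]: "case_prod P \<in> borel_measurable (borel \<Otimes>\<^sub>M borel)"
    "case_prod Px \<in> borel_measurable (borel \<Otimes>\<^sub>M borel)" using P Px by (auto dest:
        admissible_measurable_prod)
  define H where "H x w = v' (x + w) * P (x + w) (y - w) + v (x + w) * Px (x + w) (y - w)" for x w
  have [measurable]: "case_prod H \<in> borel_measurable (borel \<Otimes>\<^sub>M borel)"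
    unfolding H_def by measurable
  have inner: "v (b + w) * P (b + w) (y - w) - v (a + w) * P (a + w) (y - w) = (LINT
      x:{a..b}|lborel. H x w)" for w
  proof (cases "y - w \<le> 0")
    case True
    then show ?thesis by (simp add: H_def admissible_zero[OF P] admissible_zero[OF Px])
  next
    case False
    then have yw: "0 < y - w" by simp
    have DP: "((\<lambda>x. P (x + w) (y - w)) has_real_derivative Px (x + w) (y - w)) (at x)" for x
      using DERIV_shift[of "\<lambda>x. P x (y - w)"] D[OF yw, of "x + w"] by simp
    have contPx: "continuous_on UNIV (\<lambda>x. Px (x + w) (y - w))" by (rule
        admissible_section_continuous[OF Px yw])
    have FTC: "has_bochner_integral lborel (\<lambda>x. Px (x + w) (y - w) * indicator {a..c} x) (P (c + w)
        (y - w) - P (a + w) (y - w))"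
      if "a \<le> c" for c
      by (rule has_bochner_integral_FTC_Icc_real[OF that]) 
         (use DP contPx in \<open>auto simp: continuous_on_eq_continuous_at\<close>)
    have "v (b + w) * P (b + w) (y - w) - v (a + w) * P (a + w) (y - w)
      = (LINT x:{a..b}|lborel. v' (x + w) * P (x + w) (y - w) + v (x + w) * Px (x + w) (y - w))"
    proof (rule ac_product_rule[OF ab])
      show "set_integrable lborel {a..b} (\<lambda>x. v' (x + w))"
        unfolding set_integrable_def using lborel_integrable_real_affine[OF v', of 1 w]
        by (intro integrable_mult_indicator[of "{a..b}", simplified real_scaleR_def]) (auto simp:
            add.commute)
      show "set_integrable lborel {a..b} (\<lambda>x. Px (x + w) (y - w))"
        unfolding set_integrable_def using has_bochner_integral_iff[THEN iffD1, OF FTC[OF ab]] by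
            (simp add: mult.commute)
      fix c assume c: "c \<in> {a..b}"
      show "P (c + w) (y - w) - P (a + w) (y - w) = (LINT x:{a..c}|lborel. Px (x + w) (y - w))"
        unfolding set_lebesgue_integral_def using has_bochner_integral_iff[THEN iffD1, OF FTC[of c]]
            c by (simp add: mult.commute)
      have "v (c + w) - v (a + w) = (\<integral>t. indicator {a+w..c+w} t * v' t \<partial>lborel)"
        using ac c by (simp add: ac_pair_def set_lebesgue_integral_def)
      also have "\<dots> = (LINT t:{a..c}|lborel. v' (t + w))"
        unfolding set_lebesgue_integral_def
        by (subst lborel_integral_real_affine[where c=1 and t=w])
          (auto simp: indicator_def add.commute intro!: Bochner_Integration.integral_cong)
      finally show "v (c + w) - v (a + w) = (LINT t:{a..c}|lborel. v' (t + w))" .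
    qed auto
    then show ?thesis by (simp add: H_def)
  qed
  obtain K where K: "0 \<le> K" "\<And>t z. a \<le> t \<Longrightarrow> z \<le> y \<Longrightarrow> \<bar>P t z\<bar> \<le> K" using admissible_bounded[OF P] by
      blast
  obtain L where L: "0 \<le> L" "\<And>t z. a \<le> t \<Longrightarrow> z \<le> y \<Longrightarrow> \<bar>Px t z\<bar> \<le> L" using admissible_bounded[OF Px] by
      blast
  have int2: "integrable (lborel \<Otimes>\<^sub>M lborel) (\<lambda>(x,w). indicator {a..b} x * (indicator {0..} w * H x
      w))"
  proof (rule Bochner_Integration.integrable_bound)
    show "integrable (lborel \<Otimes>\<^sub>M lborel) (\<lambda>q. K * (case q of (x,w) \<Rightarrow> indicator {a..b} x * \<bar>v' (x +
        w)\<bar>) +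
        L * (case q of (x,w) \<Rightarrow> indicator {a..b} x * \<bar>v (x + w)\<bar>))"
      by (intro Bochner_Integration.integrable_add integrable_mult_right strip_integrable v v')
    show "AE q in lborel \<Otimes>\<^sub>M lborel. norm (case q of (x,w) \<Rightarrow> indicator {a..b} x * (indicator {0..} w
        * H x w))
      \<le> norm (K * (case q of (x,w) \<Rightarrow> indicator {a..b} x * \<bar>v' (x + w)\<bar>) +
        L * (case q of (x,w) \<Rightarrow> indicator {a..b} x * \<bar>v (x + w)\<bar>))"
    proof (intro AE_I2, clarify)
      fix x w :: real
      have "\<bar>H x w\<bar> \<le> K * \<bar>v' (x + w)\<bar> + L * \<bar>v (x + w)\<bar>" if "a \<le> x" "0 \<le> w"
        unfolding H_def using that by (intro order_trans[OF abs_triangle_ineq] add_mono abs_mult_le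
            K L) auto
      moreover have "0 \<le> K * \<bar>v' (x + w)\<bar> + L * \<bar>v (x + w)\<bar>" using K L by auto
      ultimately show "norm (indicator {a..b} x * (indicator {0..} w * H x w))
        \<le> norm (K * (indicator {a..b} x * \<bar>v' (x + w)\<bar>) + L * (indicator {a..b} x * \<bar>v (x + w)\<bar>))"
        by (auto simp: indicator_def)
    qed
  qed measurable
  have "char_int v P b y - char_int v P a y = (\<integral>w. indicator {0..} w * (v (b + w) * P (b + w) (y -
      w)) - indicator {0..} w * (v (a + w) * P (a + w) (y - w)) \<partial>lborel)"
    unfolding char_int_affine by (intro Bochner_Integration.integral_diff[symmetric]
        char_int_affine_integrable P v)
  also have "\<dots> = (\<integral>w. \<integral>x. indicator {a..b} x * (indicator {0..} w * H x w) \<partial>lborel \<partial>lborel)"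
  proof (intro Bochner_Integration.integral_cong refl)
    fix w
    have "(\<integral>x. indicator {a..b} x * (indicator {0..} w * H x w) \<partial>lborel) = indicator {0..} w * (\<integral>x.
        indicator {a..b} x * H x w \<partial>lborel)"
      by (subst Bochner_Integration.integral_mult_right_zero[symmetric]) (simp add: mult_ac)
    also have "\<dots> = indicator {0..} w * (v (b + w) * P (b + w) (y - w)) - indicator {0..} w * (v (a +
        w) * P (a + w) (y - w))"
      using inner[of w] by (simp add: set_lebesgue_integral_def algebra_simps)
    finally show "indicator {0..} w * (v (b + w) * P (b + w) (y - w)) - indicator {0..} w * (v (a +
        w) * P (a + w) (y - w))
       = (\<integral>x. indicator {a..b} x * (indicator {0..} w * H x w) \<partial>lborel)" by simp
  qed
  also have "\<dots> = (\<integral>x. \<integral>w. indicator {a..b} x * (indicator {0..} w * H x w) \<partial>lborel \<partial>lborel)"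
    using lborel_pair.Fubini_integral[OF int2] by simp
  also have "\<dots> = (LINT x:{a..b}|lborel. char_int v' P x y + char_int v Px x y)"
    unfolding set_lebesgue_integral_def
  proof (intro Bochner_Integration.integral_cong refl)
    fix x
    have "char_int v' P x y + char_int v Px x y = (\<integral>w. indicator {0..} w * H x w \<partial>lborel)"
      unfolding char_int_affine H_def
      by (subst Bochner_Integration.integral_add[symmetric, OF char_int_affine_integrable[OF P v']
          char_int_affine_integrable[OF Px v]])
        (simp add: algebra_simps)
    then show "(\<integral>w. indicator {a..b} x * (indicator {0..} w * H x w) \<partial>lborel) = indicator {a..b} x
        *\<^sub>R (char_int v' P x y + char_int v Px x y)"
      by simp
  qed
  finally show ?thesis .
qed

text \<open>Although \<open>v'\<close> is only integrable, the integrand of the absolutely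
  continuous representation is an admissible kernel, hence continuous in \<open>x\<close>; the
  derivative therefore exists at every point.\<close>

lemma char_int_x_deriv:
  assumes P: "admissible P" and Px: "admissible Px" and v: "integrable lborel v" and v': "integrable
      lborel v'"
    and ac: "ac_pair v v'"
    and D: "\<And>x y. 0 < y \<Longrightarrow> ((\<lambda>x. P x y) has_real_derivative Px x y) (at x)"
    and y: "0 < y"
  shows "((\<lambda>x. char_int v P x y) has_real_derivative char_int v' P x y + char_int v Px x y) (at x)"
proof (rule deriv_of_ac_continuous[where S=UNIV])
  have "admissible (\<lambda>x y. char_int v' P x y + char_int v Px x y)" by (intro admissible_add
      admissible_char_int P Px v v')
  from admissible_section_continuous[OF this y, of 0]
  show "continuous_on UNIV (\<lambda>x. char_int v' P x y + char_int v Px x y)" by simp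
  show "char_int v P b y - char_int v P a y = (LINT x:{a..b}|lborel. char_int v' P x y + char_int v
      Px x y)" if "a \<le> b" for a b
    by (rule char_int_x_ac[OF P Px v v' ac D that])
qed auto

text \<open>
  The proof compares \<open>char_int v P x (y + h)\<close> with \<open>char_int v P (x + h) y\<close>,
  which have the same characteristic, so that only an integral over an interval of length
  \<open>h\<close> remains.
\<close>
lemma char_int_y_deriv:
  assumes P: "admissible P" and v: "integrable lborel v" and cv: "continuous_on UNIV v"
    and D: "((\<lambda>x. char_int v P x y) has_real_derivative D) (at x)" and y: "0 < y"
  shows "(char_int v P x has_real_derivative D + v x * P x y) (at y)"
proof -
  have [measurable]: "case_prod P \<in> borel_measurable (borel \<Otimes>\<^sub>M borel)" using P by (rule
      admissible_measurable_prod)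
  have [measurable]: "v \<in> borel_measurable borel" using v by (simp add: borel_measurable_integrable)
  define R where "R h = char_int v P x (y + h) - char_int v P (x + h) y" for h
  define L where "L = v x * P x y"
  \<comment> \<open>The signed indicator of the interval between \<open>x\<close> and
    \<open>x + h\<close>. It treats both signs of \<open>h\<close> at once, with integral
    \<open>h\<close> and total mass \<open>\<bar>h\<bar>\<close>.\<close>
  define J where "J h t = indicator {x..} t - (indicator {x + h..} t :: real)" for h t
  have J_int: "integrable lborel (J h)" and J_le: "(\<integral>t. \<bar>J h t\<bar> \<partial>lborel) = \<bar>h\<bar>" and J_eq: "(\<integral>t. J h
      t \<partial>lborel) = h" for h
  proof -
    have J: "J h = (if 0 \<le> h then indicator {x..<x+h} else (\<lambda>t. - indicator {x+h..<x} t))"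
      by (auto simp: J_def fun_eq_iff indicator_def)
    show "integrable lborel (J h)" "(\<integral>t. \<bar>J h t\<bar> \<partial>lborel) = \<bar>h\<bar>" "(\<integral>t. J h t \<partial>lborel) = h" by (auto
        simp: J)
  qed
  have R_eq: "R h = (\<integral>t. J h t * (v t * P t (x + y + h - t)) \<partial>lborel)"
    and R_int: "integrable lborel (\<lambda>t. J h t * (v t * P t (x + y + h - t)))" for h
  proof -
    have i1: "integrable lborel (\<lambda>t. indicator {x..} t * (v t * P t (x + y + h - t)))"
      using char_int_integrable[OF P v, of x "y + h"] by (simp add: add.assoc)
    have i2: "integrable lborel (\<lambda>t. indicator {x+h..} t * (v t * P t (x + y + h - t)))"
      using char_int_integrable[OF P v, of "x + h" y] by (simp add: algebra_simps)
    have e1: "char_int v P x (y + h) = (\<integral>t. indicator {x..} t * (v t * P t (x + y + h - t))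
        \<partial>lborel)"
      by (simp add: char_int_def add.assoc)
    have e2: "char_int v P (x + h) y = (\<integral>t. indicator {x+h..} t * (v t * P t (x + y + h - t))
        \<partial>lborel)"
      by (simp add: char_int_def algebra_simps)
    show "R h = (\<integral>t. J h t * (v t * P t (x + y + h - t)) \<partial>lborel)"
      unfolding R_def e1 e2 J_def left_diff_distrib by (rule
          Bochner_Integration.integral_diff[symmetric, OF i1 i2])
    show "integrable lborel (\<lambda>t. J h t * (v t * P t (x + y + h - t)))"
      unfolding J_def left_diff_distrib by (rule Bochner_Integration.integrable_diff[OF i1 i2])
  qed
  have "(R has_real_derivative L) (at 0)"
    unfolding has_field_derivative_iff Lim_at dist_real_def
  proof (intro allI impI)
    fix e :: real assume e: "e > 0"
    have "isCont (\<lambda>q. P (fst q) (snd q)) (x, y)"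
      using P y open_upper by (auto simp: admissible_def continuous_on_eq_continuous_at)
    moreover have "isCont v x" using cv by (simp add: continuous_on_eq_continuous_at)
    then have "isCont (\<lambda>q. v (fst q)) (x, y)" 
      using isCont_o2[OF continuous_fst[OF continuous_ident], of "(x, y)" v] by simp
    ultimately have "isCont (\<lambda>q. v (fst q) * P (fst q) (snd q)) (x, y)" by (intro continuous_mult)
    then obtain d where d: "d > 0" "\<And>q. dist q (x, y) < d \<Longrightarrow> dist (v (fst q) * P (fst q) (snd q)) (v
        x * P x y) < e / 2"
      unfolding continuous_at_eps_delta using e by (force dest: spec[of _ "e / 2"])
    \<comment> \<open>On the short interval both arguments of \<open>P\<close> approach
      \<open>(x, y)\<close>, a point off the axis, so joint continuity makes the integrand nearly
      equal to \<open>L\<close>. Half of \<open>e\<close> leaves room for the strict inequality at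
      the end.\<close>
    have d': "\<bar>v t * P t z - L\<bar> \<le> e / 2" if "\<bar>t - x\<bar> < d / 2" "\<bar>z - y\<bar> < d / 2" for t z
    proof -
      have "dist (t, z) (x, y) \<le> \<bar>t - x\<bar> + \<bar>z - y\<bar>" 
        unfolding dist_Pair_Pair dist_real_def using sqrt_sum_squares_le_sum_abs[of "\<bar>t - x\<bar>" "\<bar>z -
            y\<bar>"] by simp
      with that have "dist (t, z) (x, y) < d" by simp
      from d(2)[OF this] show ?thesis by (simp add: L_def dist_real_def)
    qed
    show "\<exists>d>0. \<forall>h. 0 < \<bar>h - 0\<bar> \<and> \<bar>h - 0\<bar> < d \<longrightarrow> \<bar>(R h - R 0) / (h - 0) - L\<bar> < e"
    proof (intro exI[of _ "d / 2"] conjI allI impI)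
      fix h :: real assume h: "0 < \<bar>h - 0\<bar> \<and> \<bar>h - 0\<bar> < d / 2"
      have "R h - h * L = (\<integral>t. J h t * (v t * P t (x + y + h - t)) \<partial>lborel) - (\<integral>t. J h t * L
          \<partial>lborel)"
        by (simp add: R_eq J_eq)
      also have "\<dots> = (\<integral>t. J h t * (v t * P t (x + y + h - t)) - J h t * L \<partial>lborel)"
        by (intro Bochner_Integration.integral_diff[symmetric] R_int integrable_mult_left J_int)
      finally have "\<bar>R h - h * L\<bar> = \<bar>\<integral>t. J h t * (v t * P t (x + y + h - t)) - J h t * L \<partial>lborel\<bar>"
          by simp
      also have "\<dots> \<le> (e / 2) * (\<integral>t. \<bar>J h t\<bar> \<partial>lborel)"
      proof (rule dominated_integrable(2)[OF J_int])
        fix t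
        show "\<bar>J h t * (v t * P t (x + y + h - t)) - J h t * L\<bar> \<le> e / 2 * \<bar>J h t\<bar>"
        proof (cases "J h t = 0")
          case False
          then have "(x \<le> t \<and> t < x + h) \<or> (x + h \<le> t \<and> t < x)" by (auto simp: J_def indicator_def
              split: if_splits)
          then have "\<bar>v t * P t (x + y + h - t) - L\<bar> \<le> e / 2" using h by (intro d') auto
          then have "\<bar>J h t\<bar> * \<bar>v t * P t (x + y + h - t) - L\<bar> \<le> \<bar>J h t\<bar> * (e / 2)" by (intro
              mult_left_mono) auto
          then show ?thesis by (simp add: abs_mult[symmetric] right_diff_distrib mult.commute)
        qed simp
      qed (auto simp: J_def)
      also have "\<dots> = e / 2 * \<bar>h\<bar>" by (simp add: J_le)
      also have "\<dots> < e * \<bar>h\<bar>" using e h by simp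
      finally have "\<bar>R h - h * L\<bar> / \<bar>h\<bar> < e" using h by (simp add: pos_divide_less_eq)
      moreover have "\<bar>R h - h * L\<bar> / \<bar>h\<bar> = \<bar>R h / h - L\<bar>"
      proof -
        have "h \<noteq> 0" using h by auto
        then have "(R h - h * L) / h = R h / h - L" by (simp add: diff_divide_distrib)
        then show ?thesis by (metis abs_divide)
      qed
      moreover have "R 0 = 0" by (simp add: R_def)
      ultimately show "\<bar>(R h - R 0) / (h - 0) - L\<bar> < e" by simp
    qed (use d in auto)
  qed
  moreover have "((\<lambda>h. char_int v P (x + h) y) has_real_derivative D) (at 0)"
    using D DERIV_shift[of "\<lambda>x. char_int v P x y" D 0 x] by (simp add: add.commute)
  ultimately have "((\<lambda>h. char_int v P (x + h) y + R h) has_real_derivative D + L) (at 0)" by (intro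
      DERIV_add)
  then have "((\<lambda>h. char_int v P x (y + h)) has_real_derivative D + L) (at 0)" by (simp add: R_def)
  then show ?thesis using DERIV_shift[of "char_int v P x" "D + L" 0 y] by (simp add: add.commute
      L_def)
qed

lemma tail_int_x_ac:
  "admissible P \<Longrightarrow> integrable lborel v \<Longrightarrow> a \<le> b \<Longrightarrow> tail_int v P b y - tail_int v P a y = (LINT
      t:{a..b}|lborel. - (v t * P t y))"
  unfolding tail_int_def by (rule tail_integral_diff[OF tail_int_integrable])

lemma tail_int_x_deriv:
  assumes P: "admissible P" and v: "integrable lborel v" and cv: "continuous_on UNIV v" and y: "0 <
      y"
  shows "((\<lambda>x. tail_int v P x y) has_real_derivative - (v x * P x y)) (at x)"
proof (rule deriv_of_ac_continuous[where S=UNIV])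
  show "continuous_on UNIV (\<lambda>x. - (v x * P x y))"
    using admissible_section_continuous[OF P y, of 0] cv by (intro continuous_intros) auto
qed (auto intro: tail_int_x_ac[OF P v])

text \<open>The fundamental theorem in \<open>y\<close> for each \<open>t\<close>, integrated
  against \<open>v\<close>. The intervals stay inside the open half-line, so the jump at the axis
  does not enter.\<close>

lemma tail_int_y_deriv:
  assumes P: "admissible P" and Py: "admissible Py" and v: "integrable lborel v" 
    and D: "\<And>x y. 0 < y \<Longrightarrow> (P x has_real_derivative Py x y) (at y)"
    and y: "0 < y"
  shows "(tail_int v P x has_real_derivative tail_int v Py x y) (at y)"
proof (rule deriv_of_ac_continuous[where S="{0<..}"])
  have [measurable]: "case_prod P \<in> borel_measurable (borel \<Otimes>\<^sub>M borel)" using P by (rule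
      admissible_measurable_prod)
  have [measurable]: "case_prod Py \<in> borel_measurable (borel \<Otimes>\<^sub>M borel)" using Py by (rule
      admissible_measurable_prod)
  have [measurable]: "v \<in> borel_measurable borel" using v by (simp add: borel_measurable_integrable)
  show "continuous_on {0<..} (tail_int v Py x)" by (intro admissible_section_continuous'
      admissible_tail_int Py v)
  fix c d :: real assume cd: "c \<le> d" "{c..d} \<subseteq> {0<..}"
  then have c: "0 < c" by auto
  obtain K where K: "0 \<le> K" "\<And>t z. x \<le> t \<Longrightarrow> z \<le> d \<Longrightarrow> \<bar>Py t z\<bar> \<le> K" using admissible_bounded[OF Py] by
      blast
  have FTC: "has_bochner_integral lborel (\<lambda>z. Py t z * indicator {c..d} z) (P t d - P t c)" for t
    by (rule has_bochner_integral_FTC_Icc_real[OF cd(1)])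
       (use D c admissible_section_continuous'[OF Py] in \<open>auto simp:
           continuous_on_eq_continuous_at\<close>)
  have int2: "integrable (lborel \<Otimes>\<^sub>M lborel) (\<lambda>(t,z). indicator {x..} t * (v t * (indicator {c..d} z
      * Py t z)))"
  proof (rule Bochner_Integration.integrable_bound)
    show "integrable (lborel \<Otimes>\<^sub>M lborel) (\<lambda>(t,z). K * (v t * indicator {c..d} z))"
    proof (rule lborel_pair.Fubini_integrable)
      show "integrable lborel (\<lambda>t. \<integral>z. norm (case (t, z) of (t, z) \<Rightarrow> K * (v t * indicat_real {c..d}
          z)) \<partial>lborel)"
        using v by (simp add: abs_mult)
    qed auto
    show "AE q in lborel \<Otimes>\<^sub>M lborel. norm (case q of (t,z) \<Rightarrow> indicator {x..} t * (v t * (indicator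
        {c..d} z * Py t z)))
        \<le> norm (case q of (t,z) \<Rightarrow> K * (v t * indicator {c..d} z))"
    proof (intro AE_I2, clarify)
      fix t z :: real
      show "norm (indicator {x..} t * (v t * (indicator {c..d} z * Py t z))) \<le> norm (K * (v t *
          indicator {c..d} z))"
        using K by (auto simp: indicator_def abs_mult mult.commute[of K] intro!: mult_left_mono)
    qed
  qed measurable
  have "tail_int v P x d - tail_int v P x c = (\<integral>t. indicator {x..} t * (v t * P t d) - indicator
      {x..} t * (v t * P t c) \<partial>lborel)"
    unfolding tail_int_def by (intro Bochner_Integration.integral_diff[symmetric]
        tail_int_integrable P v)
  also have "\<dots> = (\<integral>t. \<integral>z. indicator {x..} t * (v t * (indicator {c..d} z * Py t z)) \<partial>lborel
      \<partial>lborel)"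
  proof (intro Bochner_Integration.integral_cong refl)
    fix t
    have "(\<integral>z. indicator {c..d} z * Py t z \<partial>lborel) = P t d - P t c"
      using has_bochner_integral_iff[THEN iffD1, OF FTC[of t]] by (simp add: mult.commute)
    then show "indicator {x..} t * (v t * P t d) - indicator {x..} t * (v t * P t c)
      = (\<integral>z. indicator {x..} t * (v t * (indicator {c..d} z * Py t z)) \<partial>lborel)"
      by (simp add: right_diff_distrib)
  qed
  also have "\<dots> = (\<integral>z. \<integral>t. indicator {x..} t * (v t * (indicator {c..d} z * Py t z)) \<partial>lborel
      \<partial>lborel)"
    using lborel_pair.Fubini_integral[OF int2] by simp
  also have "\<dots> = (LINT y:{c..d}|lborel. tail_int v Py x y)"
    unfolding set_lebesgue_integral_def tail_int_def
    by (intro Bochner_Integration.integral_cong refl) (auto simp: indicator_def)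
  finally show "tail_int v P x d - tail_int v P x c = (LINT y:{c..d}|lborel. tail_int v Py x y)" .
qed (use y in auto)

section \<open>Smooth kernels\<close>

text \<open>Restricted to the open half-plane, since the extension by zero may jump at the
  axis.\<close>

definition partials :: "(real \<Rightarrow> real \<Rightarrow> real) \<Rightarrow> (real \<Rightarrow> real \<Rightarrow> real) \<Rightarrow> (real \<Rightarrow> real \<Rightarrow> real) \<Rightarrow> bool"
    where
  "partials P Px Py \<longleftrightarrow> (\<forall>x. \<forall>y>0. ((\<lambda>x. P x y) has_real_derivative Px x y) (at x) \<and>
     (P x has_real_derivative Py x y) (at y))"

text \<open>
  \<open>C\<close> bounds the moments of all partial derivatives up to order \<open>m\<close>, and
  \<open>p\<close> is the power of \<open>left_weight\<close> in these bounds.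
\<close>
fun smooth_kernel :: "nat \<Rightarrow> nat \<Rightarrow> nat \<Rightarrow> real \<Rightarrow> (real \<Rightarrow> real \<Rightarrow> real) \<Rightarrow> bool" where
  "smooth_kernel s p 0 C P \<longleftrightarrow> admissible P \<and> (\<forall>x. nn_moment s (P x) \<le> ennreal (C * left_weight x ^
      p))"
| "smooth_kernel s p (Suc m) C P \<longleftrightarrow> smooth_kernel s p 0 C P \<and> (\<exists>Px Py. partials P Px Py \<and>
    smooth_kernel s p m C Px \<and> smooth_kernel s p m C Py)"

lemma smooth_kernel_0: "smooth_kernel s p m C P \<Longrightarrow> smooth_kernel s p 0 C P" by (cases m) auto

lemma smooth_kernel_admissible: "smooth_kernel s p m C P \<Longrightarrow> admissible P" by (cases m) auto

lemma smooth_kernel_nn_moment: "smooth_kernel s p m C P \<Longrightarrow> nn_moment s (P x) \<le> ennreal (C *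
    left_weight x ^ p)" by (cases m) auto

lemma smooth_kernel_Suc_D: "smooth_kernel s p (Suc m) C P \<Longrightarrow> smooth_kernel s p m C P"
proof (induction m arbitrary: P)
  case (Suc m)
  from Suc.prems obtain Px Py where *: "smooth_kernel s p 0 C P" "partials P Px Py" "smooth_kernel s
      p (Suc m) C Px" "smooth_kernel s p (Suc m) C Py"
    by (subst (asm) smooth_kernel.simps(2)) blast
  from * Suc.IH[OF *(3)] Suc.IH[OF *(4)] show ?case by (subst smooth_kernel.simps(2)) blast
qed auto

lemma left_weight_power_nonneg [simp]: "0 \<le> left_weight x ^ p" using left_weight_ge_1[of x] by simp

lemma smooth_kernel_0_mono:
  assumes "smooth_kernel s p 0 C P" "\<And>x. C * left_weight x ^ p \<le> C' * left_weight x ^ q"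
  shows "smooth_kernel s q 0 C' P"
proof -
  have "nn_moment s (P x) \<le> ennreal (C' * left_weight x ^ q)" for x
    using smooth_kernel_nn_moment[OF assms(1), of x] ennreal_leI[OF assms(2), of x] by (rule
        order_trans)
  with assms(1) show ?thesis by simp
qed

lemma smooth_kernel_const_mono: "smooth_kernel s p m C P \<Longrightarrow> C \<le> C' \<Longrightarrow> smooth_kernel s p m C' P"
proof (induction m arbitrary: P)
  case 0
  then show ?case by (intro smooth_kernel_0_mono[OF 0(1)] mult_right_mono) simp_all
next
  case (Suc m)
  from Suc.prems obtain Px Py where *: "smooth_kernel s p 0 C P" "partials P Px Py" "smooth_kernel s
      p m C Px" "smooth_kernel s p m C Py" by auto
  have "smooth_kernel s p 0 C' P" using Suc.prems(2) by (intro smooth_kernel_0_mono[OF *(1)]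
      mult_right_mono) simp_all
  with * Suc.IH[OF *(3) Suc.prems(2)] Suc.IH[OF *(4) Suc.prems(2)] show ?case by (subst
      smooth_kernel.simps(2)) blast
qed

text \<open>The operators take exponent \<open>s + 1\<close> to exponent \<open>s\<close>. This
  lemma gives the gain away again, so that the derivatives just bounded can be fed into the next
  round of the bootstrap.\<close>

lemma smooth_kernel_weight_mono: "smooth_kernel s s m C P \<Longrightarrow> 0 \<le> C \<Longrightarrow> smooth_kernel s (s + 1) m C P"
proof (induction m arbitrary: P)
  case 0
  have "C * left_weight x ^ s \<le> C * left_weight x ^ (s + 1)" for x
    using 0 left_weight_ge_1[of x] by (intro mult_left_mono power_increasing) auto
  with 0 show ?case by (intro smooth_kernel_0_mono[OF 0(1)]) simp_all
next
  case (Suc m)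
  have "C * left_weight x ^ s \<le> C * left_weight x ^ (s + 1)" for x
    using Suc left_weight_ge_1[of x] by (intro mult_left_mono power_increasing) auto
  then have "smooth_kernel s (s + 1) 0 C P" by (rule smooth_kernel_0_mono[OF smooth_kernel_0[OF
      Suc.prems(1)]])
  moreover from Suc.prems obtain Px Py where "partials P Px Py" "smooth_kernel s s m C Px"
      "smooth_kernel s s m C Py" by auto
  ultimately show ?case using Suc.IH Suc.prems(2) by (subst smooth_kernel.simps(2)) blast
qed

lemma admissible_section_measurable: "admissible P \<Longrightarrow> P x \<in> borel_measurable borel"
proof -
  assume "admissible P"
  then have [measurable]: "case_prod P \<in> borel_measurable (borel \<Otimes>\<^sub>M borel)" by (rule
      admissible_measurable_prod)
  show ?thesis by measurable
qed

lemma smooth_kernel_add: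
  assumes "0 \<le> C" "0 \<le> D"
  shows "smooth_kernel s p m C P \<Longrightarrow> smooth_kernel s p m D R \<Longrightarrow> smooth_kernel s p m (C + D) (\<lambda>x y. P x
      y + R x y)"
proof (induction m arbitrary: P R)
  have base: "smooth_kernel s p 0 (C + D) (\<lambda>x y. P x y + R x y)" if PR: "smooth_kernel s p 0 C P"
      "smooth_kernel s p 0 D R" for P R
  proof -
    have "nn_moment s (\<lambda>y. P x y + R x y) \<le> ennreal ((C + D) * left_weight x ^ p)" for x
    proof -
      have "nn_moment s (\<lambda>y. P x y + R x y) \<le> nn_moment s (P x) + nn_moment s (R x)"
        using PR by (intro nn_moment_add admissible_section_measurable) auto
      also have "\<dots> \<le> ennreal (C * left_weight x ^ p) + ennreal (D * left_weight x ^ p)"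
        using PR by (intro add_mono) auto
      also have "\<dots> = ennreal ((C + D) * left_weight x ^ p)"
        using assms by (subst ennreal_plus[symmetric]) (auto simp: distrib_right)
      finally show ?thesis .
    qed
    then show ?thesis using PR by (auto intro: admissible_add)
  qed
  {
    case 0
    then show ?case by (rule base)
  next
    case (Suc m)
    from Suc.prems obtain Px Py where P: "smooth_kernel s p 0 C P" "partials P Px Py" "smooth_kernel
        s p m C Px" "smooth_kernel s p m C Py" by auto
    from Suc.prems obtain Rx Ry where R: "smooth_kernel s p 0 D R" "partials R Rx Ry" "smooth_kernel
        s p m D Rx" "smooth_kernel s p m D Ry" by auto
    have "partials (\<lambda>x y. P x y + R x y) (\<lambda>x y. Px x y + Rx x y) (\<lambda>x y. Py x y + Ry x y)"
      using P(2) R(2) by (auto simp: partials_def intro!: DERIV_add)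
    with base[OF P(1) R(1)] Suc.IH[OF P(3) R(3)] Suc.IH[OF P(4) R(4)]
    show ?case by (subst smooth_kernel.simps(2)) blast
  }
qed

lemma smooth_kernel_uminus: "smooth_kernel s p m C P \<Longrightarrow> smooth_kernel s p m C (\<lambda>x y. - P x y)"
proof (induction m arbitrary: P)
  case 0
  then show ?case by (auto intro: admissible_uminus simp: nn_moment_def)
next
  case (Suc m)
  from Suc.prems obtain Px Py where P: "smooth_kernel s p 0 C P" "partials P Px Py" "smooth_kernel s
      p m C Px" "smooth_kernel s p m C Py" by auto
  have "partials (\<lambda>x y. - P x y) (\<lambda>x y. - Px x y) (\<lambda>x y. - Py x y)"
    using P(2) by (auto simp: partials_def intro!: DERIV_minus)
  moreover have "smooth_kernel s p 0 C (\<lambda>x y. - P x y)" using P(1) by (auto intro: admissible_uminus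
      simp: nn_moment_def)
  ultimately show ?case using Suc.IH[OF P(3)] Suc.IH[OF P(4)] by (subst smooth_kernel.simps(2))
      blast
qed

text \<open>\<open>w i\<close> stands for the i-th derivative of a Borel representative of the
  potential. For \<open>i < m\<close> it is continuous, being an integral; \<open>w m\<close> is
  merely integrable. A single \<open>N\<close> bounds all of them.\<close>

definition potential :: "nat \<Rightarrow> nat \<Rightarrow> real \<Rightarrow> (nat \<Rightarrow> real \<Rightarrow> real) \<Rightarrow> bool" where
  "potential s m N w \<longleftrightarrow> (\<forall>i\<le>m. weighted s N (w i)) \<and> (\<forall>i<m. ac_pair (w i) (w (Suc i)))"

lemma potential_Suc: "potential s (Suc m) N w \<Longrightarrow> potential s m N (\<lambda>i. w (Suc i))"
  by (auto simp: potential_def)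

lemma potential_mono: "potential s m N w \<Longrightarrow> j \<le> m \<Longrightarrow> potential s j N w"
  by (auto simp: potential_def)

lemma potential_0: "potential s m N w \<Longrightarrow> weighted s N (w 0)" by (simp add: potential_def)

lemma potential_nonneg: "potential s m N w \<Longrightarrow> 0 \<le> N" by (auto simp: potential_def weighted_def)

lemma potential_Suc_D:
  assumes "potential s (Suc m) N w"
  shows "ac_pair (w 0) (w 1)" "continuous_on UNIV (w 0)" "\<bar>w 0 x\<bar> * (1 + \<bar>x\<bar>) ^ (s + 1) \<le> N" "\<bar>w 0
      x\<bar> \<le> N"
    "integrable lborel (w 0)" "integrable lborel (w 1)"
proof -
  have w: "weighted s N (w 0)" "weighted s N (w 1)" and ac: "ac_pair (w 0) (w 1)" using assms by
      (auto simp: potential_def)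
  show "ac_pair (w 0) (w 1)" by (rule ac)
  show i: "integrable lborel (w 0)" "integrable lborel (w 1)" using w weighted_integrable by blast+
  show "continuous_on UNIV (w 0)" by (rule ac_pair_continuous[OF ac i(2)])
  show *: "\<bar>w 0 x\<bar> * (1 + \<bar>x\<bar>) ^ (s + 1) \<le> N" by (rule weighted_ac_bound[OF w ac])
  have "\<bar>w 0 x\<bar> * 1 \<le> \<bar>w 0 x\<bar> * (1 + \<bar>x\<bar>) ^ (s + 1)" by (intro mult_left_mono one_le_power) auto
  with * show "\<bar>w 0 x\<bar> \<le> N" by simp
qed

text \<open>Two derivatives are assumed because \<open>w 1\<close> has to be an integral itself to
  be continuous; only then is \<open>w 0\<close> differentiable at every point and not just almost
  everywhere.\<close>

lemma potential_deriv:
  assumes "potential s (Suc (Suc m)) N w"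
  shows "(w 0 has_real_derivative w 1 x) (at x)"
proof (rule deriv_of_ac_continuous[where S=UNIV])
  show "continuous_on UNIV (w 1)" using potential_Suc_D(2)[OF potential_Suc[OF assms]] by simp
  have "potential s (Suc m) N w" using assms potential_mono by simp
  from potential_Suc_D(1)[OF this] show "w 0 b - w 0 a = (LINT t:{a..b}|lborel. w 1 t)" if "a \<le> b"
      for a b
    using that by (simp add: ac_pair_def)
qed auto

text \<open>Leibniz' rule doubles the number of terms with each derivative in \<open>x\<close>,
  whence \<open>2 ^ m\<close>. One derivative more of the potential is assumed than is taken of the
  product, because the pointwise decay of \<open>w i\<close> is obtained from
  \<open>w (Suc i)\<close>.\<close>

lemma smooth_kernel_mult_left:
  "potential s (Suc m) N w \<Longrightarrow> smooth_kernel s (s + 1) m C P \<Longrightarrow> 0 \<le> C \<Longrightarrow> smooth_kernel s s m (2 ^ m * C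
      * N) (\<lambda>x y. w 0 x * P x y)"
proof (induction m arbitrary: w P)
  have base: "smooth_kernel s s 0 (2 ^ j * C * N) (\<lambda>x y. w 0 x * P x y)"
    if w: "potential s (Suc m) N w" and P: "smooth_kernel s (s + 1) 0 C P" and C: "0 \<le> C" for w P m
        j
  proof -
    have N: "0 \<le> N" by (rule potential_nonneg[OF w])
    have "nn_moment s (\<lambda>y. w 0 x * P x y) \<le> ennreal (C * N * left_weight x ^ s)" for x
      by (rule nn_moment_mult_left[OF smooth_kernel_admissible[OF P] C N potential_Suc_D(3)[OF w]
          smooth_kernel_nn_moment[OF P]])
    moreover have "admissible (\<lambda>x y. w 0 x * P x y)"
      by (rule admissible_mult_left[OF smooth_kernel_admissible[OF P] potential_Suc_D(2)[OF w]
          potential_Suc_D(4)[OF w]])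
    ultimately have "smooth_kernel s s 0 (C * N) (\<lambda>x y. w 0 x * P x y)" by simp
    moreover have "C * N \<le> 2 ^ j * C * N" using mult_right_mono[of 1 "2 ^ j" "C * N"] C N by (simp
        add: mult.assoc)
    ultimately show ?thesis by (rule smooth_kernel_const_mono)
  qed
  {
    case 0
    then show ?case using base by blast
  next
    case (Suc m)
    let ?K = "2 ^ m * C * N"
    have K: "0 \<le> ?K" using Suc.prems(3) potential_nonneg[OF Suc.prems(1)] by simp
    from Suc.prems obtain Px Py where P: "smooth_kernel s (s + 1) 0 C P" "partials P Px Py"
        "smooth_kernel s (s + 1) m C Px" "smooth_kernel s (s + 1) m C Py" by auto
    have w0: "potential s (Suc m) N w" using Suc.prems(1) potential_mono by simp
    have w1: "potential s (Suc m) N (\<lambda>i. w (Suc i))" by (rule potential_Suc[OF Suc.prems(1)])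
    have Pm: "smooth_kernel s (s + 1) m C P" by (rule smooth_kernel_Suc_D[OF Suc.prems(2)])
    have "partials (\<lambda>x y. w 0 x * P x y) (\<lambda>x y. w 1 x * P x y + w 0 x * Px x y) (\<lambda>x y. w 0 x * Py x
        y)"
      using P(2) potential_deriv[OF Suc.prems(1)] by (auto simp: partials_def intro!:
          derivative_eq_intros)
    moreover have "smooth_kernel s s m (?K + ?K) (\<lambda>x y. w 1 x * P x y + w 0 x * Px x y)"
      using Suc.IH[OF w1 Pm Suc.prems(3)] Suc.IH[OF w0 P(3) Suc.prems(3)] K by (intro
          smooth_kernel_add) auto
    then have "smooth_kernel s s m (2 ^ Suc m * C * N) (\<lambda>x y. w 1 x * P x y + w 0 x * Px x y)"
      by (rule smooth_kernel_const_mono) simp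
    moreover have "smooth_kernel s s m (2 ^ Suc m * C * N) (\<lambda>x y. w 0 x * Py x y)"
      by (rule smooth_kernel_const_mono[OF Suc.IH[OF w0 P(4) Suc.prems(3)]]) (use Suc.prems(3)
          potential_nonneg[OF w0] in simp)
    moreover have "smooth_kernel s s 0 (2 ^ Suc m * C * N) (\<lambda>x y. w 0 x * P x y)" by (rule base[OF
        w0 P(1) Suc.prems(3)])
    ultimately show ?case by (subst smooth_kernel.simps(2)) blast
  }
qed

text \<open>Both partial derivatives of the shifted potential are the shift of its derivative, so
  the constant does not grow. The extra derivative of the potential makes the last shift
  continuous.\<close>

lemma smooth_kernel_shift: "potential s (Suc m) N w \<Longrightarrow> smooth_kernel s s m N (shift (w 0))"
proof (induction m arbitrary: w)
  have base: "smooth_kernel s s 0 N (shift (w 0))" if w: "potential s (Suc m) N w" for w m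
    using admissible_shift[OF potential_Suc_D(2)[OF w] potential_Suc_D(4)[OF w]] nn_moment_shift[OF
        potential_0[OF w]] by simp
  {
    case 0
    then show ?case by (rule base)
  next
    case (Suc m)
    have "partials (shift (w 0)) (shift (w 1)) (shift (w 1))"
      unfolding partials_def
    proof (intro allI impI conjI)
      fix x y :: real assume y: "0 < y"
      note d = potential_deriv[OF Suc.prems, of "x + y"]
      have "((\<lambda>x. w 0 (x + y)) has_real_derivative w 1 (x + y)) (at x)"
        using d DERIV_shift[of "w 0" "w 1 (x + y)" x y] by simp
      then show "((\<lambda>x. shift (w 0) x y) has_real_derivative shift (w 1) x y) (at x)"
        using y by (simp add: shift_def)
      have "((\<lambda>y. w 0 (x + y)) has_real_derivative w 1 (x + y)) (at y)"
        using d DERIV_shift[of "w 0" "w 1 (x + y)" y x] by (simp add: add.commute)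
      then have "((\<lambda>y. w 0 (x + y)) has_real_derivative shift (w 1) x y) (at y)" using y by (simp
          add: shift_def)
      then show "(shift (w 0) x has_real_derivative shift (w 1) x y) (at y)"
        by (rule has_field_derivative_transform_within_open[where S="{0<..}"]) (use y in \<open>auto simp:
            shift_def\<close>)
    qed
    moreover have "smooth_kernel s s m N (shift (w 1))" using Suc.IH[OF potential_Suc[OF Suc.prems]]
        by simp
    ultimately show ?case using base[OF Suc.prems] by (subst smooth_kernel.simps(2)) blast
  }
qed

text \<open>In contrast to multiplication, \<open>m\<close> derivatives of the potential suffice, as
  the top one occurs only under the integral. A derivative in \<open>y\<close> has three terms, two
  characteristic integrals and the product \<open>w 0 * P\<close>, whence \<open>3 ^ m\<close>. The
  product loses one order of regularity, but it appears only after one differentiation.\<close>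

lemma smooth_kernel_char_int:
  "potential s m N w \<Longrightarrow> smooth_kernel s (s + 1) m C P \<Longrightarrow> 0 \<le> C \<Longrightarrow> smooth_kernel s s m (3 ^ m * C * N)
      (char_int (w 0) P)"
proof (induction m arbitrary: w P)
  have base: "smooth_kernel s s 0 (3 ^ j * C * N) (char_int (w 0) P)"
    if w: "potential s m N w" and P: "smooth_kernel s (s + 1) 0 C P" and C: "0 \<le> C" for w P m j
  proof -
    have N: "0 \<le> N" by (rule potential_nonneg[OF w])
    have "nn_moment s (char_int (w 0) P x) \<le> ennreal (C * N * left_weight x ^ s)" for x
      by (rule nn_moment_char_int[OF smooth_kernel_admissible[OF P] potential_0[OF w] C
          smooth_kernel_nn_moment[OF P]])
    then have "smooth_kernel s s 0 (C * N) (char_int (w 0) P)"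
      using admissible_char_int[OF smooth_kernel_admissible[OF P] weighted_integrable[OF
          potential_0[OF w]]] by simp
    moreover have "C * N \<le> 3 ^ j * C * N" using mult_right_mono[of 1 "3 ^ j" "C * N"] C N by (simp
        add: mult.assoc)
    ultimately show ?thesis by (rule smooth_kernel_const_mono)
  qed
  {
    case 0
    then show ?case using base by blast
  next
    case (Suc m)
    have CN: "0 \<le> C" "0 \<le> N" using Suc.prems(3) potential_nonneg[OF Suc.prems(1)] by auto
    let ?K = "3 ^ m * C * N"
    have K: "0 \<le> ?K" using CN by simp
    from Suc.prems obtain Px Py where P: "smooth_kernel s (s + 1) 0 C P" "partials P Px Py"
        "smooth_kernel s (s + 1) m C Px" "smooth_kernel s (s + 1) m C Py" by auto
    have w0: "potential s m N w" using Suc.prems(1) potential_mono by simp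
    have w1: "potential s m N (\<lambda>i. w (Suc i))" by (rule potential_Suc[OF Suc.prems(1)])
    have Pm: "smooth_kernel s (s + 1) m C P" by (rule smooth_kernel_Suc_D[OF Suc.prems(2)])
    define X where "X x y = char_int (w 1) P x y + char_int (w 0) Px x y" for x y
    define Y where "Y x y = X x y + w 0 x * P x y" for x y
    note wD = potential_Suc_D[OF Suc.prems(1)]
    have dx: "((\<lambda>x. char_int (w 0) P x y) has_real_derivative X x y) (at x)" if "0 < y" for x y
      unfolding X_def
      by (rule char_int_x_deriv[OF smooth_kernel_admissible[OF Pm] smooth_kernel_admissible[OF P(3)]
          wD(5,6,1) _ that]) (use P(2) in \<open>auto simp: partials_def\<close>)
    have "(char_int (w 0) P x has_real_derivative Y x y) (at y)" if "0 < y" for x y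
      unfolding Y_def by (rule char_int_y_deriv[OF smooth_kernel_admissible[OF Pm] wD(5,2) dx[OF
          that] that])
    with dx have "partials (char_int (w 0) P) X Y" by (simp add: partials_def)
    moreover have X: "smooth_kernel s s m (?K + ?K) X"
      using smooth_kernel_add[OF K K Suc.IH[OF w1 Pm CN(1)] Suc.IH[OF w0 P(3) CN(1)]] by (simp add:
          X_def[abs_def])
    then have "smooth_kernel s s m (3 ^ Suc m * C * N) X" by (rule smooth_kernel_const_mono) (use CN
        in simp)
    moreover have "smooth_kernel s s m (?K + ?K + 2 ^ m * C * N) Y"
      unfolding Y_def[abs_def] using CN K
      by (intro smooth_kernel_add X smooth_kernel_mult_left[OF Suc.prems(1) Pm]) auto
    then have "smooth_kernel s s m (3 ^ Suc m * C * N) Y"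
    proof (rule smooth_kernel_const_mono)
      have "2 ^ m * C * N \<le> ?K" using CN by (intro mult_right_mono power_mono) auto
      moreover have "3 ^ Suc m * C * N = ?K + ?K + ?K" by simp
      ultimately show "?K + ?K + 2 ^ m * C * N \<le> 3 ^ Suc m * C * N" by linarith
    qed
    moreover have "smooth_kernel s s 0 (3 ^ Suc m * C * N) (char_int (w 0) P)" by (rule base[OF w0
        P(1) CN(1)])
    ultimately show ?case by (subst smooth_kernel.simps(2)) blast
  }
qed

text \<open>The derivative in \<open>y\<close> passes to the kernel and the derivative in
  \<open>x\<close> removes the integral, so the potential stays \<open>w 0\<close> throughout the
  induction. The constant \<open>2 ^ m\<close> is that of the product
  \<open>w 0 * P\<close>.\<close>

lemma smooth_kernel_tail_int:
  "potential s m N w \<Longrightarrow> smooth_kernel s (s + 1) m C P \<Longrightarrow> 0 \<le> C \<Longrightarrow> smooth_kernel s s m (2 ^ m * C * N)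
      (tail_int (w 0) P)"
proof (induction m arbitrary: P)
  have base: "smooth_kernel s s 0 (2 ^ j * C * N) (tail_int (w 0) P)"
    if w: "potential s m N w" and P: "smooth_kernel s (s + 1) 0 C P" and C: "0 \<le> C" for w P m j
  proof -
    have N: "0 \<le> N" by (rule potential_nonneg[OF w])
    have "nn_moment s (tail_int (w 0) P x) \<le> ennreal (C * N * left_weight x ^ s)" for x
      by (rule nn_moment_tail_int[OF smooth_kernel_admissible[OF P] potential_0[OF w] C
          smooth_kernel_nn_moment[OF P]])
    then have "smooth_kernel s s 0 (C * N) (tail_int (w 0) P)"
      using admissible_tail_int[OF smooth_kernel_admissible[OF P] weighted_integrable[OF
          potential_0[OF w]]] by simp
    moreover have "C * N \<le> 2 ^ j * C * N" using mult_right_mono[of 1 "2 ^ j" "C * N"] C N by (simp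
        add: mult.assoc)
    ultimately show ?thesis by (rule smooth_kernel_const_mono)
  qed
  {
    case 0
    then show ?case using base by blast
  next
    case (Suc m)
    have CN: "0 \<le> C" "0 \<le> N" using Suc.prems(3) potential_nonneg[OF Suc.prems(1)] by auto
    let ?K = "2 ^ m * C * N"
    have K: "0 \<le> ?K" using CN by simp
    have KK: "?K \<le> 2 ^ Suc m * C * N" using CN by simp
    from Suc.prems obtain Px Py where P: "smooth_kernel s (s + 1) 0 C P" "partials P Px Py"
        "smooth_kernel s (s + 1) m C Px" "smooth_kernel s (s + 1) m C Py" by auto
    have w0: "potential s m N w" using Suc.prems(1) potential_mono by simp
    have Pm: "smooth_kernel s (s + 1) m C P" by (rule smooth_kernel_Suc_D[OF Suc.prems(2)])
    note wD = potential_Suc_D[OF Suc.prems(1)]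
    have "((\<lambda>x. tail_int (w 0) P x y) has_real_derivative - (w 0 x * P x y)) (at x)" if "0 < y" for
        x y
      by (rule tail_int_x_deriv[OF smooth_kernel_admissible[OF Pm] wD(5,2) that])
    moreover have "(tail_int (w 0) P x has_real_derivative tail_int (w 0) Py x y) (at y)" if "0 < y"
        for x y
      by (rule tail_int_y_deriv[OF smooth_kernel_admissible[OF Pm] smooth_kernel_admissible[OF P(4)]
          wD(5) _ that]) (use P(2) in \<open>auto simp: partials_def\<close>)
    ultimately have "partials (tail_int (w 0) P) (\<lambda>x y. - (w 0 x * P x y)) (tail_int (w 0) Py)" by
        (simp add: partials_def)
    moreover have "smooth_kernel s s m (2 ^ Suc m * C * N) (\<lambda>x y. - (w 0 x * P x y))"
      by (intro smooth_kernel_uminus smooth_kernel_const_mono[OF smooth_kernel_mult_left[OF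
          Suc.prems(1) Pm CN(1)] KK])
    moreover have "smooth_kernel s s m (2 ^ Suc m * C * N) (tail_int (w 0) Py)"
      by (rule smooth_kernel_const_mono[OF Suc.IH[OF w0 P(4) CN(1)] KK])
    moreover have "smooth_kernel s s 0 (2 ^ Suc m * C * N) (tail_int (w 0) P)" by (rule base[OF w0
        P(1) CN(1)])
    ultimately show ?case by (subst smooth_kernel.simps(2)) blast
  }
qed

text \<open>\<open>smooth_kernel\<close> hides a binary tree of partial derivatives behind
  existential quantifiers. Always taking the branch \<open>Py\<close> turns one path of it into a
  sequence of pure derivatives with the same constant.\<close>

lemma smooth_kernel_y_chain:
  "smooth_kernel s p m C P \<Longrightarrow> \<exists>F. F 0 = P \<and> (\<forall>i\<le>m. smooth_kernel s p 0 C (F i)) \<and>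
     (\<forall>i<m. \<forall>x. \<forall>y>0. (F i x has_real_derivative F (Suc i) x y) (at y))"
proof (induction m arbitrary: P)
  case 0
  then show ?case by (intro exI[of _ "\<lambda>_. P"]) auto
next
  case (Suc m)
  then obtain Px Py where P: "smooth_kernel s p 0 C P" "partials P Px Py" "smooth_kernel s p m C Py"
      by auto
  obtain F where F: "F 0 = Py" "\<forall>i\<le>m. smooth_kernel s p 0 C (F i)"
    "\<forall>i<m. \<forall>x. \<forall>y>0. (F i x has_real_derivative F (Suc i) x y) (at y)"
    using Suc.IH[OF P(3)] by blast
  show ?case
  proof (intro exI[of _ "case_nat P F"] conjI allI impI)
    show "smooth_kernel s p 0 C (case_nat P F i)" if "i \<le> Suc m" for i
      using that F(2) P(1) by (cases i) (simp_all del: smooth_kernel.simps)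
    show "(case_nat P F i x has_real_derivative case_nat P F (Suc i) x y) (at y)"
      if "i < Suc m" "0 < y" for i x y
      using that F(1,3) P(2) by (cases i) (simp_all add: partials_def)
  qed simp
qed

lemma smooth_kernel_x_chain:
  "smooth_kernel s p m C P \<Longrightarrow> \<exists>F. F 0 = P \<and> (\<forall>i\<le>m. smooth_kernel s p 0 C (F i)) \<and>
     (\<forall>i<m. \<forall>x. \<forall>y>0. ((\<lambda>x. F i x y) has_real_derivative F (Suc i) x y) (at x))"
proof (induction m arbitrary: P)
  case 0
  then show ?case by (intro exI[of _ "\<lambda>_. P"]) auto
next
  case (Suc m)
  then obtain Px Py where P: "smooth_kernel s p 0 C P" "partials P Px Py" "smooth_kernel s p m C Px"
      by auto
  obtain F where F: "F 0 = Px" "\<forall>i\<le>m. smooth_kernel s p 0 C (F i)"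
    "\<forall>i<m. \<forall>x. \<forall>y>0. ((\<lambda>x. F i x y) has_real_derivative F (Suc i) x y) (at x)"
    using Suc.IH[OF P(3)] by blast
  show ?case
  proof (intro exI[of _ "case_nat P F"] conjI allI impI)
    show "smooth_kernel s p 0 C (case_nat P F i)" if "i \<le> Suc m" for i
      using that F(2) P(1) by (cases i) (simp_all del: smooth_kernel.simps)
    show "((\<lambda>x. case_nat P F i x y) has_real_derivative case_nat P F (Suc i) x y) (at x)"
      if "i < Suc m" "0 < y" for i x y
      using that F(1,3) P(2) by (cases i) (simp_all add: partials_def)
  qed simp
qed

section \<open>Gronwall's inequality on a half-line\<close>

text \<open>Since \<open>- k\<close> is the derivative of \<open>kap\<close>, the integrand is minus
  the derivative of \<open>kap ^ Suc j / Suc j\<close>. This identity is integrated over compact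
  intervals and extended to the half-line by monotone convergence.\<close>

lemma tail_power_nn_integral:
  fixes k :: "real \<Rightarrow> real"
  assumes k: "integrable lborel k" and k0: "\<And>t. 0 \<le> k t"
  defines "kap \<equiv> \<lambda>x. \<integral>t. indicator {x..} t * k t \<partial>lborel"
  shows "(\<integral>\<^sup>+t. indicator {x..} t * ennreal (k t * kap t ^ j) \<partial>lborel) \<le> ennreal (kap x ^ Suc j /
      Suc j)"
proof -
  have [measurable]: "k \<in> borel_measurable borel" using k by (simp add: borel_measurable_integrable)
  have int: "integrable lborel (\<lambda>t. indicator {x..} t * k t)" for x :: real
    by (rule Bochner_Integration.integrable_bound[OF k]) (auto simp: indicator_def)
  have kap0: "0 \<le> kap x" for x unfolding kap_def by (intro integral_nonneg_AE) (auto simp: k0)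
  have ac: "kap b - kap a = (LINT t:{a..b}|lborel. - k t)" if "a \<le> b" for a b
    unfolding kap_def by (rule tail_integral_diff[OF int that])
  have mkint: "integrable lborel (\<lambda>t. - k t)" using k by simp
  have cont: "continuous_on UNIV kap" by (rule ac_pair_continuous[OF _ mkint]) (use ac in \<open>simp add:
      ac_pair_def\<close>)
  then have [measurable]: "kap \<in> borel_measurable borel" by (rule borel_measurable_continuous_onI)
  have anti: "kap b \<le> kap a" if "a \<le> b" for a b
    unfolding kap_def by (rule integral_mono[OF int int]) (use that k0 in \<open>auto simp:
        indicator_def\<close>)
  have kint: "set_integrable lborel {a..b} (\<lambda>t. - (k t * kap t ^ j))" for a b j
    unfolding set_integrable_def
  proof (rule Bochner_Integration.integrable_bound[where f="\<lambda>t. kap a ^ j * k t"])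
    show "AE t in lborel. norm (indicator {a..b} t *\<^sub>R - (k t * kap t ^ j)) \<le> norm (kap a ^ j * k
        t)"
      using kap0 anti by (auto simp: indicator_def abs_mult k0 mult.commute[of "k _"] intro!: AE_I2
          mult_right_mono power_mono)
  qed (use k in auto)
  \<comment> \<open>As \<open>k\<close> is only integrable, the power rule is derived in integrated
    form, by induction from the product rule for absolutely continuous functions.\<close>
  have pw: "kap b ^ Suc j - kap a ^ Suc j = (LINT t:{a..b}|lborel. - (real (Suc j) * (k t * kap t ^
      j)))" if ab: "a \<le> b" for a b j
    using ab
  proof (induction j arbitrary: b)
    case 0
    then show ?case using ac[of a b] by simp
  next
    case (Suc j)
    have "kap b ^ Suc j * kap b - kap a ^ Suc j * kap a =
      (LINT t:{a..b}|lborel. - (real (Suc j) * (k t * kap t ^ j)) * kap t + kap t ^ Suc j * - k t)"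
    proof (rule ac_product_rule[OF Suc.prems])
      show "set_integrable lborel {a..b} (\<lambda>t. - (real (Suc j) * (k t * kap t ^ j)))"
        using set_integrable_mult_right[of "real (Suc j)" lborel "{a..b}" "\<lambda>t. - (k t * kap t ^ j)"]
            kint by simp
      show "set_integrable lborel {a..b} (\<lambda>t. - k t)" using kint[of a b 0] by simp
      fix c assume "c \<in> {a..b}"
      then show "kap c ^ Suc j - kap a ^ Suc j = (LINT t:{a..c}|lborel. - (real (Suc j) * (k t * kap
          t ^ j)))"
        "kap c - kap a = (LINT t:{a..c}|lborel. - k t)" using Suc.IH[of c] ac by auto
    qed auto
    also have "\<dots> = (LINT t:{a..b}|lborel. - (real (Suc (Suc j)) * (k t * kap t ^ Suc j)))"
      by (intro arg_cong2[where f="set_lebesgue_integral lborel"] refl ext) (simp add: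
          algebra_simps)
    finally show ?case by (simp add: mult.commute)
  qed
  define g where "g n t = indicator {x..x + real n} t * ennreal (k t * kap t ^ j)" for n t
  have bound: "(\<integral>\<^sup>+t. g n t \<partial>lborel) \<le> ennreal (kap x ^ Suc j / Suc j)" for n
  proof -
    let ?b = "x + real n"
    have i: "set_integrable lborel {x..?b} (\<lambda>t. k t * kap t ^ j)"
      using set_integrable_mult_right[of "-1" lborel "{x..?b}" "\<lambda>t. - (k t * kap t ^ j)"] kint by
          simp
    have "(\<integral>\<^sup>+t. g n t \<partial>lborel) = (\<integral>\<^sup>+t. ennreal (indicator {x..?b} t *\<^sub>R (k t * kap t ^ j))
        \<partial>lborel)"
      unfolding g_def by (intro nn_integral_cong) (auto simp: indicator_def)
    also have "\<dots> = ennreal (LINT t:{x..?b}|lborel. k t * kap t ^ j)"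
      unfolding set_lebesgue_integral_def using i k0 kap0
      by (intro nn_integral_eq_integral) (auto simp: set_integrable_def)
    also have "\<dots> \<le> ennreal (kap x ^ Suc j / Suc j)"
    proof (rule ennreal_leI)
      have "(LINT t:{x..?b}|lborel. - (real (Suc j) * (k t * kap t ^ j))) = - real (Suc j) * (LINT
          t:{x..?b}|lborel. k t * kap t ^ j)"
        unfolding mult_minus_left[symmetric] by (rule set_integral_mult_right)
      with pw[of x ?b j] have "real (Suc j) * (LINT t:{x..?b}|lborel. k t * kap t ^ j) = kap x ^ Suc
          j - kap ?b ^ Suc j"
        by (simp only: mult_minus_left) linarith
      also have "\<dots> \<le> kap x ^ Suc j" using kap0[of ?b] by simp
      finally show "(LINT t:{x..?b}|lborel. k t * kap t ^ j) \<le> kap x ^ Suc j / Suc j"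
        by (simp add: pos_le_divide_eq mult.commute)
    qed
    finally show ?thesis .
  qed
  have "(\<integral>\<^sup>+t. indicator {x..} t * ennreal (k t * kap t ^ j) \<partial>lborel) = (\<integral>\<^sup>+t. (SUP n. g n t)
      \<partial>lborel)"
  proof (intro nn_integral_cong)
    fix t
    show "indicator {x..} t * ennreal (k t * kap t ^ j) = (SUP n. g n t)"
    proof (rule antisym)
      obtain n where n: "t - x \<le> real n" using real_arch_simple by blast
      then have "indicator {x..} t * ennreal (k t * kap t ^ j) \<le> g n t" by (auto simp: g_def
          indicator_def)
      also have "\<dots> \<le> (SUP n. g n t)" by (rule SUP_upper) simp
      finally show "indicator {x..} t * ennreal (k t * kap t ^ j) \<le> (SUP n. g n t)" .
      show "(SUP n. g n t) \<le> indicator {x..} t * ennreal (k t * kap t ^ j)"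
        by (rule SUP_least) (auto simp: g_def indicator_def)
    qed
  qed
  also have "\<dots> = (SUP n. \<integral>\<^sup>+t. g n t \<partial>lborel)"
  proof (rule nn_integral_monotone_convergence_SUP)
    show "incseq g" by (rule incseq_SucI) (auto simp: g_def le_fun_def indicator_def)
  qed (auto simp: g_def)
  also have "\<dots> \<le> ennreal (kap x ^ Suc j / Suc j)" by (rule SUP_least) (rule bound)
  finally show ?thesis .
qed

text \<open>Picard iteration: \<open>n\<close> insertions of the inequality into itself give
  \<open>A\<close> times a partial sum of the exponential series of \<open>kap x\<close>, plus a
  remainder \<open>K * kap x ^ n / fact n\<close>. The a priori bound \<open>K\<close> enters only
  this remainder, which tends to zero, so it leaves no trace in the result.\<close>

lemma tail_gronwall:
  fixes f k :: "real \<Rightarrow> real"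
  assumes k: "integrable lborel k" and k0: "\<And>t. 0 \<le> k t" and A: "0 \<le> A" and K: "0 \<le> K"
    and f0: "\<And>t. 0 \<le> f t" and fK: "\<And>t. x0 \<le> t \<Longrightarrow> f t \<le> K"
    and fm [measurable]: "f \<in> borel_measurable borel"
    and le: "\<And>x. x0 \<le> x \<Longrightarrow> ennreal (f x) \<le> ennreal A + (\<integral>\<^sup>+t. indicator {x..} t * ennreal (k t * f t)
        \<partial>lborel)"
    and x: "x0 \<le> x"
  shows "f x \<le> A * exp (\<integral>t. k t \<partial>lborel)"
proof -
  define kap where "kap x = (\<integral>t. indicator {x..} t * k t \<partial>lborel)" for x
  have [measurable]: "k \<in> borel_measurable borel" using k by (simp add: borel_measurable_integrable)
  have int: "integrable lborel (\<lambda>t. indicator {x..} t * k t)" for x :: real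
    by (rule Bochner_Integration.integrable_bound[OF k]) (auto simp: indicator_def)
  have kap0: "0 \<le> kap x" for x unfolding kap_def by (intro integral_nonneg_AE) (auto simp: k0)
  have [measurable]: "kap \<in> borel_measurable borel"
    unfolding kap_def by (simp add: indicator_def)
  have tail: "(\<integral>\<^sup>+t. indicator {x..} t * ennreal (k t * kap t ^ j) \<partial>lborel) \<le> ennreal (kap x ^ Suc j
      / Suc j)" for x j
    unfolding kap_def by (rule tail_power_nn_integral[OF k k0])
  have nn: "0 \<le> k t * kap t ^ j" for t j by (intro mult_nonneg_nonneg k0 zero_le_power kap0)
  have iter: "x0 \<le> x \<Longrightarrow> f x \<le> A * (\<Sum>j<n. kap x ^ j / fact j) + K * (kap x ^ n / fact n)" for n x
  proof (induction n arbitrary: x)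
    case 0
    then show ?case using fK by simp
  next
    case (Suc n)
    let ?t = "\<lambda>j. (\<integral>\<^sup>+t. indicator {x..} t * ennreal (k t * kap t ^ j) \<partial>lborel)"
    define q where "q j = kap x ^ Suc j / real (Suc j)" for j
    have q0: "0 \<le> q j" for j unfolding q_def by (intro divide_nonneg_nonneg zero_le_power kap0) simp
    have "(\<integral>\<^sup>+t. indicator {x..} t * ennreal (k t * f t) \<partial>lborel) \<le>
      (\<integral>\<^sup>+t. (\<Sum>j<n. ennreal (A / fact j) * (indicator {x..} t * ennreal (k t * kap t ^ j))) + 
             ennreal (K / fact n) * (indicator {x..} t * ennreal (k t * kap t ^ n)) \<partial>lborel)"
    proof (intro nn_integral_mono)
      fix t
      show "indicator {x..} t * ennreal (k t * f t) \<le>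
        (\<Sum>j<n. ennreal (A / fact j) * (indicator {x..} t * ennreal (k t * kap t ^ j))) + 
             ennreal (K / fact n) * (indicator {x..} t * ennreal (k t * kap t ^ n))"
      proof (cases "x \<le> t")
        case True
        have "k t * f t \<le> k t * (A * (\<Sum>j<n. kap t ^ j / fact j) + K * (kap t ^ n / fact n))"
          using True Suc.prems by (intro mult_left_mono Suc.IH k0) auto
        also have "\<dots> = (\<Sum>j<n. A / fact j * (k t * kap t ^ j)) + K / fact n * (k t * kap t ^ n)"
          by (simp add: distrib_left sum_distrib_left mult_ac)
        finally have "ennreal (k t * f t) \<le> ennreal ((\<Sum>j<n. A / fact j * (k t * kap t ^ j)) + K /
            fact n * (k t * kap t ^ n))"
          by (rule ennreal_leI)
        also have "\<dots> = (\<Sum>j<n. ennreal (A / fact j) * ennreal (k t * kap t ^ j)) + ennreal (K / fact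
            n) * ennreal (k t * kap t ^ n)"
          using A K nn[of t] by (simp add: ennreal_mult[symmetric] sum_nonneg flip: ennreal_plus)
        finally show ?thesis using True by simp
      qed simp
    qed
    also have "\<dots> = (\<Sum>j<n. ennreal (A / fact j) * ?t j) + ennreal (K / fact n) * ?t n"
      by (subst nn_integral_add, simp, simp, subst nn_integral_sum, simp, subst nn_integral_cmult,
          simp, subst nn_integral_cmult, simp, rule refl)
    also have "\<dots> \<le> (\<Sum>j<n. ennreal (A / fact j) * ennreal (q j)) + ennreal (K / fact n) * ennreal (q
        n)"
      unfolding q_def by (intro add_mono sum_mono mult_left_mono tail) auto
    also have "\<dots> = ennreal ((\<Sum>j<n. A / fact j * q j) + K / fact n * q n)"
      using A K q0 by (simp add: ennreal_mult[symmetric] sum_nonneg flip: ennreal_plus)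
    finally have "ennreal (f x) \<le> ennreal A + ennreal ((\<Sum>j<n. A / fact j * q j) + K / fact n * q n)"
      using le[OF Suc.prems] by (meson add_left_mono order_trans)
    also have "\<dots> = ennreal (A + ((\<Sum>j<n. A / fact j * q j) + K / fact n * q n))"
      using A K q0 by (simp add: sum_nonneg flip: ennreal_plus)
    finally have "f x \<le> A + ((\<Sum>j<n. A / fact j * q j) + K / fact n * q n)"
      using A K q0 by (subst (asm) ennreal_le_iff) (simp_all add: sum_nonneg)
    also have "\<dots> = A * (\<Sum>j<Suc n. kap x ^ j / fact j) + K * (kap x ^ Suc n / fact (Suc n))"
      unfolding sum.lessThan_Suc_shift q_def by (simp add: distrib_left sum_distrib_left mult_ac)
    finally show ?case .
  qed
  have "f x \<le> A * exp (kap x) + 0"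
  proof (rule tendsto_lowerbound)
    have "(\<lambda>n. kap x ^ n / fact n) \<longlonglongrightarrow> 0"
      using summable_LIMSEQ_zero[OF summable_exp[of "kap x"]] by (simp add: divide_inverse
          mult.commute)
    then show "(\<lambda>n. A * exp (kap x) + K * (kap x ^ n / fact n)) \<longlonglongrightarrow> A * exp (kap x) + 0"
      by (intro tendsto_add tendsto_const tendsto_mult_right_zero)
    show "\<forall>\<^sub>F n in sequentially. f x \<le> A * exp (kap x) + K * (kap x ^ n / fact n)"
    proof (intro always_eventually allI)
      fix n
      have "(\<Sum>j<n. kap x ^ j / fact j) \<le> exp (kap x)"
      proof -
        have "(\<Sum>j<n. inverse (fact j) * kap x ^ j) \<le> (\<Sum>j. inverse (fact j) * kap x ^ j)"
          using kap0 by (intro sum_le_suminf summable_exp) auto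
        then show ?thesis by (simp add: exp_def divide_inverse mult.commute)
      qed
      then have "A * (\<Sum>j<n. kap x ^ j / fact j) \<le> A * exp (kap x)" using A by (rule mult_left_mono)
      with iter[OF x, of n] show "f x \<le> A * exp (kap x) + K * (kap x ^ n / fact n)" by linarith
    qed
  qed simp
  also have "kap x \<le> (\<integral>t. k t \<partial>lborel)"
    unfolding kap_def by (rule integral_mono[OF int k]) (use k0 in \<open>auto simp: indicator_def\<close>)
  then have "A * exp (kap x) + 0 \<le> A * exp (\<integral>t. k t \<partial>lborel)" using A by (simp add: mult_left_mono)
  finally show ?thesis .
qed

section \<open>The Marchenko equation with a Borel potential\<close>

text \<open>
  The variable \<open>w\<close> is \<open>y - z\<close> in terms of the integration variable
  \<open>z\<close> of the Marchenko equation.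
\<close>
definition marchenko_kernel :: "(real \<Rightarrow> real) \<Rightarrow> (real \<Rightarrow> real \<Rightarrow> real) \<Rightarrow> bool" where
  "marchenko_kernel v P \<longleftrightarrow> admissible P \<and> (\<forall>x. \<forall>y>0. P x y = (\<integral>t. indicator {x + y..} t * v t
      \<partial>lborel) +
     (\<integral>w. indicator {0..} w * (\<integral>t. indicator {x + w..} t * (v t * P t (y - w)) \<partial>lborel) \<partial>lborel))"

text \<open>With \<open>z = y - w\<close> this is the integral of \<open>v t * P t z\<close> over
  the part of the strip \<open>0 < z < y\<close> beyond the characteristic
  \<open>t + z = x + y\<close>.\<close>

definition double_int :: "(real \<Rightarrow> real) \<Rightarrow> (real \<Rightarrow> real \<Rightarrow> real) \<Rightarrow> real \<Rightarrow> real \<Rightarrow> real" where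
  "double_int v P x y = (\<integral>w. indicator {0..} w * (\<integral>t. indicator {x + w..} t * (v t * P t (y - w))
      \<partial>lborel) \<partial>lborel)"

definition tail :: "(real \<Rightarrow> real) \<Rightarrow> real \<Rightarrow> real" where
  "tail v u = (\<integral>t. indicator {u..} t * v t \<partial>lborel)"

lemma marchenko_kernel_eq: "marchenko_kernel v P \<Longrightarrow> 0 < y \<Longrightarrow> P x y = tail v (x + y) + double_int v P x
    y"
  by (simp add: marchenko_kernel_def double_int_def tail_def)

lemma marchenko_kernel_admissible: "marchenko_kernel v P \<Longrightarrow> admissible P" by (simp add:
    marchenko_kernel_def)

lemma tail_ac:
  assumes v: "integrable lborel v" and ab: "a \<le> b"
  shows "tail v b - tail v a = (LINT t:{a..b}|lborel. - v t)"
  unfolding tail_def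
  by (rule tail_integral_diff[OF _ ab]) (use integrable_mult_indicator[OF _ v, of "{a..}"] in simp)

lemma tail_ac_shift:
  assumes v: "integrable lborel v" and ab: "a \<le> b"
  shows "tail v (b + y) - tail v (a + y) = (LINT t:{a..b}|lborel. - v (t + y))"
proof -
  have "tail v (b + y) - tail v (a + y) = (LINT t:{a+y..b+y}|lborel. - v t)"
    by (rule tail_ac[OF v]) (use ab in simp)
  also have "\<dots> = (LINT t:{a..b}|lborel. - v (t + y))" unfolding set_lebesgue_integral_def
    by (subst lborel_integral_real_affine[where c=1 and t=y])
       (auto simp: indicator_def add.commute intro!: Bochner_Integration.integral_cong)
  finally show ?thesis .
qed

lemma integrable_product_indicator:
  fixes v :: "real \<Rightarrow> real"
  assumes v: "integrable lborel v"
  shows "integrable (lborel \<Otimes>\<^sub>M lborel) (\<lambda>(t,z). v t * indicator {c..d::real} z)"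
proof (rule lborel_pair.Fubini_integrable)
  have [measurable]: "v \<in> borel_measurable borel" using v by (simp add: borel_measurable_integrable)
  show "(\<lambda>(t,z). v t * indicator {c..d} z) \<in> borel_measurable (lborel \<Otimes>\<^sub>M lborel)" by measurable
  show "integrable lborel (\<lambda>t. \<integral>z. norm (case (t, z) of (t, z) \<Rightarrow> v t * indicat_real {c..d} z)
      \<partial>lborel)"
    using v by (simp add: abs_mult)
qed auto

text \<open>\<open>P\<close> vanishes below the axis, so \<open>w\<close> is confined to
  \<open>{0..y}\<close>, where a local bound of \<open>P\<close> leaves a multiple of
  \<open>\<bar>v t\<bar>\<close>.\<close>

lemma double_int_integrable:
  assumes P: "admissible P" and v: "integrable lborel v"
  shows "integrable (lborel \<Otimes>\<^sub>M lborel) (\<lambda>(t,w). indicator {0..} w * (indicator {x + w..} t * (v t *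
      P t (y - w))))"
proof -
  have [measurable]: "case_prod P \<in> borel_measurable (borel \<Otimes>\<^sub>M borel)" using P by (rule
      admissible_measurable_prod)
  have [measurable]: "v \<in> borel_measurable borel" using v by (simp add: borel_measurable_integrable)
  obtain K where K: "0 \<le> K" "\<And>t z. x \<le> t \<Longrightarrow> z \<le> y \<Longrightarrow> \<bar>P t z\<bar> \<le> K" using admissible_bounded[OF P] by
      blast
  show ?thesis
  proof (rule Bochner_Integration.integrable_bound)
    show "integrable (lborel \<Otimes>\<^sub>M lborel) (\<lambda>q. K * (case q of (t,w) \<Rightarrow> v t * indicator {0..y} w))"
      by (intro integrable_mult_right integrable_product_indicator v)
    show "AE q in lborel \<Otimes>\<^sub>M lborel. norm (case q of (t,w) \<Rightarrow> indicator {0..} w * (indicator {x +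
        w..} t * (v t * P t (y - w))))
      \<le> norm (K * (case q of (t,w) \<Rightarrow> v t * indicator {0..y} w))"
    proof (intro AE_I2, clarify)
      fix t w :: real
      show "norm (indicator {0..} w * (indicator {x + w..} t * (v t * P t (y - w)))) \<le> norm (K * (v
          t * indicator {0..y} w))"
      proof (cases "0 \<le> w \<and> x + w \<le> t \<and> w \<le> y")
        case True
        then have "\<bar>v t * P t (y - w)\<bar> \<le> K * \<bar>v t\<bar>" by (intro abs_mult_le K) auto
        then show ?thesis using True K by (simp add: abs_mult)
      next
        case False
        then show ?thesis using admissible_zero[OF P, of "y - w" t] by (auto simp: indicator_def)
      qed
    qed
  qed (simp add: indicator_def)
qed

text \<open>For fixed \<open>w\<close> the inner integral is \<open>tail_int\<close> at the point
  \<open>(x + w, y - w)\<close>, whose increments in \<open>x\<close> are known. Integrating them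
  over \<open>w\<close> runs along the characteristic, and Fubini produces
  \<open>char_int\<close>.\<close>

lemma double_int_x_ac:
  assumes P: "admissible P" and v: "integrable lborel v" and ab: "a \<le> b"
  shows "double_int v P b y - double_int v P a y = (LINT x:{a..b}|lborel. - char_int v P x y)"
proof -
  have [measurable]: "case_prod P \<in> borel_measurable (borel \<Otimes>\<^sub>M borel)" using P by (rule
      admissible_measurable_prod)
  have [measurable]: "v \<in> borel_measurable borel" using v by (simp add: borel_measurable_integrable)
  define G where "G x t w = indicator {0..} w * (indicator {x + w..} t * (v t * P t (y - w)))" for x
      t w
  have G: "integrable (lborel \<Otimes>\<^sub>M lborel) (\<lambda>(t,w). G x t w)" for x
    unfolding G_def by (rule double_int_integrable[OF P v])
  have eq: "double_int v P x y = (\<integral>w. \<integral>t. G x t w \<partial>lborel \<partial>lborel)" for x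
    unfolding double_int_def G_def by simp
  have outer: "integrable lborel (\<lambda>w. \<integral>t. G x t w \<partial>lborel)" for x
    using lborel_pair.integrable_snd[OF G] by simp
  obtain K where K: "0 \<le> K" "\<And>t z. a \<le> t \<Longrightarrow> z \<le> y \<Longrightarrow> \<bar>P t z\<bar> \<le> K" using admissible_bounded[OF P] by
      blast
  define H where "H x w = indicator {a..b} x * (indicator {0..} w * (v (x + w) * P (x + w) (y -
      w)))" for x w
  have H: "integrable (lborel \<Otimes>\<^sub>M lborel) (\<lambda>(x,w). H x w)"
  proof (rule Bochner_Integration.integrable_bound)
    show "integrable (lborel \<Otimes>\<^sub>M lborel) (\<lambda>q. K * (case q of (x,w) \<Rightarrow> indicator {a..b} x * \<bar>v (x +
        w)\<bar>))"
      by (intro integrable_mult_right strip_integrable v)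
    show "AE q in lborel \<Otimes>\<^sub>M lborel. norm (case q of (x,w) \<Rightarrow> H x w) \<le> norm (K * (case q of (x,w) \<Rightarrow>
        indicator {a..b} x * \<bar>v (x + w)\<bar>))"
    proof (intro AE_I2, clarify)
      fix x w :: real
      have "\<bar>v (x + w) * P (x + w) (y - w)\<bar> \<le> K * \<bar>v (x + w)\<bar>" if "a \<le> x" "0 \<le> w"
        using that by (intro abs_mult_le K) auto
      then show "norm (H x w) \<le> norm (K * (indicator {a..b} x * \<bar>v (x + w)\<bar>))"
        using K(1) by (auto simp: H_def indicator_def)
    qed
  qed (unfold H_def, measurable)
  have "double_int v P b y - double_int v P a y = (\<integral>w. (\<integral>t. G b t w \<partial>lborel) - (\<integral>t. G a t w \<partial>lborel)
      \<partial>lborel)"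
    unfolding eq by (rule Bochner_Integration.integral_diff[symmetric, OF outer outer])
  also have "\<dots> = (\<integral>w. \<integral>x. - H x w \<partial>lborel \<partial>lborel)"
  proof (intro Bochner_Integration.integral_cong refl)
    fix w
    have "(\<integral>t. G b t w \<partial>lborel) - (\<integral>t. G a t w \<partial>lborel) = indicator {0..} w * (tail_int v P (b + w)
        (y - w) - tail_int v P (a + w) (y - w))"
      by (simp add: G_def tail_int_def right_diff_distrib)
    also have "tail_int v P (b + w) (y - w) - tail_int v P (a + w) (y - w) = (LINT
        t:{a+w..b+w}|lborel. - (v t * P t (y - w)))"
      by (rule tail_int_x_ac[OF P v]) (use ab in simp)
    also have "\<dots> = (LINT x:{a..b}|lborel. - (v (x + w) * P (x + w) (y - w)))" unfolding
        set_lebesgue_integral_def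
      by (subst lborel_integral_real_affine[where c=1 and t=w])
         (auto simp: indicator_def add.commute intro!: Bochner_Integration.integral_cong)
    also have "indicator {0..} w * \<dots> = (\<integral>x. - H x w \<partial>lborel)"
      unfolding set_lebesgue_integral_def Bochner_Integration.integral_mult_right_zero[symmetric]
      by (intro Bochner_Integration.integral_cong) (auto simp: H_def)
    finally show "(\<integral>t. G b t w \<partial>lborel) - (\<integral>t. G a t w \<partial>lborel) = (\<integral>x. - H x w \<partial>lborel)" .
  qed
  also have "\<dots> = - (\<integral>w. \<integral>x. H x w \<partial>lborel \<partial>lborel)" by simp
  also have "(\<integral>w. \<integral>x. H x w \<partial>lborel \<partial>lborel) = (\<integral>x. \<integral>w. H x w \<partial>lborel \<partial>lborel)"
    using lborel_pair.Fubini_integral[OF H] by simp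
  also have "- \<dots> = (LINT x:{a..b}|lborel. - char_int v P x y)"
    unfolding char_int_affine H_def set_lebesgue_integral_def by simp
  finally show ?thesis .
qed

lemma admissible_section_integrable:
  assumes P: "admissible P"
  shows "integrable lborel (\<lambda>z. indicator {p..q} z * P t z)"
proof -
  have [measurable]: "P t \<in> borel_measurable borel" using admissible_section_measurable[OF P] .
  obtain K where K: "0 \<le> K" "\<And>s z. t \<le> s \<Longrightarrow> z \<le> q \<Longrightarrow> \<bar>P s z\<bar> \<le> K" using admissible_bounded[OF P] by
      blast
  show ?thesis
  proof (rule Bochner_Integration.integrable_bound[where f="\<lambda>z. K * indicator {p..q} z"])
    show "AE z in lborel. norm (indicator {p..q} z * P t z) \<le> norm (K * indicator {p..q} z)"
    proof (intro AE_I2)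
      fix z show "norm (indicator {p..q} z * P t z) \<le> norm (K * indicator {p..q} z)"
        using K by (cases "z \<in> {p..q}") auto
    qed
  qed auto
qed

text \<open>With \<open>t\<close> outermost and \<open>z = y - w\<close> inside, \<open>y\<close>
  enters only through the end points of the window \<open>{x + y - t..y}\<close>. This is the form
  that can be differentiated in \<open>y\<close> without differentiating \<open>P\<close>.\<close>

lemma double_int_t:
  assumes P: "admissible P" and v: "integrable lborel v"
  shows "double_int v P x y = (\<integral>t. indicator {x..} t * (v t * (\<integral>z. indicator {x + y - t..y} z * P t
      z \<partial>lborel)) \<partial>lborel)"
    and "integrable lborel (\<lambda>t. indicator {x..} t * (v t * (\<integral>z. indicator {x + y - t..y} z * P t z
        \<partial>lborel)))"
proof -
  let ?G = "\<lambda>t w. indicator {0..} w * (indicator {x + w..} t * (v t * P t (y - w)))"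
  note G = double_int_integrable[OF P v, of x y]
  have in_t: "(\<integral>w. ?G t w \<partial>lborel) = indicator {x..} t * (v t * (\<integral>z. indicator {x + y - t..y} z * P
      t z \<partial>lborel))" for t
  proof -
    have "(\<integral>w. ?G t w \<partial>lborel) = (\<integral>w. indicator {x..} t * (v t * (indicator {0..t-x} w * P t (y -
        w))) \<partial>lborel)"
      by (intro Bochner_Integration.integral_cong) (auto simp: indicator_def)
    also have "\<dots> = indicator {x..} t * (v t * (\<integral>w. indicator {0..t-x} w * P t (y - w) \<partial>lborel))" by
        simp
    also have "(\<integral>w. indicator {0..t-x} w * P t (y - w) \<partial>lborel) = (\<integral>z. indicator {x + y - t..y} z *
        P t z \<partial>lborel)"
      by (subst lborel_integral_real_affine[where c="-1" and t=y])
         (auto simp: indicator_def intro!: Bochner_Integration.integral_cong)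
    finally show ?thesis .
  qed
  have "double_int v P x y = (\<integral>w. \<integral>t. ?G t w \<partial>lborel \<partial>lborel)" unfolding double_int_def by simp
  also have "\<dots> = (\<integral>t. \<integral>w. ?G t w \<partial>lborel \<partial>lborel)" by (rule lborel_pair.Fubini_integral[OF G])
  finally show "double_int v P x y = (\<integral>t. indicator {x..} t * (v t * (\<integral>z. indicator {x + y - t..y} z
      * P t z \<partial>lborel)) \<partial>lborel)"
    unfolding in_t .
  show "integrable lborel (\<lambda>t. indicator {x..} t * (v t * (\<integral>z. indicator {x + y - t..y} z * P t z
      \<partial>lborel)))"
    using lborel_pair.integrable_fst[OF G] unfolding in_t .
qed

text \<open>The window \<open>{x + y - t..y}\<close> moves rigidly with \<open>y\<close>: what
  enters at its upper end is \<open>P t y\<close>, which integrates to \<open>tail_int\<close>, and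
  what leaves at its lower end is \<open>P t (x + y - t)\<close>, which integrates to
  \<open>char_int\<close>.\<close>

lemma double_int_y_ac:
  assumes P: "admissible P" and v: "integrable lborel v" and cd: "c \<le> d"
  shows "double_int v P x d - double_int v P x c = (LINT y:{c..d}|lborel. tail_int v P x y -
      char_int v P x y)"
proof -
  have [measurable]: "case_prod P \<in> borel_measurable (borel \<Otimes>\<^sub>M borel)" using P by (rule
      admissible_measurable_prod)
  have [measurable]: "v \<in> borel_measurable borel" using v by (simp add: borel_measurable_integrable)
  have Pt: "P t \<in> borel_measurable borel" for t using admissible_section_measurable[OF P] .
  obtain K where K: "0 \<le> K" "\<And>t z. x \<le> t \<Longrightarrow> z \<le> d \<Longrightarrow> \<bar>P t z\<bar> \<le> K" using admissible_bounded[OF P] by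
      blast
  define h where "h y t = (\<integral>z. indicator {x + y - t..y} z * P t z \<partial>lborel)" for y t
  define H where "H t y = indicator {x..} t * (v t * (indicator {c..d} y * (P t y - P t (x + y -
      t))))" for t y
  have h_diff: "h d t - h c t = (\<integral>y. indicator {c..d} y * (P t y - P t (x + y - t)) \<partial>lborel)" if t:
      "x \<le> t" for t
  proof -
    have i2: "integrable lborel (\<lambda>y. indicator {c..d} y * P t (x + y - t))"
      using lborel_integrable_real_affine[OF admissible_section_integrable[OF P, of "x+c-t" "x+d-t"
          t], of 1 "x-t"]
      by (simp add: indicator_def algebra_simps)
    have "h d t - h c t = (\<integral>z. indicator {x + d - t..d} z * P t z - indicator {x + c - t..c} z * P t
        z \<partial>lborel)"
      unfolding h_def by (intro Bochner_Integration.integral_diff[symmetric]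
          admissible_section_integrable P)
    \<comment> \<open>Whether or not the two windows overlap, the difference of their indicators
      equals the difference of the indicators swept by the upper and the lower end points, up to the
      points \<open>x + d - t\<close> and \<open>c\<close>.\<close>
    also have "\<dots> = (\<integral>z. indicator {c..d} z * P t z - indicator {x + c - t..x + d - t} z * P t z
        \<partial>lborel)"
    proof (rule integral_cong_AE)
      show "AE z in lborel. indicator {x + d - t..d} z * P t z - indicator {x + c - t..c} z * P t z
          =
          indicator {c..d} z * P t z - indicator {x + c - t..x + d - t} z * P t z"
        using AE_lborel_singleton[of "x + d - t"] AE_lborel_singleton[of c]
        by eventually_elim (use t cd in \<open>auto simp: indicator_def\<close>)
    qed (use Pt in auto)
    also have "\<dots> = (\<integral>z. indicator {c..d} z * P t z \<partial>lborel) - (\<integral>z. indicator {x + c - t..x + d - t}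
        z * P t z \<partial>lborel)"
      by (intro Bochner_Integration.integral_diff admissible_section_integrable P)
    also have "(\<integral>z. indicator {x + c - t..x + d - t} z * P t z \<partial>lborel) = (\<integral>y. indicator {c..d} y *
        P t (x + y - t) \<partial>lborel)"
      by (subst lborel_integral_real_affine[where c="1" and t="x-t"])
         (auto simp: indicator_def algebra_simps intro!: Bochner_Integration.integral_cong)
    also have "(\<integral>z. indicator {c..d} z * P t z \<partial>lborel) - \<dots> = (\<integral>y. indicator {c..d} y * (P t y - P t
        (x + y - t)) \<partial>lborel)"
      unfolding right_diff_distrib by (intro Bochner_Integration.integral_diff[symmetric]
          admissible_section_integrable P i2)
    finally show ?thesis .
  qed
  have H: "integrable (lborel \<Otimes>\<^sub>M lborel) (\<lambda>(t,y). H t y)"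
  proof (rule Bochner_Integration.integrable_bound)
    show "integrable (lborel \<Otimes>\<^sub>M lborel) (\<lambda>q. (2 * K) * (case q of (t,y) \<Rightarrow> v t * indicator {c..d}
        y))"
      by (intro integrable_mult_right integrable_product_indicator v)
    show "AE q in lborel \<Otimes>\<^sub>M lborel. norm (case q of (t,y) \<Rightarrow> H t y) \<le> norm ((2 * K) * (case q of
        (t,y) \<Rightarrow> v t * indicator {c..d} y))"
    proof (intro AE_I2, clarify)
      fix t y :: real
      have "\<bar>v t * (P t y - P t (x + y - t))\<bar> \<le> (2 * K) * \<bar>v t\<bar>" if "x \<le> t" "y \<le> d"
      proof (rule abs_mult_le)
        show "\<bar>P t y - P t (x + y - t)\<bar> \<le> 2 * K" 
          using that K(2)[of t y] K(2)[of t "x + y - t"] by linarith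
      qed (use K in simp)
      then show "norm (H t y) \<le> norm ((2 * K) * (v t * indicator {c..d} y))"
        using K(1) by (auto simp: H_def indicator_def abs_mult)
    qed
  qed (unfold H_def, measurable)
  have "double_int v P x d - double_int v P x c = (\<integral>t. indicator {x..} t * (v t * h d t) - indicator
      {x..} t * (v t * h c t) \<partial>lborel)"
    unfolding double_int_t(1)[OF P v] h_def
    by (rule Bochner_Integration.integral_diff[symmetric]) (rule double_int_t(2)[OF P v])+
  also have "\<dots> = (\<integral>t. \<integral>y. H t y \<partial>lborel \<partial>lborel)"
  proof (intro Bochner_Integration.integral_cong refl)
    fix t show "indicator {x..} t * (v t * h d t) - indicator {x..} t * (v t * h c t) = (\<integral>y. H t y
        \<partial>lborel)"
    proof (cases "x \<le> t")
      case True
      then show ?thesis using h_diff[OF True] by (simp add: H_def right_diff_distrib[symmetric])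
    qed (simp add: H_def)
  qed
  also have "\<dots> = (\<integral>y. \<integral>t. H t y \<partial>lborel \<partial>lborel)" using lborel_pair.Fubini_integral[OF H] by simp
  also have "\<dots> = (LINT y:{c..d}|lborel. tail_int v P x y - char_int v P x y)"
    unfolding set_lebesgue_integral_def
  proof (intro Bochner_Integration.integral_cong refl)
    fix y
    have "tail_int v P x y - char_int v P x y = (\<integral>t. indicator {x..} t * (v t * P t y) - indicator
        {x..} t * (v t * P t (x + y - t)) \<partial>lborel)"
      unfolding tail_int_def char_int_def by (intro Bochner_Integration.integral_diff[symmetric]
          tail_int_integrable char_int_integrable P v)
    then have "indicator {c..d} y *\<^sub>R (tail_int v P x y - char_int v P x y) =
      (\<integral>t. indicator {c..d} y * (indicator {x..} t * (v t * P t y) - indicator {x..} t * (v t * P t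
          (x + y - t))) \<partial>lborel)" by simp
    also have "\<dots> = (\<integral>t. H t y \<partial>lborel)"
      by (intro Bochner_Integration.integral_cong) (auto simp: H_def algebra_simps)
    finally show "(\<integral>t. H t y \<partial>lborel) = indicator {c..d} y *\<^sub>R (tail_int v P x y - char_int v P x
        y)" by simp
  qed
  finally show ?thesis .
qed

section \<open>First derivatives of a Marchenko kernel\<close>

lemma translate_set_integrable:
  fixes v :: "real \<Rightarrow> real"
  assumes v: "integrable lborel v"
  shows "set_integrable lborel {a..b} (\<lambda>t. v (t + y))" "set_integrable lborel {a..b} (\<lambda>t. v (y +
      t))"
proof -
  have "integrable lborel (\<lambda>t. v (y + t))" using lborel_integrable_real_affine[OF v, of 1 y] by simp
  then show "set_integrable lborel {a..b} (\<lambda>t. v (y + t))"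
    unfolding set_integrable_def by (rule integrable_mult_indicator[rotated]) simp
  then show "set_integrable lborel {a..b} (\<lambda>t. v (t + y))" by (simp add: add.commute)
qed

lemma marchenko_kernel_x_ac:
  assumes C: "marchenko_kernel v P" and v: "integrable lborel v" and ab: "a \<le> b" and y: "0 < y"
  shows "P b y - P a y = (LINT x:{a..b}|lborel. - v (x + y) - char_int v P x y)"
proof -
  have P: "admissible P" using C by (rule marchenko_kernel_admissible)
  have "P b y - P a y = (tail v (b + y) - tail v (a + y)) + (double_int v P b y - double_int v P a
      y)"
    using marchenko_kernel_eq[OF C y] by simp
  also have "\<dots> = (LINT x:{a..b}|lborel. - v (x + y)) + (LINT x:{a..b}|lborel. - char_int v P x y)"
    by (simp only: tail_ac_shift[OF v ab] double_int_x_ac[OF P v ab])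
  also have "\<dots> = (LINT x:{a..b}|lborel. - v (x + y) + - char_int v P x y)"
  proof (rule set_integral_add(2)[symmetric])
    show "set_integrable lborel {a..b} (\<lambda>x. - v (x + y))" 
      using set_integrable_mult_right[of "-1", OF translate_set_integrable(1)[OF v]] by simp
    have "continuous_on UNIV (\<lambda>x. - char_int v P x y)"
      using admissible_section_continuous[OF admissible_char_int[OF P v] y, of 0] by (intro
          continuous_intros) simp
    then show "set_integrable lborel {a..b} (\<lambda>x. - char_int v P x y)"
      by (intro borel_integrable_atLeastAtMost') (rule continuous_on_subset, auto)
  qed
  finally show ?thesis by simp
qed

lemma marchenko_kernel_y_ac:
  assumes C: "marchenko_kernel v P" and v: "integrable lborel v" and cd: "0 < c" "c \<le> d"
  shows "P x d - P x c = (LINT y:{c..d}|lborel. - v (x + y) + (tail_int v P x y - char_int v P x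
      y))"
proof -
  have P: "admissible P" using C by (rule marchenko_kernel_admissible)
  have "P x d - P x c = (tail v (x + d) - tail v (x + c)) + (double_int v P x d - double_int v P x
      c)"
    using marchenko_kernel_eq[OF C, of c x] marchenko_kernel_eq[OF C, of d x] cd by simp
  also have "tail v (x + d) - tail v (x + c) = (LINT y:{c..d}|lborel. - v (x + y))"
    using tail_ac_shift[OF v cd(2), of x] by (simp add: add.commute)
  also have "double_int v P x d - double_int v P x c = (LINT y:{c..d}|lborel. tail_int v P x y -
      char_int v P x y)" by (rule double_int_y_ac[OF P v cd(2)])
  also have "(LINT y:{c..d}|lborel. - v (x + y)) + \<dots> = (LINT y:{c..d}|lborel. - v (x + y) +
      (tail_int v P x y - char_int v P x y))"
  proof (rule set_integral_add(2)[symmetric])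
    show "set_integrable lborel {c..d} (\<lambda>y. - v (x + y))" 
      using set_integrable_mult_right[of "-1", OF translate_set_integrable(2)[OF v]] by simp
    have "continuous_on {0<..} (\<lambda>y. tail_int v P x y - char_int v P x y)"
      by (intro continuous_on_diff admissible_section_continuous' admissible_char_int
          admissible_tail_int P v)
    then show "set_integrable lborel {c..d} (\<lambda>y. tail_int v P x y - char_int v P x y)"
      using cd by (intro borel_integrable_atLeastAtMost') (rule continuous_on_subset, auto)
  qed
  finally show ?thesis .
qed

section \<open>Growth of the moments of a Marchenko kernel\<close>

lemma marchenko_kernel_abs_le:
  assumes C: "marchenko_kernel v P" and v: "integrable lborel v" and y: "0 < y"
  shows "ennreal \<bar>P x y\<bar> \<le> (\<integral>\<^sup>+t. indicator {x + y..} t * ennreal \<bar>v t\<bar> \<partial>lborel) +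
    (\<integral>\<^sup>+w. \<integral>\<^sup>+t. indicator {0..} w * (indicator {x + w..} t * ennreal \<bar>v t * P t (y - w)\<bar>) \<partial>lborel
        \<partial>lborel)"
proof -
  have P: "admissible P" using C by (rule marchenko_kernel_admissible)
  have [measurable]: "case_prod P \<in> borel_measurable (borel \<Otimes>\<^sub>M borel)" using P by (rule
      admissible_measurable_prod)
  have [measurable]: "v \<in> borel_measurable borel" using v by (simp add: borel_measurable_integrable)
  have "ennreal \<bar>P x y\<bar> \<le> ennreal (\<bar>tail v (x + y)\<bar> + \<bar>double_int v P x y\<bar>)"
    unfolding marchenko_kernel_eq[OF C y] by (intro ennreal_leI abs_triangle_ineq)
  also have "\<dots> = ennreal \<bar>tail v (x + y)\<bar> + ennreal \<bar>double_int v P x y\<bar>" by (rule ennreal_plus)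
      auto
  finally have 1: "ennreal \<bar>P x y\<bar> \<le> \<dots>" .
  have 2: "ennreal \<bar>tail v (x + y)\<bar> \<le> (\<integral>\<^sup>+t. indicator {x + y..} t * ennreal \<bar>v t\<bar> \<partial>lborel)"
    unfolding tail_def by (rule order_trans[OF ennreal_abs_integral_le]) (auto intro!:
        nn_integral_mono simp: indicator_def)
  have "ennreal \<bar>double_int v P x y\<bar> \<le> (\<integral>\<^sup>+w. ennreal \<bar>indicator {0..} w * (\<integral>t. indicator {x + w..}
      t * (v t * P t (y - w)) \<partial>lborel)\<bar> \<partial>lborel)"
    unfolding double_int_def by (rule ennreal_abs_integral_le)
  also have "\<dots> \<le> (\<integral>\<^sup>+w. \<integral>\<^sup>+t. indicator {0..} w * (indicator {x + w..} t * ennreal \<bar>v t * P t (y -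
      w)\<bar>) \<partial>lborel \<partial>lborel)"
  proof (intro nn_integral_mono)
    fix w
    have "ennreal \<bar>\<integral>t. indicator {x + w..} t * (v t * P t (y - w)) \<partial>lborel\<bar> \<le> (\<integral>\<^sup>+t. ennreal
        \<bar>indicator {x + w..} t * (v t * P t (y - w))\<bar> \<partial>lborel)"
      by (rule ennreal_abs_integral_le)
    also have "\<dots> = (\<integral>\<^sup>+t. indicator {x + w..} t * ennreal \<bar>v t * P t (y - w)\<bar> \<partial>lborel)"
      by (intro nn_integral_cong) (auto simp: indicator_def)
    finally show "ennreal \<bar>indicator {0..} w * (\<integral>t. indicator {x + w..} t * (v t * P t (y - w))
        \<partial>lborel)\<bar>
      \<le> (\<integral>\<^sup>+t. indicator {0..} w * (indicator {x + w..} t * ennreal \<bar>v t * P t (y - w)\<bar>) \<partial>lborel)"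
      by (cases "0 \<le> w") simp_all
  qed
  finally show ?thesis using 1 2 by (meson add_mono order_trans)
qed

text \<open>
  Truncation makes the moments finite and locally bounded a priori, as Gronwall's inequality requires.
\<close>
definition trunc_moment :: "nat \<Rightarrow> (real \<Rightarrow> real \<Rightarrow> real) \<Rightarrow> real \<Rightarrow> real \<Rightarrow> ennreal" where
  "trunc_moment s P Y x = (\<integral>\<^sup>+y. indicator {0..Y} y * ennreal ((1 + y) ^ s * \<bar>P x y\<bar>) \<partial>lborel)"

text \<open>Tonelli moves \<open>t\<close> outermost. The free term leaves the integral of
  \<open>(1 + y) ^ s\<close> over \<open>0 \<le> y \<le> t - x\<close>. In the double integral the
  substitution \<open>y = w + z\<close> costs \<open>(1 + (t - x)) ^ s\<close>, and \<open>w\<close>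
  ranges over an interval of length \<open>t - x\<close>. Both give the exponent
  \<open>s + 1\<close>. The truncation survives because \<open>z \<le> y \<le> Y\<close>.\<close>

lemma trunc_moment_iter:
  assumes C: "marchenko_kernel v P" and v: "integrable lborel v"
  shows "trunc_moment s P Y x \<le> (\<integral>\<^sup>+t. indicator {x..} t * (ennreal (\<bar>v t\<bar> * (1 + (t - x)) ^ (s +
      1)) * (1 + trunc_moment s P Y t)) \<partial>lborel)"
proof -
  have P: "admissible P" using C by (rule marchenko_kernel_admissible)
  have [measurable]: "case_prod P \<in> borel_measurable (borel \<Otimes>\<^sub>M borel)" using P by (rule
      admissible_measurable_prod)
  have [measurable]: "v \<in> borel_measurable borel" using v by (simp add: borel_measurable_integrable)
  have [measurable]: "trunc_moment s P Y \<in> borel_measurable borel" unfolding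
      trunc_moment_def[abs_def] by measurable
  define E where "E y = ennreal ((1 + y) ^ s)" for y :: real
  have [measurable]: "E \<in> borel_measurable borel" unfolding E_def by measurable
  define G where "G y w t = indicator {0..Y} y * E y * (indicator {0..} w * (indicator {x + w..} t *
      ennreal \<bar>v t * P t (y - w)\<bar>))" for y w t
  \<comment> \<open>Stated for arbitrary measurable arguments, so that one rule covers
    \<open>G\<close> in every order of integration of the triple integral.\<close>
  have [measurable (raw)]: "(\<lambda>q. G (a q) (b q) (c q)) \<in> borel_measurable M"
    if [measurable]: "a \<in> borel_measurable M" "b \<in> borel_measurable M" "c \<in> borel_measurable M"
    for M :: "'z measure" and a b c
    unfolding G_def by (simp add: indicator_def)
  have m1: "(\<lambda>y. \<integral>\<^sup>+t. indicator {0..Y} y * E y * (indicator {x + y..} t * ennreal \<bar>v t\<bar>) \<partial>lborel) \<in>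
      borel_measurable lborel"
    by (simp add: indicator_def)
  have m2: "(\<lambda>y. \<integral>\<^sup>+w. \<integral>\<^sup>+t. G y w t \<partial>lborel \<partial>lborel) \<in> borel_measurable lborel"
    by measurable
  have "trunc_moment s P Y x \<le> (\<integral>\<^sup>+y. (\<integral>\<^sup>+t. indicator {0..Y} y * E y * (indicator {x + y..} t *
      ennreal \<bar>v t\<bar>) \<partial>lborel) +
     (\<integral>\<^sup>+w. \<integral>\<^sup>+t. G y w t \<partial>lborel \<partial>lborel) \<partial>lborel)"
    unfolding trunc_moment_def
  proof (rule nn_integral_mono)
    fix y
    show "indicator {0..Y} y * ennreal ((1 + y) ^ s * \<bar>P x y\<bar>) \<le>
      (\<integral>\<^sup>+t. indicator {0..Y} y * E y * (indicator {x + y..} t * ennreal \<bar>v t\<bar>) \<partial>lborel) + (\<integral>\<^sup>+w.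
          \<integral>\<^sup>+t. G y w t \<partial>lborel \<partial>lborel)"
    proof (cases "0 < y \<and> y \<le> Y")
      case True
      have "indicator {0..Y} y * ennreal ((1 + y) ^ s * \<bar>P x y\<bar>) = E y * ennreal \<bar>P x y\<bar>"
        using True by (simp add: E_def ennreal_mult)
      also have "\<dots> \<le> E y * ((\<integral>\<^sup>+t. indicator {x + y..} t * ennreal \<bar>v t\<bar> \<partial>lborel) +
        (\<integral>\<^sup>+w. \<integral>\<^sup>+t. indicator {0..} w * (indicator {x + w..} t * ennreal \<bar>v t * P t (y - w)\<bar>)
            \<partial>lborel \<partial>lborel))"
        by (intro mult_left_mono marchenko_kernel_abs_le[OF C v]) (use True in auto)
      also have "\<dots> = (\<integral>\<^sup>+t. indicator {0..Y} y * E y * (indicator {x + y..} t * ennreal \<bar>v t\<bar>)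
          \<partial>lborel) + (\<integral>\<^sup>+w. \<integral>\<^sup>+t. G y w t \<partial>lborel \<partial>lborel)"
        unfolding G_def using True
        by (simp add: distrib_left nn_integral_cmult indicator_def)
      finally show ?thesis .
    next
      case False
      then have "y < 0 \<or> Y < y \<or> P x y = 0" using admissible_zero[OF P, of y x] by linarith
      then show ?thesis by (auto simp: indicator_def)
    qed
  qed
  also have "\<dots> = (\<integral>\<^sup>+y. \<integral>\<^sup>+t. indicator {0..Y} y * E y * (indicator {x + y..} t * ennreal \<bar>v t\<bar>)
      \<partial>lborel \<partial>lborel) +
     (\<integral>\<^sup>+y. \<integral>\<^sup>+w. \<integral>\<^sup>+t. G y w t \<partial>lborel \<partial>lborel \<partial>lborel)"
    by (rule nn_integral_add) (fact m1, fact m2)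
  finally have 0: "trunc_moment s P Y x \<le> \<dots>" .
  have "(\<integral>\<^sup>+y. \<integral>\<^sup>+t. indicator {0..Y} y * E y * (indicator {x + y..} t * ennreal \<bar>v t\<bar>) \<partial>lborel
      \<partial>lborel) =
     (\<integral>\<^sup>+t. \<integral>\<^sup>+y. indicator {0..Y} y * E y * (indicator {x + y..} t * ennreal \<bar>v t\<bar>) \<partial>lborel
         \<partial>lborel)"
    by (rule lborel_pair.Fubini') (simp add: indicator_def)
  also have "\<dots> \<le> (\<integral>\<^sup>+t. indicator {x..} t * ennreal (\<bar>v t\<bar> * (1 + (t - x)) ^ (s + 1)) \<partial>lborel)"
  proof (rule nn_integral_mono)
    fix t
    have "(\<integral>\<^sup>+y. indicator {0..Y} y * E y * (indicator {x + y..} t * ennreal \<bar>v t\<bar>) \<partial>lborel)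
      \<le> (\<integral>\<^sup>+y. (indicator {x..} t * (ennreal \<bar>v t\<bar> * E (t - x))) * indicator {0..t - x} y \<partial>lborel)"
      by (rule nn_integral_mono) (auto simp: indicator_def E_def mult.commute intro!: mult_left_mono
          ennreal_leI power_mono)
    also have "\<dots> = indicator {x..} t * (ennreal \<bar>v t\<bar> * E (t - x)) * ennreal (t - x)"
      by (cases "x \<le> t") (auto simp: nn_integral_cmult_indicator)
    also have "\<dots> \<le> indicator {x..} t * ennreal (\<bar>v t\<bar> * (1 + (t - x)) ^ (s + 1))"
    proof (cases "x \<le> t")
      case True
      have "\<bar>v t\<bar> * (1 + (t - x)) ^ s * (t - x) \<le> \<bar>v t\<bar> * (1 + (t - x)) ^ s * (1 + (t - x))"
        using True by (intro mult_left_mono) auto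
      then show ?thesis using True by (auto simp: E_def ennreal_mult[symmetric] mult_ac intro!:
          ennreal_leI)
    qed simp
    finally show "(\<integral>\<^sup>+y. indicator {0..Y} y * E y * (indicator {x + y..} t * ennreal \<bar>v t\<bar>) \<partial>lborel)
        \<le>
       indicator {x..} t * ennreal (\<bar>v t\<bar> * (1 + (t - x)) ^ (s + 1))" .
  qed
  finally have 1: "(\<integral>\<^sup>+y. \<integral>\<^sup>+t. indicator {0..Y} y * E y * (indicator {x + y..} t * ennreal \<bar>v t\<bar>)
      \<partial>lborel \<partial>lborel) \<le> \<dots>" .
  have "(\<integral>\<^sup>+y. \<integral>\<^sup>+w. \<integral>\<^sup>+t. G y w t \<partial>lborel \<partial>lborel \<partial>lborel) = (\<integral>\<^sup>+y. \<integral>\<^sup>+t. \<integral>\<^sup>+w. G y w t \<partial>lborel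
      \<partial>lborel \<partial>lborel)"
    by (rule nn_integral_cong, rule lborel_pair.Fubini') measurable
  also have "\<dots> = (\<integral>\<^sup>+t. \<integral>\<^sup>+y. \<integral>\<^sup>+w. G y w t \<partial>lborel \<partial>lborel \<partial>lborel)"
    by (rule lborel_pair.Fubini') measurable
  also have "\<dots> = (\<integral>\<^sup>+t. \<integral>\<^sup>+w. \<integral>\<^sup>+y. G y w t \<partial>lborel \<partial>lborel \<partial>lborel)"
    by (rule nn_integral_cong, rule lborel_pair.Fubini') measurable
  also have "\<dots> \<le> (\<integral>\<^sup>+t. indicator {x..} t * (ennreal (\<bar>v t\<bar> * (1 + (t - x)) ^ (s + 1)) *
      trunc_moment s P Y t) \<partial>lborel)"
  proof (rule nn_integral_mono)
    fix t
    have "(\<integral>\<^sup>+w. \<integral>\<^sup>+y. G y w t \<partial>lborel \<partial>lborel) \<le> (\<integral>\<^sup>+w. (indicator {x..} t * (ennreal \<bar>v t\<bar> * E (t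
        - x) * trunc_moment s P Y t)) * indicator {0..t - x} w \<partial>lborel)"
    proof (rule nn_integral_mono)
      fix w
      show "(\<integral>\<^sup>+y. G y w t \<partial>lborel) \<le> (indicator {x..} t * (ennreal \<bar>v t\<bar> * E (t - x) * trunc_moment
          s P Y t)) * indicator {0..t - x} w"
      proof (cases "0 \<le> w \<and> x + w \<le> t")
        case True
        have "(\<integral>\<^sup>+y. G y w t \<partial>lborel) = (\<integral>\<^sup>+z. G (w + z) w t \<partial>lborel)"
          by (subst nn_integral_real_affine[where c=1 and t=w]) auto
        also have "\<dots> \<le> (\<integral>\<^sup>+z. (ennreal \<bar>v t\<bar> * E (t - x)) * (indicator {0..Y} z * ennreal ((1 + z) ^
            s * \<bar>P t z\<bar>)) \<partial>lborel)"
        proof (rule nn_integral_mono)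
          fix z
          show "G (w + z) w t \<le> (ennreal \<bar>v t\<bar> * E (t - x)) * (indicator {0..Y} z * ennreal ((1 + z)
              ^ s * \<bar>P t z\<bar>))"
          proof (cases "0 \<le> z \<and> w + z \<le> Y")
            case z: True
            have "(1 + (w + z)) \<le> (1 + (t - x)) * (1 + z)"
            proof -
              have "w + z \<le> (t - x) + z" "0 \<le> (t - x) * z" using True z by auto
              then show ?thesis by (simp add: algebra_simps)
            qed
            then have "(1 + (w + z)) ^ s \<le> ((1 + (t - x)) * (1 + z)) ^ s" using True z by (intro
                power_mono) auto
            then have "(1 + (w + z)) ^ s * \<bar>v t * P t z\<bar> \<le> ((1 + (t - x)) * (1 + z)) ^ s * \<bar>v t * P
                t z\<bar>" by (rule mult_right_mono) simp
            also have "\<dots> = \<bar>v t\<bar> * (1 + (t - x)) ^ s * ((1 + z) ^ s * \<bar>P t z\<bar>)" by (simp add: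
                power_mult_distrib abs_mult mult_ac)
            finally have "ennreal ((1 + (w + z)) ^ s * \<bar>v t * P t z\<bar>) \<le> ennreal (\<bar>v t\<bar> * (1 + (t -
                x)) ^ s * ((1 + z) ^ s * \<bar>P t z\<bar>))" by (rule ennreal_leI)
            then show ?thesis using True z by (simp add: G_def E_def ennreal_mult[symmetric])
          next
            case False
            then show ?thesis using admissible_zero[OF P, of z t] by (auto simp: G_def
                indicator_def)
          qed
        qed
        also have "\<dots> = (ennreal \<bar>v t\<bar> * E (t - x)) * trunc_moment s P Y t"
          unfolding trunc_moment_def by (rule nn_integral_cmult) simp
        finally show ?thesis using True by simp
      next
        case False
        then show ?thesis by (auto simp: G_def indicator_def)
      qed
    qed
    also have "\<dots> = indicator {x..} t * (ennreal \<bar>v t\<bar> * E (t - x) * trunc_moment s P Y t) * ennreal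
        (t - x)"
      by (cases "x \<le> t") (auto simp: nn_integral_cmult_indicator)
    also have "\<dots> = indicator {x..} t * (ennreal \<bar>v t\<bar> * E (t - x) * ennreal (t - x) * trunc_moment s
        P Y t)" by (simp add: mult_ac)
    also have "\<dots> \<le> indicator {x..} t * (ennreal (\<bar>v t\<bar> * (1 + (t - x)) ^ (s + 1)) * trunc_moment s P
        Y t)"
    proof (cases "x \<le> t")
      case True
      have "\<bar>v t\<bar> * (1 + (t - x)) ^ s * (t - x) \<le> \<bar>v t\<bar> * (1 + (t - x)) ^ s * (1 + (t - x))"
        using True by (intro mult_left_mono) auto
      then have "ennreal \<bar>v t\<bar> * E (t - x) * ennreal (t - x) \<le> ennreal (\<bar>v t\<bar> * (1 + (t - x)) ^ (s +
          1))"
        using True by (auto simp: E_def ennreal_mult[symmetric] mult_ac intro!: ennreal_leI)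
      then show ?thesis by (intro mult_left_mono mult_right_mono) auto
    qed simp
    finally show "(\<integral>\<^sup>+w. \<integral>\<^sup>+y. G y w t \<partial>lborel \<partial>lborel) \<le> indicator {x..} t * (ennreal (\<bar>v t\<bar> * (1 +
        (t - x)) ^ (s + 1)) * trunc_moment s P Y t)" .
  qed
  finally have 2: "(\<integral>\<^sup>+y. \<integral>\<^sup>+w. \<integral>\<^sup>+t. G y w t \<partial>lborel \<partial>lborel \<partial>lborel) \<le> \<dots>" .
  note order_trans[OF 0 add_mono[OF 1 2]]
  also have "(\<integral>\<^sup>+t. indicator {x..} t * ennreal (\<bar>v t\<bar> * (1 + (t - x)) ^ (s + 1)) \<partial>lborel) +
    (\<integral>\<^sup>+t. indicator {x..} t * (ennreal (\<bar>v t\<bar> * (1 + (t - x)) ^ (s + 1)) * trunc_moment s P Y t)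
        \<partial>lborel) =
    (\<integral>\<^sup>+t. indicator {x..} t * (ennreal (\<bar>v t\<bar> * (1 + (t - x)) ^ (s + 1)) * (1 + trunc_moment s P Y
        t)) \<partial>lborel)"
    by (subst nn_integral_add[symmetric]) (auto simp: distrib_left)
  finally show ?thesis .
qed

lemma weighted_kernel:
  assumes v: "weighted s N v"
  shows "integrable lborel (\<lambda>t. (1 + \<bar>t\<bar>) ^ (s + 1) * \<bar>v t\<bar>)" "(\<integral>t. (1 + \<bar>t\<bar>) ^ (s + 1) * \<bar>v t\<bar>
      \<partial>lborel) \<le> N"
proof -
  have [measurable]: "v \<in> borel_measurable borel" using v by (rule weighted_measurable)
  have le: "(\<integral>\<^sup>+t. ennreal ((1 + \<bar>t\<bar>) ^ (s + 1) * \<bar>v t\<bar>) \<partial>lborel) \<le> ennreal N" using v by (simp add: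
      weighted_def)
  show i: "integrable lborel (\<lambda>t. (1 + \<bar>t\<bar>) ^ (s + 1) * \<bar>v t\<bar>)"
  proof (rule integrableI_nonneg)
    show "(\<integral>\<^sup>+t. ennreal ((1 + \<bar>t\<bar>) ^ (s + 1) * \<bar>v t\<bar>) \<partial>lborel) < \<infinity>"
      using le by (rule order_le_less_trans) simp
  qed auto
  have "(\<integral>\<^sup>+t. ennreal ((1 + \<bar>t\<bar>) ^ (s + 1) * \<bar>v t\<bar>) \<partial>lborel) = ennreal (\<integral>t. (1 + \<bar>t\<bar>) ^ (s + 1) *
      \<bar>v t\<bar> \<partial>lborel)"
    by (rule nn_integral_eq_integral[OF i]) simp
  moreover have "0 \<le> N" using v by (simp add: weighted_def)
  ultimately show "(\<integral>t. (1 + \<bar>t\<bar>) ^ (s + 1) * \<bar>v t\<bar> \<partial>lborel) \<le> N"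
    using le by (simp add: ennreal_le_iff)
qed

text \<open>After division by \<open>left_weight ^ (s + 1)\<close> the shift inequality replaces the
  kernel of \<open>trunc_moment_iter\<close> by
  \<open>k t = (1 + \<bar>t\<bar>) ^ (s + 1) * \<bar>v t\<bar>\<close>, which no longer depends on
  \<open>x\<close> and has integral at most \<open>N\<close>. The free term contributes the factor
  \<open>N\<close> and Gronwall's inequality the factor \<open>exp N\<close>.\<close>

lemma marchenko_kernel_trunc_moment:
  assumes C: "marchenko_kernel v P" and v: "weighted s N v" and Y: "0 \<le> Y"
  shows "trunc_moment s P Y x \<le> ennreal (N * exp N * left_weight x ^ (s + 1))"
proof -
  have P: "admissible P" using C by (rule marchenko_kernel_admissible)
  have [measurable]: "case_prod P \<in> borel_measurable (borel \<Otimes>\<^sub>M borel)" using P by (rule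
      admissible_measurable_prod)
  have [measurable]: "v \<in> borel_measurable borel" using v by (rule weighted_measurable)
  have N: "0 \<le> N" using v by (simp add: weighted_def)
  have [measurable]: "trunc_moment s P Y \<in> borel_measurable borel" unfolding
      trunc_moment_def[abs_def] by measurable
  have [measurable]: "left_weight \<in> borel_measurable borel" unfolding left_weight_def[abs_def] by
      measurable
  obtain K where K: "0 \<le> K" "\<And>t z. x \<le> t \<Longrightarrow> z \<le> Y \<Longrightarrow> \<bar>P t z\<bar> \<le> K" using admissible_bounded[OF P] by
      blast
  \<comment> \<open>This crude bound depends on \<open>P\<close> and \<open>Y\<close>. It only
    provides the finiteness and the a priori bound that Gronwall's inequality asks for, and does not
    reach the constant.\<close>
  have fin: "trunc_moment s P Y t \<le> ennreal ((1 + Y) ^ s * K * Y)" if t: "x \<le> t" for t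
  proof -
    have "trunc_moment s P Y t \<le> (\<integral>\<^sup>+y. ennreal ((1 + Y) ^ s * K) * indicator {0..Y} y \<partial>lborel)"
      unfolding trunc_moment_def
    proof (rule nn_integral_mono)
      fix y
      show "indicator {0..Y} y * ennreal ((1 + y) ^ s * \<bar>P t y\<bar>) \<le> ennreal ((1 + Y) ^ s * K) *
          indicator {0..Y} y"
      proof (cases "y \<in> {0..Y}")
        case True
        then have "(1 + y) ^ s * \<bar>P t y\<bar> \<le> (1 + Y) ^ s * K" using t by (intro mult_mono power_mono
            K) auto
        then show ?thesis using True by (simp add: ennreal_leI)
      qed simp
    qed
    also have "\<dots> = ennreal ((1 + Y) ^ s * K * Y)" using Y K(1) by (simp add:
        nn_integral_cmult_indicator ennreal_mult)
    finally show ?thesis .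
  qed
  define f where "f t = enn2real (trunc_moment s P Y t) / left_weight t ^ (s + 1)" for t
  define k where "k t = (1 + \<bar>t\<bar>) ^ (s + 1) * \<bar>v t\<bar>" for t
  have [measurable]: "k \<in> borel_measurable borel" unfolding k_def by measurable
  have [measurable]: "f \<in> borel_measurable borel" unfolding f_def by measurable
  have lw0: "0 < left_weight t ^ (s + 1)" "1 \<le> left_weight t ^ (s + 1)" for t using
      left_weight_ge_1[of t] by (auto intro!: one_le_power zero_less_power simp del: power_Suc
      add_2_eq_Suc')
  have f0: "0 \<le> f t" for t unfolding f_def using lw0[of t] by (intro divide_nonneg_nonneg) auto
  have k0: "0 \<le> k t" for t unfolding k_def by simp
  have kint: "integrable lborel k" and kN: "(\<integral>t. k t \<partial>lborel) \<le> N" using weighted_kernel[OF v] by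
      (simp_all add: k_def[abs_def])
  have tm: "trunc_moment s P Y t = ennreal (left_weight t ^ (s + 1) * f t)" if t: "x \<le> t" for t
  proof -
    have "trunc_moment s P Y t < top" using fin[OF t] by (rule order_le_less_trans) simp
    then have "trunc_moment s P Y t = ennreal (enn2real (trunc_moment s P Y t))" by simp
    also have "enn2real (trunc_moment s P Y t) = left_weight t ^ (s + 1) * f t" using lw0(1)[of t]
        unfolding f_def by (metis less_irrefl nonzero_mult_div_cancel_left times_divide_eq_right)
    finally show ?thesis .
  qed
  have "f x \<le> N * exp (\<integral>t. k t \<partial>lborel)"
  proof (rule tail_gronwall[where x0=x and K="(1 + Y) ^ s * K * Y", OF kint k0 N _ f0])
    show "0 \<le> (1 + Y) ^ s * K * Y" using Y K(1) by simp
    show "f t \<le> (1 + Y) ^ s * K * Y" if t: "x \<le> t" for t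
    proof -
      have "f t * 1 \<le> f t * left_weight t ^ (s + 1)" by (intro mult_left_mono lw0 f0)
      also have "\<dots> \<le> (1 + Y) ^ s * K * Y"
        using fin[OF t] Y K(1) unfolding tm[OF t] by (subst (asm) ennreal_le_iff) (simp_all add:
            mult.commute)
      finally show ?thesis by simp
    qed
    show "ennreal (f z) \<le> ennreal N + (\<integral>\<^sup>+t. indicator {z..} t * ennreal (k t * f t) \<partial>lborel)" if z:
        "x \<le> z" for z
    proof -
      have "ennreal (left_weight z ^ (s + 1)) * ennreal (f z) = trunc_moment s P Y z" unfolding
          tm[OF z] by (rule ennreal_mult[symmetric, OF less_imp_le[OF lw0(1)] f0])
      also have "\<dots> \<le> (\<integral>\<^sup>+t. indicator {z..} t * (ennreal (\<bar>v t\<bar> * (1 + (t - z)) ^ (s + 1)) * (1 +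
          trunc_moment s P Y t)) \<partial>lborel)"
        by (rule trunc_moment_iter[OF C weighted_integrable[OF v]])
      also have "\<dots> \<le> (\<integral>\<^sup>+t. ennreal (left_weight z ^ (s + 1)) * (ennreal (k t) + indicator {z..} t *
          ennreal (k t * f t)) \<partial>lborel)"
      proof (rule nn_integral_mono)
        fix t
        show "indicator {z..} t * (ennreal (\<bar>v t\<bar> * (1 + (t - z)) ^ (s + 1)) * (1 + trunc_moment s P
            Y t))
          \<le> ennreal (left_weight z ^ (s + 1)) * (ennreal (k t) + indicator {z..} t * ennreal (k t *
              f t))"
        proof (cases "z \<le> t")
          case True
          have "0 \<le> left_weight t ^ (s + 1) * f t" using f0[of t] lw0(1)[of t] by (intro
              mult_nonneg_nonneg) auto
          then have 1: "1 + trunc_moment s P Y t = ennreal (1 + left_weight t ^ (s + 1) * f t)"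
            using True z by (subst tm) (simp_all add: ennreal_1[symmetric] del: ennreal_1)
          have 2: "\<bar>v t\<bar> * (1 + (t - z)) ^ (s + 1) * (1 + left_weight t ^ (s + 1) * f t) \<le>
              left_weight z ^ (s + 1) * (k t + k t * f t)"
          proof -
            \<comment> \<open>Since \<open>left_weight t\<close> is at least \<open>1\<close>, the
              free term can carry the same weight as the moment, and both are then exchanged
              together.\<close>
            have "1 + left_weight t ^ (s + 1) * f t \<le> left_weight t ^ (s + 1) * (1 + f t)" using
                lw0[of t] by (simp only: distrib_left)
            then have "\<bar>v t\<bar> * (1 + (t - z)) ^ (s + 1) * (1 + left_weight t ^ (s + 1) * f t) \<le> \<bar>v t\<bar>
                * (1 + (t - z)) ^ (s + 1) * (left_weight t ^ (s + 1) * (1 + f t))"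
              using True by (intro mult_left_mono) auto
            also have "\<dots> = (\<bar>v t\<bar> * (1 + f t)) * ((1 + (t - z)) * left_weight t) ^ (s + 1)"
              by (simp only: power_mult_distrib mult_ac)
            also have "\<dots> \<le> (\<bar>v t\<bar> * (1 + f t)) * (left_weight z * (1 + \<bar>t\<bar>)) ^ (s + 1)"
              using True f0[of t] left_weight_ge_1[of t] by (intro mult_left_mono power_mono
                  left_weight_shift) auto
            also have "\<dots> = left_weight z ^ (s + 1) * (k t + k t * f t)"
              unfolding k_def power_mult_distrib by (simp only: distrib_left distrib_right mult_ac
                  mult_1 mult_1_right)
            finally show ?thesis .
          qed
          have "ennreal (\<bar>v t\<bar> * (1 + (t - z)) ^ (s + 1)) * (1 + trunc_moment s P Y t) = ennreal (\<bar>v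
              t\<bar> * (1 + (t - z)) ^ (s + 1) * (1 + left_weight t ^ (s + 1) * f t))"
            unfolding 1 using True f0[of t] lw0[of t] by (intro ennreal_mult[symmetric]) auto
          also have "\<dots> \<le> ennreal (left_weight z ^ (s + 1) * (k t + k t * f t))" by (rule
              ennreal_leI[OF 2])
          also have "\<dots> = ennreal (left_weight z ^ (s + 1)) * (ennreal (k t) + ennreal (k t * f t))"
            using k0[of t] f0[of t] lw0[of z] by (subst ennreal_mult) (simp_all del: power_Suc
                add_2_eq_Suc')
          finally show ?thesis using True by simp
        qed simp
      qed
      also have "\<dots> = ennreal (left_weight z ^ (s + 1)) * ((\<integral>\<^sup>+t. ennreal (k t) \<partial>lborel) + (\<integral>\<^sup>+t.
          indicator {z..} t * ennreal (k t * f t) \<partial>lborel))"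
        by (subst nn_integral_cmult, simp, subst nn_integral_add) simp_all
      finally have "ennreal (f z) \<le> (\<integral>\<^sup>+t. ennreal (k t) \<partial>lborel) + (\<integral>\<^sup>+t. indicator {z..} t *
          ennreal (k t * f t) \<partial>lborel)"
        using lw0[of z] by (subst (asm) ennreal_mult_le_mult_iff) auto
      also have "\<dots> \<le> ennreal N + (\<integral>\<^sup>+t. indicator {z..} t * ennreal (k t * f t) \<partial>lborel)"
        using v by (intro add_right_mono) (simp add: weighted_def k_def)
      finally show ?thesis .
    qed
  qed auto
  also have "\<dots> \<le> N * exp N" using N kN by (intro mult_left_mono) auto
  finally have "left_weight x ^ (s + 1) * f x \<le> left_weight x ^ (s + 1) * (N * exp N)" using lw0[of
      x] by (intro mult_left_mono) auto
  then have "ennreal (left_weight x ^ (s + 1) * f x) \<le> ennreal (N * exp N * left_weight x ^ (s +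
      1))" by (intro ennreal_leI) (simp only: mult_ac)
  then show ?thesis by (simp only: tm[OF order_refl])
qed

text \<open>The bound for the truncated moments does not depend on \<open>Y\<close>, so monotone
  convergence removes the truncation.\<close>

lemma marchenko_kernel_nn_moment:
  assumes C: "marchenko_kernel v P" and v: "weighted s N v"
  shows "nn_moment s (P x) \<le> ennreal (N * exp N * left_weight x ^ (s + 1))"
proof -
  have P: "admissible P" using C by (rule marchenko_kernel_admissible)
  have [measurable]: "P x \<in> borel_measurable borel" using admissible_section_measurable[OF P] .
  define g where "g n y = indicator {0..real n} y * ennreal ((1 + y) ^ s * \<bar>P x y\<bar>)" for n y
  have "nn_moment s (P x) = (\<integral>\<^sup>+y. (SUP n. g n y) \<partial>lborel)"
    unfolding nn_moment_def
  proof (rule nn_integral_cong)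
    fix y
    show "ennreal ((1 + \<bar>y\<bar>) ^ s * \<bar>P x y\<bar>) = (SUP n. g n y)"
    proof (rule antisym)
      obtain n where n: "y \<le> real n" using real_arch_simple by blast
      have "ennreal ((1 + \<bar>y\<bar>) ^ s * \<bar>P x y\<bar>) \<le> g n y"
        using n admissible_zero[OF P, of y x] by (cases "0 < y") (auto simp: g_def)
      also have "\<dots> \<le> (SUP n. g n y)" by (rule SUP_upper) simp
      finally show "ennreal ((1 + \<bar>y\<bar>) ^ s * \<bar>P x y\<bar>) \<le> (SUP n. g n y)" .
      show "(SUP n. g n y) \<le> ennreal ((1 + \<bar>y\<bar>) ^ s * \<bar>P x y\<bar>)"
        by (rule SUP_least) (auto simp: g_def indicator_def)
    qed
  qed
  also have "\<dots> = (SUP n. \<integral>\<^sup>+y. g n y \<partial>lborel)"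
  proof (rule nn_integral_monotone_convergence_SUP)
    show "incseq g" by (rule incseq_SucI) (auto simp: g_def le_fun_def indicator_def)
  qed (auto simp: g_def)
  also have "\<dots> \<le> ennreal (N * exp N * left_weight x ^ (s + 1))"
    using marchenko_kernel_trunc_moment[OF C v] by (intro SUP_least) (simp add: g_def
        trunc_moment_def)
  finally show ?thesis .
qed

text \<open>The start is Gronwall's constant. Each step adds the constants of the free term
  (\<open>N\<close>), of \<open>char_int\<close> (\<open>3 ^ j\<close>) and of
  \<open>tail_int\<close> (\<open>2 ^ j\<close>), which together make up the first derivatives. The
  previous constant is kept as a summand, so that the new one also covers the lower orders.\<close>

primrec kernel_const :: "real \<Rightarrow> nat \<Rightarrow> real" where
  "kernel_const N 0 = N * exp N"
| "kernel_const N (Suc j) = kernel_const N j + (N + 3 ^ j * kernel_const N j * N + 2 ^ j *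
    kernel_const N j * N)"

lemma kernel_const_nonneg: "0 \<le> N \<Longrightarrow> 0 \<le> kernel_const N j" by (induction j) auto

text \<open>The additional derivative of the potential makes \<open>w 0\<close> continuous and
  bounded, hence its shift admissible, and the absolutely continuous representations of
  \<open>P\<close> become derivatives at every point.\<close>

lemma marchenko_kernel_partials:
  assumes C: "marchenko_kernel (w 0) P" and w: "potential s (Suc m) N w"
  shows "partials P (\<lambda>x y. - (shift (w 0) x y + char_int (w 0) P x y)) (\<lambda>x y. - (shift (w 0) x y +
      char_int (w 0) P x y) + tail_int (w 0) P x y)"
  unfolding partials_def
proof (intro allI impI conjI)
  fix x y :: real assume y: "0 < y"
  note P = marchenko_kernel_admissible[OF C] and wD = potential_Suc_D[OF w]
  note rT = admissible_char_int[OF P wD(5)] and rQ = admissible_tail_int[OF P wD(5)] and rS =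
      admissible_shift[OF wD(2,4)]
  show "((\<lambda>x. P x y) has_real_derivative - (shift (w 0) x y + char_int (w 0) P x y)) (at x)"
  proof (rule deriv_of_ac_continuous[where S=UNIV])
    show "continuous_on UNIV (\<lambda>x. - (shift (w 0) x y + char_int (w 0) P x y))"
      using admissible_section_continuous[OF admissible_uminus[OF admissible_add[OF rS rT]] y, of 0]
          by simp
    show "P b y - P a y = (LINT t:{a..b}|lborel. - (shift (w 0) t y + char_int (w 0) P t y))" if "a
        \<le> b" for a b
      using marchenko_kernel_x_ac[OF C wD(5) that y] y by (simp add: shift_def)
  qed auto
  show "(P x has_real_derivative - (shift (w 0) x y + char_int (w 0) P x y) + tail_int (w 0) P x y)
      (at y)"
  proof (rule deriv_of_ac_continuous[where S="{0<..}"])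
    show "continuous_on {0<..} (\<lambda>y. - (shift (w 0) x y + char_int (w 0) P x y) + tail_int (w 0) P x
        y)"
      by (rule admissible_section_continuous'[OF admissible_add[OF admissible_uminus[OF
          admissible_add[OF rS rT]] rQ]])
    fix c d assume cd: "c \<le> d" "{c..d} \<subseteq> {0::real<..}"
    then have c: "0 < c" by auto
    have "P x d - P x c = (LINT y:{c..d}|lborel. - w 0 (x + y) + (tail_int (w 0) P x y - char_int (w
        0) P x y))"
      by (rule marchenko_kernel_y_ac[OF C wD(5) c cd(1)])
    also have "\<dots> = (LINT y:{c..d}|lborel. - (shift (w 0) x y + char_int (w 0) P x y) + tail_int (w
        0) P x y)"
      unfolding set_lebesgue_integral_def using c
      by (intro Bochner_Integration.integral_cong) (auto simp: shift_def indicator_def)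
    finally show "P x d - P x c = (LINT y:{c..d}|lborel. - (shift (w 0) x y + char_int (w 0) P x y)
        + tail_int (w 0) P x y)" .
  qed (use y in auto)
qed

text \<open>The bootstrap: the first derivatives of \<open>P\<close> are expressed by
  \<open>P\<close> itself through operators that preserve the order \<open>j\<close>, so
  \<open>P\<close> has order \<open>Suc j\<close>. The limit is the free term: its shift has order
  \<open>j\<close> only if the potential has \<open>Suc j\<close> derivatives.\<close>

lemma marchenko_kernel_smooth_kernel:
  assumes C: "marchenko_kernel (w 0) P" and w: "potential s m N w"
  shows "j \<le> m \<Longrightarrow> smooth_kernel s (s + 1) j (kernel_const N j) P"
proof (induction j)
  have N: "0 \<le> N" using potential_nonneg[OF w] .
  case 0
  then show ?case using marchenko_kernel_nn_moment[OF C potential_0[OF w]]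
      marchenko_kernel_admissible[OF C] by simp
next
  case (Suc j)
  have N: "0 \<le> N" using potential_nonneg[OF w] .
  have K: "0 \<le> kernel_const N j" using kernel_const_nonneg[OF N] .
  have IH: "smooth_kernel s (s + 1) j (kernel_const N j) P" using Suc by simp
  have w1: "potential s (Suc j) N w" using potential_mono[OF w Suc.prems] .
  have wj: "potential s j N w" using potential_mono[OF w1] by simp
  have X: "smooth_kernel s s j (N + 3 ^ j * kernel_const N j * N) (\<lambda>x y. - (shift (w 0) x y +
      char_int (w 0) P x y))"
    by (intro smooth_kernel_uminus smooth_kernel_add smooth_kernel_shift[OF w1]
        smooth_kernel_char_int[OF wj IH K] mult_nonneg_nonneg) (use N K in auto)
  have Y: "smooth_kernel s s j (N + 3 ^ j * kernel_const N j * N + 2 ^ j * kernel_const N j * N) (\<lambda>x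
      y. - (shift (w 0) x y + char_int (w 0) P x y) + tail_int (w 0) P x y)"
    by (intro smooth_kernel_add X smooth_kernel_tail_int[OF wj IH K] mult_nonneg_nonneg
        add_nonneg_nonneg) (use N K in auto)
  have le: "N + 3 ^ j * kernel_const N j * N \<le> kernel_const N (Suc j)" "N + 3 ^ j * kernel_const N j
      * N + 2 ^ j * kernel_const N j * N \<le> kernel_const N (Suc j)" "kernel_const N j \<le> kernel_const
      N (Suc j)"
    using N K by auto
  have nn: "0 \<le> N + 3 ^ j * kernel_const N j * N" "0 \<le> N + 3 ^ j * kernel_const N j * N + 2 ^ j *
      kernel_const N j * N" using N K by auto
  show ?case
    unfolding smooth_kernel.simps(2)
    using smooth_kernel_const_mono[OF smooth_kernel_0[OF IH] le(3)] marchenko_kernel_partials[OF C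
        w1]
      smooth_kernel_const_mono[OF smooth_kernel_weight_mono[OF X nn(1)] le(1)]
          smooth_kernel_const_mono[OF smooth_kernel_weight_mono[OF Y nn(2)] le(2)] by blast
qed

section \<open>Reduction to Borel potentials\<close>

text \<open>Completeness of \<open>lebesgue\<close> makes both functions measurable or neither, and
  in the latter case both integrals are zero by convention. So no measurability has to be known for
  the inner integrals of the Marchenko equation.\<close>

lemma integral_lebesgue_cong_AE:
  fixes f g :: "'a::euclidean_space \<Rightarrow> real"
  assumes ae: "AE x in lebesgue. f x = g x"
  shows "integral\<^sup>L lebesgue f = integral\<^sup>L lebesgue g"
proof -
  have ae': "AE x in lebesgue. g x = f x" using ae by eventually_elim simp
  show ?thesis
  proof (cases "f \<in> borel_measurable lebesgue")
    case True
    then show ?thesis using borel_measurable_AE[OF True ae] ae by (intro integral_cong_AE) auto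
  next
    case False
    then have "g \<notin> borel_measurable lebesgue" using borel_measurable_AE[OF _ ae'] by blast
    with False have "\<not> integrable lebesgue f" "\<not> integrable lebesgue g" by (auto dest:
        borel_measurable_integrable)
    then show ?thesis by (simp add: not_integrable_integral_eq)
  qed
qed

lemma integrable_lebesgue_cong_AE:
  fixes f g :: "'a::euclidean_space \<Rightarrow> real"
  assumes f: "integrable lebesgue f" and ae: "AE x in lebesgue. f x = g x"
  shows "integrable lebesgue g"
  using integrable_cong_AE[OF borel_measurable_integrable[OF f] borel_measurable_AE[OF
      borel_measurable_integrable[OF f] ae] ae] f
  by simp

lemma integral_lebesgue_eq_lborel:
  fixes f g :: "'a::euclidean_space \<Rightarrow> real"
  assumes "AE x in lborel. f x = g x" "g \<in> borel_measurable borel"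
  shows "integral\<^sup>L lebesgue f = integral\<^sup>L lborel g"
  using integral_lebesgue_cong_AE[OF AE_completion[OF assms(1)]] integral_completion[of g lborel]
      assms(2) by simp

lemma integrable_lebesgue_borel:
  fixes f :: "'a::euclidean_space \<Rightarrow> real"
  assumes f: "integrable lebesgue f"
  obtains g where "g \<in> borel_measurable borel" "AE x in lborel. f x = g x" "integrable lborel g"
proof -
  obtain g where g: "g \<in> borel_measurable lborel" "AE x in lborel. f x = g x"
    using completion_ex_borel_measurable_real[of f lborel] f by (auto dest:
        borel_measurable_integrable)
  have "integrable lebesgue g" by (rule integrable_lebesgue_cong_AE[OF f AE_completion[OF g(2)]])
  then have "integrable lborel g" using integrable_completion[OF g(1)] by simp
  then show ?thesis using g that by simp
qed

text \<open>The exceptional set is first enlarged to a Borel null set, since exchanging the two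
  quantifiers requires measurability in the product.\<close>

lemma AE_swapped_sections:
  assumes "AE q in (lborel :: (real \<times> real) measure). Q q"
  shows "AE z in lborel. AE t in lborel. Q (t, z)"
proof -
  have "AE q in lborel \<Otimes>\<^sub>M lborel. Q q" using assms by (simp only: lborel_prod)
  then obtain N where N: "N \<in> null_sets (lborel \<Otimes>\<^sub>M lborel)" "{q \<in> space (lborel \<Otimes>\<^sub>M lborel). \<not> Q q}
      \<subseteq> N"
    by (auto simp: eventually_ae_filter)
  have [measurable]: "N \<in> sets (lborel \<Otimes>\<^sub>M lborel)" using N(1) by auto
  have "AE q in lborel \<Otimes>\<^sub>M lborel. q \<notin> N" using N(1) by (rule AE_not_in)
  then have "AE t in lborel. AE z in lborel. (t, z) \<notin> N" by (rule lborel_pair.AE_pair)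
  moreover have "{q \<in> space (lborel \<Otimes>\<^sub>M lborel). (fst q, snd q) \<notin> N} \<in> sets (lborel \<Otimes>\<^sub>M lborel)" by
      measurable
  ultimately have "AE z in lborel. AE t in lborel. (t, z) \<notin> N"
    using lborel_pair.AE_commute[of "\<lambda>t z. (t, z) \<notin> N"] by (simp only:)
  then show ?thesis
    by eventually_elim (erule eventually_mono, use N(2) in \<open>auto simp: space_pair_measure\<close>)
qed

text \<open>
  The measure \<open>lebesgue\<close> on the plane is not the product of the measures
  \<open>lebesgue\<close> on the axes, so that Fubini is applied to a Borel representative.
\<close>
lemma integral_lebesgue_iterated:
  fixes g :: "real \<times> real \<Rightarrow> real"
  assumes g: "integrable lebesgue g"
  shows "(LINT z|lebesgue. LINT t|lebesgue. g (t, z)) = integral\<^sup>L lebesgue g"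
proof -
  obtain g' where g': "g' \<in> borel_measurable borel" "AE q in lborel. g q = g' q" "integrable lborel
      g'"
    using integrable_lebesgue_borel[OF g] .
  have [measurable]: "g' \<in> borel_measurable (borel \<Otimes>\<^sub>M borel)" using g'(1) by (simp add: borel_prod)
  have int: "integrable (lborel \<Otimes>\<^sub>M lborel) (\<lambda>(t, z). g' (t, z))" using g'(3) by (simp add:
      lborel_prod)
  have "AE z in lborel. AE t in lborel. g (t, z) = g' (t, z)" by (rule AE_swapped_sections[OF
      g'(2)])
  then have "AE z in lborel. (LINT t|lebesgue. g (t, z)) = (LINT t|lborel. g' (t, z))"
    by eventually_elim (rule integral_lebesgue_eq_lborel, auto)
  then have "(LINT z|lebesgue. LINT t|lebesgue. g (t, z)) = (LINT z|lborel. LINT t|lborel. g' (t,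
      z))"
    by (rule integral_lebesgue_eq_lborel) measurable
  also have "\<dots> = integral\<^sup>L (lborel \<Otimes>\<^sub>M lborel) g'" using lborel_pair.integral_snd[OF int] by simp
  also have "\<dots> = integral\<^sup>L lebesgue g" 
    using integral_lebesgue_eq_lborel[OF g'(2,1)] by (simp add: lborel_prod)
  finally show ?thesis .
qed

text \<open>The common form of the plus equation and of the reflected minus equation, so that the
  passage to kernels is carried out once.\<close>

definition marchenko_eq :: "(real \<Rightarrow> real) \<Rightarrow> (real \<Rightarrow> real \<Rightarrow> real) \<Rightarrow> bool" where
  "marchenko_eq V B \<longleftrightarrow> (\<forall>x. \<forall>y>0.
        set_integrable lebesgue {(t, z). 0 < z \<and> z < y \<and> x + y - z < t} (\<lambda>(t, z). V t * B t z) \<and>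
        B x y = (LINT t:{x + y..}|lebesgue. V t) +
                (LINT z:{0..y}|lebesgue. (LINT t:{x + y - z..}|lebesgue. V t * B t z)))"

text \<open>The slanted edge of the region of integration is a null set; off its edges the indicator
  of the region is stable under small changes of \<open>(x, y)\<close>.\<close>

lemma AE_lborel_neq_line: "AE q in (lborel :: (real \<times> real) measure). fst q + snd q \<noteq> c"
proof -
  have "AE q in lborel \<Otimes>\<^sub>M lborel. fst q + snd q \<noteq> (c::real)"
  proof (rule lborel_pair.AE_pair_measure)
    have "AE z in lborel. t + z \<noteq> c" for t :: real
      using AE_lborel_singleton[of "c - t"] by eventually_elim auto
    then show "AE t in lborel. AE z in lborel. fst (t, z) + snd (t, z) \<noteq> c" by simp
  qed measurable
  then show ?thesis by (simp only: lborel_prod)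
qed

lemma AE_lborel_snd_neq: "AE q in (lborel :: (real \<times> real) measure). snd q \<noteq> c"
proof -
  have "AE q in lborel \<Otimes>\<^sub>M lborel. snd (q::real\<times>real) \<noteq> c"
  proof (rule lborel_pair.AE_pair_measure)
    show "AE t in lborel. AE z in lborel. snd (t::real, z) \<noteq> c" using AE_lborel_singleton[of c] by
        simp
  qed measurable
  then show ?thesis by (simp only: lborel_prod)
qed

text \<open>No joint regularity of \<open>B\<close> is given, so the order of the steps matters.
  First the iterated integral is replaced by an integral over the plane, which is continuous in
  \<open>(x, y)\<close> by dominated convergence, whatever \<open>B\<close> is. Hence
  \<open>P\<close> is admissible, in particular jointly Borel measurable, and only then can
  \<open>V\<close> be replaced by \<open>v\<close> and the integrals be rewritten over
  \<open>lborel\<close>.\<close>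

lemma marchenko_eq_marchenko_kernel:
  assumes M: "marchenko_eq V B" and V: "integrable lebesgue V"
    and v: "integrable lborel v" and Vv: "AE t in lborel. V t = v t"
  shows "marchenko_kernel v (\<lambda>x y. indicator {0<..} y * B x y)"
proof -
  define P where "P x y = indicator {0<..} y * B x y" for x y
  define g where "g x y q = indicator {(t, z). 0 < z \<and> z < y \<and> x + y - z < t} q * (case q of (t, z)
      \<Rightarrow> V t * B t z)" for x y q
  have [measurable]: "v \<in> borel_measurable borel" using v by (simp add: borel_measurable_integrable)
  have g: "integrable lebesgue (g x y)" if "0 < y" for x y
    using M that unfolding marchenko_eq_def set_integrable_def g_def[abs_def] by simp
  \<comment> \<open>For \<open>x0 \<le> x\<close> and \<open>y \<le> Y\<close> the region of
    \<open>(x, y)\<close> lies inside that of \<open>(x0 - Y, Y)\<close>: from \<open>z < y\<close>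
    and \<open>z > 0\<close> one gets \<open>x + y - z > x0 - z\<close>. So one integrable function
    dominates all of them; for \<open>y \<le> 0\<close> the region is empty.\<close>
  have g_le: "\<bar>g x y q\<bar> \<le> \<bar>g (x0 - Y) Y q\<bar>" if "x0 \<le> x" "y \<le> Y" for x y x0 Y q
    using that by (auto simp: g_def indicator_def split: prod.split)
  have tailV: "(LINT t:{u..}|lebesgue. V t) = (\<integral>t. indicator {u..} t * v t \<partial>lborel)" for u
    unfolding set_lebesgue_integral_def
    by (rule integral_lebesgue_eq_lborel) (use Vv in \<open>auto elim!: eventually_mono\<close>)
  have Beq: "B x y = (\<integral>t. indicator {x + y..} t * v t \<partial>lborel) + integral\<^sup>L lebesgue (g x y)" if y:
      "0 < y" for x y
  proof -
    have "(LINT z:{0..y}|lebesgue. (LINT t:{x + y - z..}|lebesgue. V t * B t z)) =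
      (LINT z|lebesgue. LINT t|lebesgue. g x y (t, z))"
      unfolding set_lebesgue_integral_def
    proof (rule integral_lebesgue_cong_AE)
      have "AE z in lborel. z \<noteq> 0 \<and> z \<noteq> y" using AE_lborel_singleton[of 0] AE_lborel_singleton[of y]
          by eventually_elim simp
      then have "AE z in lborel. indicator {0..y} z *\<^sub>R (LINT t|lebesgue. indicator {x + y - z..} t
          *\<^sub>R (V t * B t z)) = (LINT t|lebesgue. g x y (t, z))"
      proof eventually_elim
        case (elim z)
        have "(LINT t|lebesgue. indicator {0..y} z * (indicator {x + y - z..} t * (V t * B t z))) =
            (LINT t|lebesgue. g x y (t, z))"
        proof (rule integral_lebesgue_cong_AE, rule AE_completion)
          show "AE t in lborel. indicator {0..y} z * (indicator {x + y - z..} t * (V t * B t z)) = g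
              x y (t, z)"
            using AE_lborel_singleton[of "x + y - z"] by eventually_elim (use elim in \<open>auto simp:
                g_def indicator_def\<close>)
        qed
        then show ?case by simp
      qed
      then show "AE z in lebesgue. indicator {0..y} z *\<^sub>R (LINT t|lebesgue. indicator {x + y - z..}
          t *\<^sub>R (V t * B t z)) = (LINT t|lebesgue. g x y (t, z))"
        by (rule AE_completion)
    qed
    also have "\<dots> = integral\<^sup>L lebesgue (g x y)" by (rule integral_lebesgue_iterated[OF g[OF y]])
    finally show ?thesis using M y tailV unfolding marchenko_eq_def by simp
  qed
  have admissible: "admissible P"
  proof (rule admissibleI)
    show "P x y = 0" if "y \<le> 0" for x y using that by (simp add: P_def)
  next
    fix X Y :: "nat \<Rightarrow> real" and x y assume X: "X \<longlonglongrightarrow> x" and Y: "Y \<longlonglongrightarrow> y" and Yn: "\<And>n. 0 < Y n" and y: "0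
        < y"
    obtain x0 where x0: "\<And>n. \<bar>X n\<bar> \<le> x0" using bounded_sequences[OF X] by blast
    obtain y0 where y0: "\<And>n. \<bar>Y n\<bar> \<le> y0" using bounded_sequences[OF Y] by blast
    have y0p: "0 < y0" using y0[of 0] Yn[of 0] by linarith
    have "(\<lambda>n. \<integral>t. indicator {X n + Y n..} t * v t \<partial>lborel) \<longlonglongrightarrow> (\<integral>t. indicator {x + y..} t * v t
        \<partial>lborel)"
    proof (rule integral_dominated_convergence[where w="\<lambda>t. \<bar>v t\<bar>"])
      show "AE t in lborel. (\<lambda>n. indicator {X n + Y n..} t * v t) \<longlonglongrightarrow> indicator {x + y..} t * v t"
        using AE_lborel_singleton[of "x + y"]
        by eventually_elim (intro tendsto_mult indicator_atLeast_tendsto tendsto_add X Y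
            tendsto_const)
    qed (use v in \<open>auto simp: indicator_def\<close>)
    moreover have "(\<lambda>n. integral\<^sup>L lebesgue (g (X n) (Y n))) \<longlonglongrightarrow> integral\<^sup>L lebesgue (g x y)"
    proof (rule integral_dominated_convergence[where w="\<lambda>q. \<bar>g (- x0 - y0) y0 q\<bar>"])
      have "AE q in lborel. (\<lambda>n. g (X n) (Y n) q) \<longlonglongrightarrow> g x y q"
        using AE_lborel_neq_line[of "x + y"] AE_lborel_snd_neq[of y]
      proof eventually_elim
        case (elim q)
        obtain t z where q: "q = (t, z)" by (cases q)
        have e1: "eventually (\<lambda>n. (z < Y n) = (z < y)) sequentially"
        proof (cases "z < y")
          case True
          show ?thesis using order_tendstoD(1)[OF Y True] by (rule eventually_mono) (use True in
              auto)
        next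
          case False
          with elim q have "y < z" by auto
          show ?thesis using order_tendstoD(2)[OF Y \<open>y < z\<close>] by (rule eventually_mono) (use False in
              auto)
        qed
        have XY: "(\<lambda>n. X n + Y n - z) \<longlonglongrightarrow> x + y - z" by (intro tendsto_intros X Y)
        have e2: "eventually (\<lambda>n. (X n + Y n - z < t) = (x + y - z < t)) sequentially"
        proof (cases "x + y - z < t")
          case True
          show ?thesis using order_tendstoD(2)[OF XY True] by (rule eventually_mono) (use True in
              auto)
        next
          case False
          with elim q have "t < x + y - z" by auto
          show ?thesis using order_tendstoD(1)[OF XY \<open>t < x + y - z\<close>] by (rule eventually_mono) (use
              False in auto)
        qed
        have "eventually (\<lambda>n. g (X n) (Y n) q = g x y q) sequentially"
          using e1 e2 by eventually_elim (simp add: g_def q indicator_def)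
        then show ?case by (rule tendsto_eventually)
      qed
      then show "AE q in lebesgue. (\<lambda>n. g (X n) (Y n) q) \<longlonglongrightarrow> g x y q" by (rule AE_completion)
      show "AE q in lebesgue. norm (g (X n) (Y n) q) \<le> \<bar>g (- x0 - y0) y0 q\<bar>" for n
        using g_le[of "-x0" "X n" "Y n" y0] x0[of n] y0[of n] by (auto intro!: AE_I2)
      show "integrable lebesgue (\<lambda>q. \<bar>g (- x0 - y0) y0 q\<bar>)" using g[OF y0p] by simp
    qed (use g Yn y in \<open>auto dest: borel_measurable_integrable\<close>)
    ultimately have "(\<lambda>n. B (X n) (Y n)) \<longlonglongrightarrow> B x y"
      unfolding Beq[OF y] Beq[OF Yn] by (rule tendsto_add)
    then show "(\<lambda>n. P (X n) (Y n)) \<longlonglongrightarrow> P x y" using Yn y by (simp add: P_def)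
  next
    fix x0 Y :: real
    show "\<exists>K. \<forall>x\<ge>x0. \<forall>y\<le>Y. \<bar>P x y\<bar> \<le> K"
    proof (intro exI[of _ "(\<integral>t. \<bar>v t\<bar> \<partial>lborel) + (LINT q|lebesgue. \<bar>g (x0 - Y) Y q\<bar>)"] allI impI)
      fix x y assume xy: "x0 \<le> x" "y \<le> Y"
      show "\<bar>P x y\<bar> \<le> (\<integral>t. \<bar>v t\<bar> \<partial>lborel) + (LINT q|lebesgue. \<bar>g (x0 - Y) Y q\<bar>)"
      proof (cases "0 < y")
        case True
        have "\<bar>\<integral>t. indicator {x + y..} t * v t \<partial>lborel\<bar> \<le> 1 * (\<integral>t. \<bar>v t\<bar> \<partial>lborel)"
          by (rule dominated_integrable(2)[OF v]) (auto simp: indicator_def)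
        moreover have "\<bar>integral\<^sup>L lebesgue (g x y)\<bar> \<le> (LINT q|lebesgue. \<bar>g x y q\<bar>)" by (rule
            integral_abs_bound)
        moreover have "(LINT q|lebesgue. \<bar>g x y q\<bar>) \<le> (LINT q|lebesgue. \<bar>g (x0 - Y) Y q\<bar>)"
          using g[OF True] g[of Y] True xy g_le[OF xy] by (intro integral_mono) auto
        moreover have "\<bar>P x y\<bar> \<le> \<bar>\<integral>t. indicator {x + y..} t * v t \<partial>lborel\<bar> + \<bar>integral\<^sup>L lebesgue (g
            x y)\<bar>"
          using True Beq[OF True, of x] by (simp add: P_def)
        ultimately show ?thesis by linarith
      next
        case False
        then show ?thesis by (simp add: P_def)
      qed
    qed
  qed
  have [measurable]: "case_prod P \<in> borel_measurable (borel \<Otimes>\<^sub>M borel)" by (rule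
      admissible_measurable_prod[OF admissible])
  have "P x y = (\<integral>t. indicator {x + y..} t * v t \<partial>lborel) +
     (\<integral>w. indicator {0..} w * (\<integral>t. indicator {x + w..} t * (v t * P t (y - w)) \<partial>lborel) \<partial>lborel)" if
         y: "0 < y" for x y
  proof -
    have inner: "(LINT t:{x + y - z..}|lebesgue. V t * B t z) = (\<integral>t. indicator {x + y - z..} t * (v
        t * P t z) \<partial>lborel)" if "0 < z" for z
      unfolding set_lebesgue_integral_def
    proof (rule integral_lebesgue_eq_lborel)
      show "AE t in lborel. indicator {x + y - z..} t *\<^sub>R (V t * B t z) = indicator {x + y - z..} t
          * (v t * P t z)"
        using Vv by eventually_elim (use that in \<open>simp add: P_def\<close>)
    qed measurable
    define J where "J z = (\<integral>t. indicator {x + y - z..} t * (v t * P t z) \<partial>lborel)" for z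
    have [measurable]: "J \<in> borel_measurable borel" unfolding J_def by (simp add: indicator_def)
    have "(LINT z:{0..y}|lebesgue. (LINT t:{x + y - z..}|lebesgue. V t * B t z)) = (\<integral>z. indicator
        {0..y} z * J z \<partial>lborel)"
      unfolding set_lebesgue_integral_def[of _ "{0..y}"]
    proof (rule integral_lebesgue_eq_lborel)
      show "AE z in lborel. indicator {0..y} z *\<^sub>R (LINT t:{x + y - z..}|lebesgue. V t * B t z) =
          indicator {0..y} z * J z"
        using AE_lborel_singleton[of 0] by eventually_elim (auto simp: inner J_def indicator_def)
    qed measurable
    also have "\<dots> = (\<integral>w. indicator {0..y} (y - w) * J (y - w) \<partial>lborel)"
      using lborel_integral_real_affine[of "-1" "\<lambda>z. indicator {0..y} z * J z" y] by simp
    also have "\<dots> = (\<integral>w. indicator {0..} w * (\<integral>t. indicator {x + w..} t * (v t * P t (y - w))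
        \<partial>lborel) \<partial>lborel)"
    proof (rule Bochner_Integration.integral_cong[OF refl])
      fix w
      have J: "J (y - w) = (\<integral>t. indicator {x + w..} t * (v t * P t (y - w)) \<partial>lborel)" by (simp add:
          J_def algebra_simps)
      show "indicator {0..y} (y - w) * J (y - w) = indicator {0..} w * (\<integral>t. indicator {x + w..} t *
          (v t * P t (y - w)) \<partial>lborel)"
      proof (cases "0 \<le> w \<and> w \<le> y")
        case False
        then have "w < 0 \<or> y - w \<le> 0" by auto
        then show ?thesis using False admissible_zero[OF admissible, of "y - w"] by (auto simp:
            indicator_def)
      qed (simp add: J)
    qed
    finally show ?thesis using M y tailV unfolding marchenko_eq_def by (simp add: P_def)
  qed
  then have "marchenko_kernel v P" using admissible by (simp add: marchenko_kernel_def)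
  then show ?thesis by (simp add: P_def[abs_def])
qed

section \<open>Reflection of the minus case\<close>

lemma distr_lebesgue_uminus: "distr lebesgue lebesgue uminus = (lebesgue :: 'a::euclidean_space
    measure)"
  and measurable_lebesgue_uminus: "uminus \<in> lebesgue \<rightarrow>\<^sub>M (lebesgue :: 'a measure)"
proof -
  have T: "(\<lambda>x::'a. 0 + (\<Sum>j\<in>Basis. (- 1 * (x \<bullet> j)) *\<^sub>R j)) = uminus"
    by (auto simp: sum_negf euclidean_representation)
  show "uminus \<in> lebesgue \<rightarrow>\<^sub>M (lebesgue :: 'a measure)"
    using lebesgue_affine_measurable[of "\<lambda>_::'a. -1" 0] unfolding T by simp
  show "distr lebesgue lebesgue uminus = (lebesgue :: 'a measure)"
    using lebesgue_affine_euclidean[of "\<lambda>_::'a. -1" 0, symmetric] unfolding T by (simp add: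
        density_1)
qed

lemma integrable_lebesgue_uminus:
  fixes f :: "'a::euclidean_space \<Rightarrow> real"
  assumes "integrable lebesgue f" shows "integrable lebesgue (\<lambda>x. f (- x))"
  using assms integrable_distr[OF measurable_lebesgue_uminus, of f] distr_lebesgue_uminus by metis

lemma integral_lebesgue_uminus:
  fixes f :: "'a::euclidean_space \<Rightarrow> real"
  shows "(LINT x|lebesgue. f (- x)) = integral\<^sup>L lebesgue f"
proof (cases "integrable lebesgue f")
  case True
  then have "f \<in> borel_measurable lebesgue" by auto
  then have "integral\<^sup>L (distr lebesgue lebesgue uminus) f = (LINT x|lebesgue. f (- x))"
    by (intro integral_distr measurable_lebesgue_uminus)
  then show ?thesis by (simp add: distr_lebesgue_uminus)
next
  case False
  then have "\<not> integrable lebesgue (\<lambda>x. f (- x))" using integrable_lebesgue_uminus[of "\<lambda>x. f (- x)"]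
      by auto
  with False show ?thesis by (simp add: not_integrable_integral_eq)
qed

lemma marchenko_plus_eq: "marchenko_plus V B \<Longrightarrow> marchenko_eq V B"
  unfolding marchenko_plus_def marchenko_eq_def by blast

lemma marchenko_minus_eq:
  assumes "marchenko_minus V B"
  shows "marchenko_eq (\<lambda>t. V (- t)) (\<lambda>x y. B (- x) (- y))"
  unfolding marchenko_eq_def
proof (intro allI impI conjI)
  fix x y :: real assume y: "0 < y"
  have M: "\<forall>x. \<forall>y<0. set_integrable lebesgue {(t, z). y < z \<and> z < 0 \<and> t < x + y - z} (\<lambda>(t, z). V t *
      B t z) \<and>
        B x y = (LINT t:{..x + y}|lebesgue. V t) +
                (LINT z:{y..0}|lebesgue. (LINT t:{..x + y - z}|lebesgue. V t * B t z))"
    using assms unfolding marchenko_minus_def by blast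
  have int: "set_integrable lebesgue {(t, z). - y < z \<and> z < 0 \<and> t < - x + - y - z} (\<lambda>(t, z). V t * B
      t z)"
    and eq: "B (- x) (- y) = (LINT t:{..- x + - y}|lebesgue. V t) +
                (LINT z:{- y..0}|lebesgue. (LINT t:{..- x + - y - z}|lebesgue. V t * B t z))"
    using M[rule_format, of "- y" "- x"] y by simp_all
  show "set_integrable lebesgue {(t, z). 0 < z \<and> z < y \<and> x + y - z < t} (\<lambda>(t, z). V (- t) * B (- t)
      (- z))"
    \<comment> \<open>The reflection is that of the plane, changing the signs of \<open>t\<close>
      and \<open>z\<close> together; the iterated integrals below are reflected one variable at a
      time.\<close>
    using integrable_lebesgue_uminus[OF int[unfolded set_integrable_def]] unfolding
        set_integrable_def
    by (rule Bochner_Integration.integrable_cong[THEN iffD1, rotated 2]) (auto simp: indicator_def)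
  have 1: "(LINT t:{..- x + - y}|lebesgue. V t) = (LINT t:{x + y..}|lebesgue. V (- t))"
    unfolding set_lebesgue_integral_def
    by (subst integral_lebesgue_uminus[symmetric]) (auto simp: indicator_def intro!:
        Bochner_Integration.integral_cong)
  have 2: "(LINT t:{..- x + - y + z}|lebesgue. V t * B t (- z)) = (LINT t:{x + y - z..}|lebesgue. V
      (- t) * B (- t) (- z))" for z
    unfolding set_lebesgue_integral_def
    by (subst integral_lebesgue_uminus[symmetric]) (auto simp: indicator_def intro!:
        Bochner_Integration.integral_cong)
  have "(LINT z:{- y..0}|lebesgue. (LINT t:{..- x + - y - z}|lebesgue. V t * B t z)) =
     (LINT z:{0..y}|lebesgue. (LINT t:{..- x + - y + z}|lebesgue. V t * B t (- z)))"
    unfolding set_lebesgue_integral_def[of _ "{- y..0}"] set_lebesgue_integral_def[of _ "{0..y}"]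
    by (subst integral_lebesgue_uminus[symmetric]) (auto simp: indicator_def intro!:
        Bochner_Integration.integral_cong)
  with eq 1 2 show "B (- x) (- y) = (LINT t:{x + y..}|lebesgue. V (- t)) +
       (LINT z:{0..y}|lebesgue. LINT t:{x + y - z..}|lebesgue. V (- t) * B (- t) (- z))" by simp
qed

section \<open>Weak derivatives and weighted Sobolev spaces\<close>

lemma set_integral_lborel_lebesgue:
  fixes f :: "real \<Rightarrow> real"
  assumes "set_integrable lborel A f"
  shows "set_integrable lebesgue A f" "(LINT t:A|lebesgue. f t) = (LINT t:A|lborel. f t)"
proof -
  have m: "(\<lambda>t. indicator A t *\<^sub>R f t) \<in> borel_measurable lborel"
    using assms unfolding set_integrable_def by (rule borel_measurable_integrable)
  show "set_integrable lebesgue A f" using assms integrable_completion[OF m] by (simp add: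
      set_integrable_def)
  show "(LINT t:A|lebesgue. f t) = (LINT t:A|lborel. f t)"
    unfolding set_lebesgue_integral_def by (rule integral_completion[OF m])
qed

lemma ac_derivsD:
  assumes "ac_derivs S n F" "i < n" "a \<in> S" "b \<in> S" "a \<le> b"
  shows "set_integrable lebesgue {a..b} (F (Suc i))" "F i b - F i a = (LINT t:{a..b}|lebesgue. F
      (Suc i) t)"
  using assms unfolding ac_derivs_def by blast+

lemma ac_derivs_continuous:
  fixes F :: "nat \<Rightarrow> real \<Rightarrow> real"
  assumes S: "open S" "is_interval S" and F: "ac_derivs S n F" and i: "i < n"
  shows "continuous_on S (F i)"
proof -
  have "isCont (F i) x" if x: "x \<in> S" for x
  proof -
    obtain e where e: "e > 0" "cball x e \<subseteq> S" using S x open_contains_cball by blast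
    define a b where "a = x - e" and "b = x + e"
    have ab: "a \<in> S" "b \<in> S" "a < x" "x < b" using e by (auto simp: a_def b_def dist_real_def
        subset_eq)
    have sub: "{a..b} \<subseteq> S" using ab S(2) by (meson atLeastAtMost_iff mem_is_interval_1_I subsetI)
    have int: "set_integrable lebesgue {a..b} (F (Suc i))" using ac_derivsD(1)[OF F i ab(1,2)] ab by
        simp
    have "continuous_on {a..b} (\<lambda>y. F i a + integral {a..y} (F (Suc i)))"
      by (intro continuous_intros indefinite_integral_continuous_1
          set_lebesgue_integral_eq_integral(1) int)
    moreover have "F i a + integral {a..y} (F (Suc i)) = F i y" if y: "y \<in> {a..b}" for y
    proof -
      have "set_integrable lebesgue {a..y} (F (Suc i))" using set_integrable_subset[OF int] y by
          auto
      then have "integral {a..y} (F (Suc i)) = (LINT t:{a..y}|lebesgue. F (Suc i) t)"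
        by (simp add: set_lebesgue_integral_eq_integral(2))
      moreover have "F i y - F i a = (LINT t:{a..y}|lebesgue. F (Suc i) t)"
        by (rule ac_derivsD(2)[OF F i ab(1)]) (use y sub in auto)
      ultimately show ?thesis by simp
    qed
    ultimately have "continuous_on {a..b} (F i)" by (metis (no_types, lifting) continuous_on_cong)
    then have "continuous_on {a<..<b} (F i)" by (rule continuous_on_subset) auto
    then show ?thesis using ab by (simp add: continuous_on_eq_continuous_at)
  qed
  then show ?thesis by (simp add: continuous_at_imp_continuous_on)
qed

text \<open>Below the top order the next function is an integral itself, hence continuous, and the
  derivative exists at every point. At the top order Lebesgue's theorem gives it almost
  everywhere.\<close>

lemma ac_derivs_has_derivative:
  fixes F :: "nat \<Rightarrow> real \<Rightarrow> real"
  assumes S: "open S" "is_interval S" and F: "ac_derivs S n F"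
  shows "Suc i < n \<Longrightarrow> x \<in> S \<Longrightarrow> (F i has_real_derivative F (Suc i) x) (at x)"
    and "i < n \<Longrightarrow> AE x in lebesgue. x \<in> S \<longrightarrow> (F i has_real_derivative F (Suc i) x) (at x)"
proof -
  show "(F i has_real_derivative F (Suc i) x) (at x)" if i: "Suc i < n" and x: "x \<in> S"
  proof (rule deriv_of_ac_continuous[OF S(1) x])
    show c: "continuous_on S (F (Suc i))" by (rule ac_derivs_continuous[OF S F i])
    fix a b :: real assume ab: "a \<le> b" "{a..b} \<subseteq> S"
    then have "F i b - F i a = (LINT t:{a..b}|lebesgue. F (Suc i) t)"
      by (intro ac_derivsD(2)[OF F]) (use i in auto)
    also have "\<dots> = (LINT t:{a..b}|lborel. F (Suc i) t)"
      by (rule set_integral_lborel_lebesgue(2)[OF borel_integrable_atLeastAtMost'[OF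
          continuous_on_subset[OF c ab(2)]]])
    finally show "F i b - F i a = (LINT t:{a..b}|lborel. F (Suc i) t)" .
  qed
  show "AE x in lebesgue. x \<in> S \<longrightarrow> (F i has_real_derivative F (Suc i) x) (at x)" if i: "i < n"
    by (rule ac_has_derivative_AE[OF S]) (use ac_derivsD[OF F i] in blast)
qed

text \<open>The set where the functions differ is open and null, hence empty.\<close>

lemma continuous_AE_eq:
  fixes f g :: "real \<Rightarrow> real"
  assumes "continuous_on UNIV f" "continuous_on UNIV g" "AE x in lebesgue. f x = g x"
  shows "f x = g x"
proof (rule ccontr)
  assume ne: "f x \<noteq> g x"
  have "open {x. f x \<noteq> g x}" using open_Collect_neq[OF assms(1,2)] .
  moreover have "negligible {x. f x \<noteq> g x}"
    using assms(3) unfolding completion.AE_iff_null_sets negligible_iff_null_sets by simp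
  ultimately show False using open_not_negligible ne by blast
qed

text \<open>
  The choice of derivatives in \<open>norm_W1\<close> is only constrained by
  \<open>sobolev_derivs\<close>; its integrability is inherited from any other choice through this
  lemma.
\<close>
lemma sobolev_derivs_unique:
  assumes W: "sobolev_derivs n V W" and W': "sobolev_derivs n V W'"
  shows "i \<le> n \<Longrightarrow> AE x in lebesgue. W i x = W' i x"
proof (induction i)
  case 0
  have "AE x in lebesgue. W 0 x = V x" "AE x in lebesgue. W' 0 x = V x" using W W' by (auto simp:
      sobolev_derivs_def)
  then show ?case by eventually_elim simp
next
  case (Suc i)
  have acW: "ac_derivs UNIV n W" "ac_derivs UNIV n W'" using W W' by (auto simp: sobolev_derivs_def)
  have U: "open (UNIV :: real set)" "is_interval (UNIV :: real set)" by auto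
  have i: "i < n" using Suc by simp
  \<comment> \<open>Below the top order, equality almost everywhere is equality, by continuity. Then
    the next functions are almost everywhere derivatives of one and the same function.\<close>
  have "W i x = W' i x" for x
    by (rule continuous_AE_eq[OF ac_derivs_continuous[OF U acW(1) i] ac_derivs_continuous[OF U
        acW(2) i]]) (use Suc in simp)
  then have eq: "W i = W' i" by auto
  show ?case
    using ac_derivs_has_derivative(2)[OF U acW(1) i] ac_derivs_has_derivative(2)[OF U acW(2) i]
  proof eventually_elim
    case (elim x)
    then show ?case using DERIV_unique eq by auto
  qed
qed

lemma weight_powr: "(1 + \<bar>y\<bar>) powr real (s + 1) = (1 + \<bar>y\<bar>) ^ (s + 1)"
  by (rule powr_realpow) auto

text \<open>It is the product with the weight that is known to be integrable, so its Borel
  representative is taken and divided by the weight, which never vanishes.\<close>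

lemma weighted_borel_rep:
  assumes int: "integrable lebesgue (\<lambda>y. (1 + \<bar>y\<bar>) powr real (s + 1) * V y)"
    and N: "(LINT y|lebesgue. (1 + \<bar>y\<bar>) powr real (s + 1) * \<bar>V y\<bar>) \<le> N"
  obtains v where "weighted s N v" "AE y in lborel. V y = v y"
proof -
  let ?e = "\<lambda>y::real. (1 + \<bar>y\<bar>) ^ (s + 1)"
  have e: "0 < ?e y" for y by simp
  obtain g where g: "g \<in> borel_measurable borel" "AE y in lborel. ?e y * V y = g y" "integrable
      lborel g"
    using integrable_lebesgue_borel[OF int[unfolded weight_powr]] .
  define v where "v y = g y / ?e y" for y
  have vm: "v \<in> borel_measurable borel" unfolding v_def using g(1) by measurable
  have gv: "g y = ?e y * v y" for y using e[of y] by (simp add: v_def)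
  have ae: "AE y in lborel. V y = v y" using g(2)
  proof eventually_elim
    case (elim y) then show ?case using e[of y] by (simp add: v_def field_simps)
  qed
  have "(\<integral>\<^sup>+y. ennreal (?e y * \<bar>v y\<bar>) \<partial>lborel) = (\<integral>\<^sup>+y. ennreal \<bar>g y\<bar> \<partial>lborel)"
    by (intro nn_integral_cong) (simp only: gv abs_mult abs_of_pos[OF e])
  also have "\<dots> = ennreal (\<integral>y. \<bar>g y\<bar> \<partial>lborel)" using g(3) by (intro nn_integral_eq_integral) auto
  also have "(\<integral>y. \<bar>g y\<bar> \<partial>lborel) = (LINT y|lebesgue. (1 + \<bar>y\<bar>) powr real (s + 1) * \<bar>V y\<bar>)"
  proof (rule integral_lebesgue_eq_lborel[symmetric])
    show "AE y in lborel. (1 + \<bar>y\<bar>) powr real (s + 1) * \<bar>V y\<bar> = \<bar>g y\<bar>" using g(2)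
    proof eventually_elim
      case (elim y)
      have "\<bar>g y\<bar> = \<bar>?e y * V y\<bar>" using elim by simp
      also have "\<dots> = ?e y * \<bar>V y\<bar>" by (simp only: abs_mult abs_of_pos[OF e])
      finally show ?case by (simp only: weight_powr)
    qed
  qed (use g(1) in measurable)
  finally have "(\<integral>\<^sup>+y. ennreal (?e y * \<bar>v y\<bar>) \<partial>lborel) \<le> ennreal N" using N by (simp add:
      ennreal_leI)
  moreover have "0 \<le> (LINT y|lebesgue. (1 + \<bar>y\<bar>) powr real (s + 1) * \<bar>V y\<bar>)" by simp
  then have "0 \<le> N" using N by linarith
  ultimately have "weighted s N v" using vm by (simp add: weighted_def)
  then show ?thesis using ae that by blast
qed

lemma weighted_weighted:
  assumes "V \<in> weighted_L1 (real (s + 1))"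
  obtains w where "potential s 0 (norm_L1 (real (s + 1)) V) w" "AE y in lborel. V y = w 0 y"
proof -
  obtain v where v: "weighted s (norm_L1 (real (s + 1)) V) v" "AE y in lborel. V y = v y"
    using weighted_borel_rep[of s V "norm_L1 (real (s + 1)) V"] assms by (auto simp: weighted_L1_def
        norm_L1_def)
  then show ?thesis by (intro that[of "\<lambda>_. v"]) (auto simp: potential_def)
qed

lemma potential_weighted:
  assumes V: "V \<in> weighted_W1 m (real (s + 1))"
  obtains w where "potential s m (norm_W1 m (real (s + 1)) V) w" "AE y in lborel. V y = w 0 y"
proof -
  let ?I = "\<lambda>W i. integrable lebesgue (\<lambda>y. (1 + \<bar>y\<bar>) powr real (s + 1) * W i y)"
  let ?J = "\<lambda>W i. LINT y|lebesgue. (1 + \<bar>y\<bar>) powr real (s + 1) * \<bar>W i y\<bar>"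
  obtain W' where W': "sobolev_derivs m V W'" "\<And>i. i \<le> m \<Longrightarrow> ?I W' i" using V by (auto simp:
      weighted_W1_def)
  define W where "W = (SOME W. sobolev_derivs m V W)"
  have W: "sobolev_derivs m V W" unfolding W_def using someI[of "sobolev_derivs m V"] W'(1) by simp
  have acW: "ac_derivs UNIV m W" using W by (simp add: sobolev_derivs_def)
  define N where "N = norm_W1 m (real (s + 1)) V"
  have N: "N = (\<Sum>i\<le>m. ?J W i)" by (simp add: N_def norm_W1_def W_def)
  have I: "?I W i" if "i \<le> m" for i
    by (rule integrable_lebesgue_cong_AE[OF W'(2)[OF that]])
       (use sobolev_derivs_unique[OF W'(1) W that] in \<open>auto elim: eventually_mono\<close>)
  have J: "?J W i \<le> N" if "i \<le> m" for i
    unfolding N using that by (intro member_le_sum) auto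
  have "\<exists>v. weighted s N v \<and> (AE y in lborel. W i y = v y)" if "i \<le> m" for i
    using weighted_borel_rep[OF I[OF that] J[OF that]] by blast
  then obtain v where v: "\<And>i. i \<le> m \<Longrightarrow> weighted s N (v i)" "\<And>i. i \<le> m \<Longrightarrow> AE y in lborel. W i y = v i
      y" by metis
  \<comment> \<open>Below the top order the derivatives are continuous, hence Borel, and are kept
    exactly, since absolute continuity is a statement about every point. At the top order only the
    class modulo null sets matters, and a Borel representative is taken.\<close>
  define w where "w i = (if i < m then W i else v i)" for i
  have wW: "AE y in lborel. W i y = w i y" if "i \<le> m" for i using v(2)[OF that] by (simp add: w_def)
  have U: "open (UNIV :: real set)" "is_interval (UNIV :: real set)" by auto
  have wm: "w i \<in> borel_measurable borel" if "i \<le> m" for i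
  proof (cases "i < m")
    case True
    then show ?thesis using ac_derivs_continuous[OF U acW True] by (simp add: w_def
        borel_measurable_continuous_onI)
  next
    case False
    then show ?thesis using v(1)[OF that] by (simp add: w_def weighted_measurable)
  qed
  have wL: "weighted s N (w i)" if i: "i \<le> m" for i
  proof -
    have "AE y in lborel. w i y = v i y" using wW[OF i] v(2)[OF i] by eventually_elim simp
    then have "(\<integral>\<^sup>+t. ennreal ((1 + \<bar>t\<bar>) ^ (s + 1) * \<bar>w i t\<bar>) \<partial>lborel) = (\<integral>\<^sup>+t. ennreal ((1 + \<bar>t\<bar>) ^
        (s + 1) * \<bar>v i t\<bar>) \<partial>lborel)"
      by (intro nn_integral_cong_AE) (auto elim: eventually_mono)
    then show ?thesis using v(1)[OF i] wm[OF i] by (simp add: weighted_def)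
  qed
  have ac: "ac_pair (w i) (w (Suc i))" if i: "i < m" for i
    unfolding ac_pair_def
  proof (intro allI impI)
    fix a b :: real assume ab: "a \<le> b"
    have wi: "w i = W i" using i by (simp add: w_def)
    have [measurable]: "w (Suc i) \<in> borel_measurable borel" using wm i by simp
    have "w i b - w i a = (LINT t:{a..b}|lebesgue. W (Suc i) t)"
      unfolding wi by (rule ac_derivsD(2)[OF acW i _ _ ab]) auto
    also have "\<dots> = (LINT t:{a..b}|lborel. w (Suc i) t)"
      unfolding set_lebesgue_integral_def
    proof (rule integral_lebesgue_eq_lborel)
      show "AE t in lborel. indicator {a..b} t *\<^sub>R W (Suc i) t = indicator {a..b} t *\<^sub>R w (Suc i) t"
        using wW[of "Suc i"] i by (auto elim: eventually_mono)
    qed measurable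
    finally show "w i b - w i a = (LINT t:{a..b}|lborel. w (Suc i) t)" .
  qed
  have "AE y in lborel. W 0 y = V y" using W AE_completion_iff by (auto simp: sobolev_derivs_def)
  moreover have "AE y in lborel. W 0 y = w 0 y" using wW[of 0] by simp
  ultimately have "AE y in lborel. V y = w 0 y" by eventually_elim auto
  then show ?thesis using that[of w] wL ac by (simp add: potential_def N_def)
qed

lemma integral_lborel_reflect: "(\<integral>t. f (- t) \<partial>lborel) = (\<integral>t. f t \<partial>lborel)" for f :: "real \<Rightarrow> real"
  using lborel_integral_real_affine[of "-1" f 0] by simp

text \<open>The sign is that of the chain rule, so that the reflected functions form a chain of
  derivatives again; the weight is even and the bound \<open>N\<close> is unchanged.\<close>

lemma potential_reflect:
  assumes "potential s m N w"
  shows "potential s m N (\<lambda>i t. (- 1) ^ i * w i (- t))"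
  unfolding potential_def
proof (intro conjI allI impI)
  fix i assume "i \<le> m"
  then have w: "weighted s N (w i)" using assms by (simp add: potential_def)
  have [measurable]: "w i \<in> borel_measurable borel" using w by (rule weighted_measurable)
  have "(\<integral>\<^sup>+t. ennreal ((1 + \<bar>t\<bar>) ^ (s + 1) * \<bar>(- 1) ^ i * w i (- t)\<bar>) \<partial>lborel) = (\<integral>\<^sup>+t. ennreal ((1
      + \<bar>t\<bar>) ^ (s + 1) * \<bar>w i t\<bar>) \<partial>lborel)"
    using nn_integral_real_affine[of "\<lambda>t. ennreal ((1 + \<bar>t\<bar>) ^ (s + 1) * \<bar>w i t\<bar>)" "-1" 0]
    by (simp add: abs_mult power_abs)
  then show "weighted s N (\<lambda>t. (- 1) ^ i * w i (- t))" using w by (simp add: weighted_def)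
next
  fix i assume "i < m"
  then have w: "ac_pair (w i) (w (Suc i))" using assms by (simp add: potential_def)
  show "ac_pair (\<lambda>t. (- 1) ^ i * w i (- t)) (\<lambda>t. (- 1) ^ Suc i * w (Suc i) (- t))"
    unfolding ac_pair_def
  proof (intro allI impI)
    fix a b :: real assume ab: "a \<le> b"
    then have "w i (- a) - w i (- b) = (LINT t:{-b..-a}|lborel. w (Suc i) t)" using w by (simp add:
        ac_pair_def)
    also have "\<dots> = (LINT t:{a..b}|lborel. w (Suc i) (- t))"
      unfolding set_lebesgue_integral_def
      by (subst integral_lborel_reflect[symmetric]) (auto simp: indicator_def intro!:
          Bochner_Integration.integral_cong)
    finally have "(- 1) ^ Suc i * (w i (- a) - w i (- b)) = (LINT t:{a..b}|lborel. (- 1) ^ Suc i * w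
        (Suc i) (- t))"
      by (simp only: set_integral_mult_right)
    then show "(- 1) ^ i * w i (- b) - (- 1) ^ i * w i (- a) = (LINT t:{a..b}|lborel. (- 1) ^ Suc i
        * w (Suc i) (- t))"
      by (simp add: algebra_simps)
  qed
qed

section \<open>Iterated pointwise derivatives\<close>

lemma AE_affine:
  assumes "AE u in lborel. Q u" "c \<noteq> 0"
  shows "AE y in lborel. Q (t + c * y :: real)"
proof -
  obtain N where N: "N \<in> null_sets lborel" "{u \<in> space lborel. \<not> Q u} \<subseteq> N"
    using assms(1) by (auto simp: eventually_ae_filter)
  have [measurable]: "N \<in> sets borel" using N(1) by auto
  have "AE y in lborel. t + c * y \<notin> N"
    by (rule AE_borel_affine[OF assms(2)]) (use AE_not_in[OF N(1)] in auto)
  then show ?thesis using N(2) by (auto elim!: eventually_mono)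
qed

lemma ac_pair_derivative_AE:
  assumes ac: "ac_pair A a" and a: "integrable lborel a"
  shows "AE u in lborel. (A has_real_derivative a u) (at u)"
proof -
  have "AE u in lebesgue. u \<in> UNIV \<longrightarrow> (A has_real_derivative a u) (at u)"
  proof (rule ac_has_derivative_AE)
    fix p q :: real assume pq: "p \<le> q"
    have "set_integrable lborel {p..q} a" unfolding set_integrable_def
      by (rule integrable_mult_indicator) (use a in auto)
    from set_integral_lborel_lebesgue[OF this] ac pq
    show "set_integrable lebesgue {p..q} a \<and> A q - A p = (LINT t:{p..q}|lebesgue. a t)" by (simp
        add: ac_pair_def)
  qed auto
  then show ?thesis by (simp add: AE_completion_iff)
qed

lemma higher_deriv_zero:
  fixes f :: "real \<Rightarrow> real"
  assumes S: "open S" and f: "\<And>y. y \<in> S \<Longrightarrow> f y = 0"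
  shows "y \<in> S \<Longrightarrow> (deriv ^^ i) f y = 0"
proof (induction i arbitrary: y)
  case (Suc i)
  have "((deriv ^^ i) f has_real_derivative 0) (at y)"
    by (rule has_field_derivative_transform_within_open[OF DERIV_const[of 0] S Suc.prems]) (simp
        add: Suc.IH)
  then show ?case by (simp add: DERIV_imp_deriv)
qed (use f in simp)

context
  fixes S :: "real set" and F :: "nat \<Rightarrow> real \<Rightarrow> real" and n :: nat and f :: "real \<Rightarrow> real"
  assumes S: "open S" "is_interval S" and F: "ac_derivs S n F" and f: "\<And>y. y \<in> S \<Longrightarrow> f y = F 0 y"
begin

lemma higher_deriv_ac: "i < n \<Longrightarrow> y \<in> S \<Longrightarrow> (deriv ^^ i) f y = F i y"
proof (induction i arbitrary: y)
  case (Suc i)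
  have "(F i has_real_derivative F (Suc i) y) (at y)" by (rule ac_derivs_has_derivative(1)[OF S F
      Suc.prems])
  then have "((deriv ^^ i) f has_real_derivative F (Suc i) y) (at y)"
    by (rule has_field_derivative_transform_within_open[OF _ S(1) Suc.prems(2)]) (use Suc in simp)
  then show ?case by (simp add: DERIV_imp_deriv)
qed (use f in simp)

lemma higher_deriv_ac_AE:
  assumes "i < n"
  shows "AE y in lebesgue. y \<in> S \<longrightarrow> (deriv ^^ Suc i) f y = F (Suc i) y \<and> (deriv ^^ i) f
      differentiable (at y)"
  using ac_derivs_has_derivative(2)[OF S F assms]
proof eventually_elim
  case (elim y)
  show ?case
  proof
    assume y: "y \<in> S"
    with elim have "(F i has_real_derivative F (Suc i) y) (at y)" by simp
    then have "((deriv ^^ i) f has_real_derivative F (Suc i) y) (at y)"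
      by (rule has_field_derivative_transform_within_open[OF _ S(1) y]) (use higher_deriv_ac[OF
          assms] in simp)
    then show "(deriv ^^ Suc i) f y = F (Suc i) y \<and> (deriv ^^ i) f differentiable (at y)"
      by (auto simp: DERIV_imp_deriv real_differentiable_def)
  qed
qed

text \<open>Below order \<open>n\<close> the pointwise derivatives coincide with \<open>F\<close> on
  \<open>S\<close>. At order \<open>n\<close> they do so only almost everywhere, which integrals do
  not see.\<close>

lemma ac_derivs_higher_deriv: "ac_derivs S n (\<lambda>i. (deriv ^^ i) f)"
  unfolding ac_derivs_def
proof (intro allI impI ballI)
  fix i a b assume i: "i < n" and a: "a \<in> S" and b: "b \<in> S" and ab: "(a::real) \<le> b"
  have sub: "{a..b} \<subseteq> S" using a b S(2) by (meson atLeastAtMost_iff mem_is_interval_1_I subsetI)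
  note D = ac_derivsD[OF F i a b ab]
  have ae: "AE t in lebesgue. indicator {a..b} t *\<^sub>R F (Suc i) t = indicator {a..b} t *\<^sub>R (deriv ^^
      Suc i) f t"
    using higher_deriv_ac_AE[OF i]
  proof eventually_elim
    case (elim t)
    then show ?case using sub by (cases "t \<in> {a..b}") auto
  qed
  have "set_integrable lebesgue {a..b} ((deriv ^^ Suc i) f)"
    using integrable_lebesgue_cong_AE[OF D(1)[unfolded set_integrable_def] ae] by (simp only:
        set_integrable_def)
  moreover have "(deriv ^^ i) f b - (deriv ^^ i) f a = (LINT t:{a..b}|lebesgue. (deriv ^^ Suc i) f
      t)"
    using D(2) integral_lebesgue_cong_AE[OF ae] higher_deriv_ac[OF i] a b by (simp only:
        set_lebesgue_integral_def)
  ultimately show "set_integrable lebesgue {a..b} ((deriv ^^ Suc i) f) \<and>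
      (deriv ^^ i) f b - (deriv ^^ i) f a = (LINT t:{a..b}|lebesgue. (deriv ^^ Suc i) f t)" by blast
qed

end

text \<open>\<open>\<bar>y\<bar> ^ s \<le> (1 + \<bar>y\<bar>) ^ s\<close> leads from
  \<open>nn_moment\<close> to \<open>moment_le\<close>. The Borel function \<open>h'\<close>
  supplies the measurability, which the pointwise derivative \<open>h\<close> inherits through
  completeness of \<open>lebesgue\<close>.\<close>

lemma moment_leI:
  assumes ae: "AE y in lebesgue. h y = h' y" and [measurable]: "h' \<in> borel_measurable borel"
    and le: "nn_moment s h' \<le> ennreal C" and C: "0 \<le> C"
  shows "moment_le s h C"
proof -
  let ?g = "\<lambda>y. \<bar>y\<bar> ^ s * h' y"
  have le': "(\<integral>\<^sup>+y. ennreal \<bar>?g y\<bar> \<partial>lborel) \<le> ennreal C"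
  proof -
    have "(\<integral>\<^sup>+y. ennreal \<bar>?g y\<bar> \<partial>lborel) \<le> nn_moment s h'" unfolding nn_moment_def
      by (intro nn_integral_mono ennreal_leI) (auto simp: abs_mult power_abs intro!: mult_right_mono
          power_mono)
    with le show ?thesis by (rule order_trans[rotated])
  qed
  have i: "integrable lborel ?g"
  proof (rule integrableI_bounded)
    show "(\<integral>\<^sup>+y. ennreal (norm (?g y)) \<partial>lborel) < \<infinity>" using le' by (simp add: order_le_less_trans)
  qed measurable
  have i': "integrable lebesgue ?g" using i integrable_completion[of ?g lborel] by simp
  have "integrable lebesgue (\<lambda>y. \<bar>y\<bar> ^ s * h y)"
    by (rule integrable_lebesgue_cong_AE[OF i']) (use ae in \<open>auto elim: eventually_mono\<close>)
  moreover have "(LINT y|lebesgue. \<bar>y\<bar> ^ s * \<bar>h y\<bar>) = (LINT y|lborel. \<bar>?g y\<bar>)"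
  proof (rule integral_lebesgue_eq_lborel)
    have "AE y in lborel. h y = h' y" using ae by (simp add: AE_completion_iff)
    then show "AE y in lborel. \<bar>y\<bar> ^ s * \<bar>h y\<bar> = \<bar>?g y\<bar>" by eventually_elim (simp add: abs_mult
        power_abs)
  qed measurable
  moreover have "(LINT y|lborel. \<bar>?g y\<bar>) \<le> C"
  proof -
    have "ennreal (LINT y|lborel. \<bar>?g y\<bar>) = (\<integral>\<^sup>+y. ennreal \<bar>?g y\<bar> \<partial>lborel)"
      using i by (intro nn_integral_eq_integral[symmetric]) auto
    with le' have "ennreal (LINT y|lborel. \<bar>?g y\<bar>) \<le> ennreal C" by simp
    then show ?thesis using C by (simp add: ennreal_le_iff)
  qed
  ultimately show ?thesis by (simp add: moment_le_def)
qed

text \<open>An explicit chain of derivatives that replaces the total operator \<open>deriv\<close>.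
  The top function is zero off \<open>S\<close>, as are the pointwise derivatives of
  \<open>B\<close> there, so that the two can be compared on the whole line. \<open>C\<close> is the
  moment bound as a function of \<open>x\<close>.\<close>

definition dy_witness :: "real set \<Rightarrow> nat \<Rightarrow> nat \<Rightarrow> (real \<Rightarrow> real) \<Rightarrow> (real \<Rightarrow> real \<Rightarrow> real) \<Rightarrow> (nat \<Rightarrow> real
    \<Rightarrow> real \<Rightarrow> real) \<Rightarrow> bool" where
  "dy_witness S n s C B F \<longleftrightarrow> (\<forall>x. \<forall>y\<in>S. F 0 x y = B x y) \<and> (\<forall>x. ac_derivs S n (\<lambda>i. F i x)) \<and>
     (\<forall>x y. y \<notin> S \<longrightarrow> F n x y = 0) \<and> (\<forall>x. F n x \<in> borel_measurable borel \<and> 0 \<le> C x \<and> nn_moment s (F n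
         x) \<le> ennreal (C x))"

text \<open>
  Absolute continuity in \<open>x\<close> for every \<open>y\<close> yields differentiability only for
  almost every \<open>x\<close>, whence the separate condition on almost every \<open>y\<close>.
\<close>
definition dx_witness :: "real set \<Rightarrow> nat \<Rightarrow> nat \<Rightarrow> (real \<Rightarrow> real) \<Rightarrow> (real \<Rightarrow> real \<Rightarrow> real) \<Rightarrow> (nat \<Rightarrow> real
    \<Rightarrow> real \<Rightarrow> real) \<Rightarrow> bool" where
  "dx_witness S n s C B F \<longleftrightarrow> (\<forall>x. \<forall>y\<in>S. F 0 x y = B x y) \<and> (\<forall>y\<in>S. ac_derivs UNIV n (\<lambda>i x. F i x y)) \<and>
     (\<forall>x. AE y in lebesgue. y \<in> S \<longrightarrow> ((\<lambda>x'. F (n - 1) x' y) has_real_derivative F n x y) (at x)) \<and>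
     (\<forall>x y. y \<notin> S \<longrightarrow> F n x y = 0) \<and> (\<forall>x. F n x \<in> borel_measurable borel \<and> 0 \<le> C x \<and> nn_moment s (F n
         x) \<le> ennreal (C x))"

lemma AE_lebesgue_neq: "AE y in lebesgue. y \<noteq> (c::real)"
  by (rule AE_completion[OF AE_lborel_singleton])

text \<open>Off \<open>S\<close> and away from \<open>0\<close> the function \<open>B x\<close>
  vanishes on an open half-line, and so do its pointwise derivatives. The point \<open>0\<close>,
  where \<open>B x\<close> may jump, is a null set.\<close>

lemma dy_witness_imp:
  assumes S: "S = {0<..} \<or> S = {..<0}" and n: "1 \<le> n" and W: "dy_witness S n s C B F"
    and B: "\<And>x y. y \<notin> S \<Longrightarrow> y \<noteq> 0 \<Longrightarrow> B x y = 0"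
  shows "has_dy S n B" "moment_le s (dy n B x) (C x)"
proof -
  have Sp: "open S" "is_interval S" using S by auto
  have ac: "ac_derivs S n (\<lambda>i. F i x)" and F0: "\<And>y. y \<in> S \<Longrightarrow> B x y = F 0 x y" for x
    using W by (auto simp: dy_witness_def)
  have n': "n - 1 < n" "Suc (n - 1) = n" using n by auto
  have H: "AE y in lebesgue. y \<in> S \<longrightarrow> (deriv ^^ n) (B x) y = F n x y \<and> (deriv ^^ (n - 1)) (B x)
      differentiable (at y)" for x
    by (rule higher_deriv_ac_AE[OF Sp ac F0 n'(1), unfolded n'(2)])
  show "has_dy S n B" unfolding has_dy_def
  proof (intro conjI allI)
    fix x
    show "ac_derivs S n (\<lambda>i y. dy i B x y)" using ac_derivs_higher_deriv[OF Sp ac F0] by (simp add: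
        dy_def)
    show "AE y in lebesgue. y \<in> S \<longrightarrow> (\<lambda>y'. dy (n - 1) B x y') differentiable (at y)"
      using H[of x] by eventually_elim (simp add: dy_def)
  qed
  have "AE y in lebesgue. dy n B x y = F n x y"
    using H[of x] AE_lebesgue_neq[of 0]
  proof eventually_elim
    case (elim y)
    show ?case
    proof (cases "y \<in> S")
      case True
      then show ?thesis using elim by (simp add: dy_def)
    next
      case False
      have o: "open {z. z \<notin> S \<and> z \<noteq> 0}"
      proof -
        have "{z. z \<notin> S \<and> z \<noteq> 0} = {..<0} \<or> {z. z \<notin> S \<and> z \<noteq> 0} = {0<..}" using S by auto
        then show ?thesis by (metis open_greaterThan open_lessThan)
      qed
      have "(deriv ^^ n) (B x) y = 0" by (rule higher_deriv_zero[OF o]) (use B False elim in auto)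
      then show ?thesis using W False by (simp add: dy_def dy_witness_def)
    qed
  qed
  then show "moment_le s (dy n B x) (C x)" by (rule moment_leI) (use W in \<open>auto simp:
      dy_witness_def\<close>)
qed

lemma dx_witness_imp:
  assumes S: "S = {0<..} \<or> S = {..<0}" and n: "1 \<le> n" and W: "dx_witness S n s C B F"
    and B: "\<And>x y. y \<notin> S \<Longrightarrow> y \<noteq> 0 \<Longrightarrow> B x y = 0"
  shows "has_dx S n B" "moment_le s (dx n B x) (C x)"
proof -
  have U: "open (UNIV :: real set)" "is_interval (UNIV :: real set)" by auto
  have ac: "y \<in> S \<Longrightarrow> ac_derivs UNIV n (\<lambda>i x. F i x y)" and F0: "y \<in> S \<Longrightarrow> B x y = F 0 x y" for x y
    using W by (auto simp: dx_witness_def)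
  have n': "n - 1 < n" "Suc (n - 1) = n" using n by auto
  have eq: "(\<lambda>x. dx (n - 1) B x y) = (\<lambda>x. F (n - 1) x y)" if "y \<in> S" for y
    using higher_deriv_ac[OF U ac[OF that], of "\<lambda>x. B x y" "n - 1"] n' F0 that by (auto simp:
        dx_def)
  have D: "AE y in lebesgue. y \<in> S \<longrightarrow> ((\<lambda>x'. dx (n - 1) B x' y) has_real_derivative F n x y) (at x)"
      for x
  proof -
    have "AE y in lebesgue. y \<in> S \<longrightarrow> ((\<lambda>x'. F (n - 1) x' y) has_real_derivative F n x y) (at x)"
      using W by (auto simp: dx_witness_def)
    then show ?thesis by eventually_elim (use eq in simp)
  qed
  show "has_dx S n B" unfolding has_dx_def
  proof (intro conjI allI ballI)
    fix y assume y: "y \<in> S"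
    show "ac_derivs UNIV n (\<lambda>i x. dx i B x y)"
      using ac_derivs_higher_deriv[OF U ac[OF y], of "\<lambda>x. B x y"] F0 y by (simp add: dx_def)
  next
    fix x
    show "AE y in lebesgue. y \<in> S \<longrightarrow> (\<lambda>x'. dx (n - 1) B x' y) differentiable (at x)"
      using D[of x] by eventually_elim (auto simp: real_differentiable_def)
  qed
  have "AE y in lebesgue. dx n B x y = F n x y"
    using D[of x] AE_lebesgue_neq[of 0]
  proof eventually_elim
    case (elim y)
    show ?case
    proof (cases "y \<in> S")
      case True
      have "dx n B x y = (deriv ^^ Suc (n - 1)) (\<lambda>x'. B x' y) x" unfolding n'(2) dx_def ..
      also have "\<dots> = deriv (\<lambda>x'. dx (n - 1) B x' y) x" by (simp add: dx_def)
      also have "\<dots> = F n x y" using elim True by (simp add: DERIV_imp_deriv)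
      finally show ?thesis .
    next
      case False
      have "(deriv ^^ n) (\<lambda>x'. B x' y) x = 0" by (rule higher_deriv_zero[OF open_UNIV]) (use B False
          elim in auto)
      then show ?thesis using W False by (simp add: dx_def dx_witness_def)
    qed
  qed
  then show "moment_le s (dx n B x) (C x)" by (rule moment_leI) (use W in \<open>auto simp:
      dx_witness_def\<close>)
qed

section \<open>Reflection of the derivative witnesses\<close>

lemma ac_derivs_reflect:
  assumes F: "ac_derivs S n F"
  shows "ac_derivs (uminus ` S) n (\<lambda>i y. (- 1) ^ i * F i (- y :: real) :: real)"
  unfolding ac_derivs_def
proof (intro allI impI ballI)
  fix i a b assume i: "i < n" and a: "a \<in> uminus ` S" and b: "b \<in> uminus ` S" and ab: "a \<le>
      (b::real)"
  have ab': "- b \<in> S" "- a \<in> S" "- b \<le> - a" using a b ab by auto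
  note D = ac_derivsD[OF F i ab']
  have ind: "indicator {- b..- a} (- t) = (indicator {a..b} t :: real)" for t by (auto simp:
      indicator_def)
  have "integrable lebesgue (\<lambda>t. indicator {a..b} t *\<^sub>R F (Suc i) (- t))"
    using integrable_lebesgue_uminus[OF D(1)[unfolded set_integrable_def]] by (simp add: ind)
  then have s: "set_integrable lebesgue {a..b} (\<lambda>t. F (Suc i) (- t))" by (simp add:
      set_integrable_def)
  have "(LINT t:{-b..-a}|lebesgue. F (Suc i) t) = (LINT t:{a..b}|lebesgue. F (Suc i) (- t))"
    unfolding set_lebesgue_integral_def by (subst integral_lebesgue_uminus[symmetric]) (simp add:
        ind)
  with D(2) have "(- 1) ^ Suc i * (F i (- a) - F i (- b)) = (LINT t:{a..b}|lebesgue. (- 1) ^ Suc i *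
      F (Suc i) (- t))"
    by (simp only: set_integral_mult_right)
  then have e: "(- 1) ^ i * F i (- b) - (- 1) ^ i * F i (- a) = (LINT t:{a..b}|lebesgue. (- 1) ^ Suc
      i * F (Suc i) (- t))"
    by (simp add: algebra_simps)
  have "set_integrable lebesgue {a..b} (\<lambda>t. (- 1) ^ Suc i * F (Suc i) (- t))"
    by (rule set_integrable_mult_right) (rule s)
  with e show "set_integrable lebesgue {a..b} (\<lambda>t. (- 1) ^ Suc i * F (Suc i) (- t)) \<and>
     (- 1) ^ i * F i (- b) - (- 1) ^ i * F i (- a) = (LINT t:{a..b}|lebesgue. (- 1) ^ Suc i * F (Suc
         i) (- t))" by blast
qed

lemma measurable_reflect: "h \<in> borel_measurable borel \<Longrightarrow> (\<lambda>y::real. (- 1) ^ i * h (- y) :: real) \<in>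
    borel_measurable borel"
proof -
  assume [measurable]: "h \<in> borel_measurable borel"
  show ?thesis by measurable
qed

lemma nn_moment_reflect:
  assumes [measurable]: "h \<in> borel_measurable borel"
  shows "nn_moment s (\<lambda>y. (- 1) ^ i * h (- y)) = nn_moment s h"
  using nn_integral_real_affine[of "\<lambda>y. ennreal ((1 + \<bar>y\<bar>) ^ s * \<bar>h y\<bar>)" "-1" 0]
  by (simp add: nn_moment_def abs_mult power_abs)

lemma dy_witness_reflect:
  assumes "dy_witness {0<..} n s C (\<lambda>x y. B (- x) (- y)) F"
  shows "dy_witness {..<0} n s (\<lambda>x. C (- x)) B (\<lambda>i x y. (- 1) ^ i * F i (- x) (- y))"
proof -
  have S: "uminus ` {0<..} = {..<0::real}" by (auto intro: image_eqI[of _ _ "- _"])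
  have "ac_derivs {..<0} n (\<lambda>i y. (- 1) ^ i * F i x (- y))" for x
    using ac_derivs_reflect[of "{0<..}" n "\<lambda>i. F i x"] assms unfolding S dy_witness_def by blast
  then show ?thesis using assms by (auto simp: dy_witness_def nn_moment_reflect measurable_reflect)
qed

lemma dx_witness_reflect:
  assumes W: "dx_witness {0<..} n s C (\<lambda>x y. B (- x) (- y)) F" and n: "1 \<le> n"
  shows "dx_witness {..<0} n s (\<lambda>x. C (- x)) B (\<lambda>i x y. (- 1) ^ i * F i (- x) (- y))"
proof -
  have U: "uminus ` UNIV = (UNIV :: real set)" by (metis surj_uminus)
  have ac: "ac_derivs UNIV n (\<lambda>i x. (- 1) ^ i * F i (- x) y)" if "0 < y" for y
    using ac_derivs_reflect[of UNIV n "\<lambda>i x. F i x y"] W that unfolding U dx_witness_def by simp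
  have AE: "AE y in lebesgue. y \<in> {..<0} \<longrightarrow> ((\<lambda>x'. (- 1) ^ (n - 1) * F (n - 1) (- x') (- y))
      has_real_derivative (- 1) ^ n * F n (- x) (- y)) (at x)" for x
  proof -
    have "AE y in lborel. y \<in> {0<..} \<longrightarrow> ((\<lambda>x'. F (n - 1) x' y) has_real_derivative F n (- x) y) (at
        (- x))"
      using W unfolding dx_witness_def AE_completion_iff by blast
    from AE_affine[OF this, of "-1" 0]
    have "AE y in lborel. - y \<in> {0<..} \<longrightarrow> ((\<lambda>x'. F (n - 1) x' (- y)) has_real_derivative F n (- x) (-
        y)) (at (- x))" by simp
    then have "AE y in lborel. y \<in> {..<0} \<longrightarrow> ((\<lambda>x'. (- 1) ^ (n - 1) * F (n - 1) (- x') (- y))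
        has_real_derivative (- 1) ^ n * F n (- x) (- y)) (at x)"
    proof eventually_elim
      case (elim y)
      show ?case
      proof
        assume "y \<in> {..<0}"
        with elim have "((\<lambda>x'. F (n - 1) x' (- y)) has_real_derivative F n (- x) (- y)) (at (- x))"
            by simp
        then have "((\<lambda>x'. F (n - 1) (- x') (- y)) has_real_derivative - F n (- x) (- y)) (at x)" by
            (simp only: DERIV_mirror)
        then have "((\<lambda>x'. (- 1) ^ (n - 1) * F (n - 1) (- x') (- y)) has_real_derivative (- 1) ^ (n -
            1) * - F n (- x) (- y)) (at x)"
          by (rule DERIV_cmult)
        moreover have "(- 1 :: real) ^ n = - ((- 1) ^ (n - 1))" using n by (cases n) auto
        ultimately show "((\<lambda>x'. (- 1) ^ (n - 1) * F (n - 1) (- x') (- y)) has_real_derivative (- 1)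
            ^ n * F n (- x) (- y)) (at x)" by simp
      qed
    qed
    then show ?thesis by (rule AE_completion)
  qed
  show ?thesis using W AE ac by (auto simp: dx_witness_def nn_moment_reflect measurable_reflect)
qed

section \<open>Derivatives of the Marchenko functions\<close>

lemma shift_integrable:
  assumes v: "integrable lborel v" shows "integrable lborel (shift v x)"
proof -
  have "integrable lborel (\<lambda>y. v (x + y))" using lborel_integrable_real_affine[OF v, of 1 x] by simp
  from integrable_mult_indicator[of "{0<..}", OF _ this] show ?thesis by (simp add:
      shift_def[abs_def])
qed

lemma shift_measurable:
  assumes [measurable]: "v \<in> borel_measurable borel"
  shows "(\<lambda>y. shift v x y) \<in> borel_measurable borel"
  unfolding shift_def by measurable

text \<open>A pure derivative of a Marchenko kernel has this shape, with an admissible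
  \<open>G\<close>. At the top order \<open>v\<close> is only integrable, so the sum as a whole is
  not admissible and the two parts are treated separately.\<close>

lemma source_set_integrable_y:
  assumes v: "integrable lborel v" and G: "admissible G"
  shows "set_integrable lborel {a..b} (\<lambda>y. - shift v x y + G x y)"
proof (rule set_integral_add(1))
  show "set_integrable lborel {a..b} (\<lambda>y. - shift v x y)" unfolding set_integrable_def
    by (rule integrable_mult_indicator) (use shift_integrable[OF v, of x] in auto)
  show "set_integrable lborel {a..b} (G x)" using admissible_section_integrable[OF G] by (simp add:
      set_integrable_def)
qed

lemma source_set_integrable_x:
  assumes v: "integrable lborel v" and G: "admissible G" and y: "0 < y"
  shows "set_integrable lborel {a..b} (\<lambda>x. - shift v x y + G x y)"
proof (rule set_integral_add(1))
  show "set_integrable lborel {a..b} (\<lambda>x. - shift v x y)"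
    using set_integrable_mult_right[of "-1", OF translate_set_integrable(1)[OF v]] y by (simp add:
        shift_def)
  have "continuous_on UNIV (\<lambda>x. G x y)" using admissible_section_continuous[OF G y, of 0] by simp
  then show "set_integrable lborel {a..b} (\<lambda>x. G x y)"
    by (intro borel_integrable_atLeastAtMost') (rule continuous_on_subset, auto)
qed

lemma ac_pair_shift_y:
  assumes ac: "ac_pair A a" and ab: "0 < p" "p \<le> q"
  shows "shift A x q - shift A x p = (LINT y:{p..q}|lborel. shift a x y)"
proof -
  have "shift A x q - shift A x p = (\<integral>t. indicator {x + p..x + q} t * a t \<partial>lborel)"
    using ac ab by (simp add: shift_def ac_pair_def set_lebesgue_integral_def)
  also have "\<dots> = (LINT y:{p..q}|lborel. shift a x y)"
    unfolding set_lebesgue_integral_def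
    by (subst lborel_integral_real_affine[where c=1 and t=x])
       (use ab in \<open>auto simp: indicator_def shift_def intro!: Bochner_Integration.integral_cong\<close>)
  finally show ?thesis .
qed

lemma ac_pair_shift_x:
  assumes ac: "ac_pair A a" and ab: "p \<le> q" and y: "0 < y"
  shows "shift A q y - shift A p y = (LINT x:{p..q}|lborel. shift a x y)"
proof -
  have "shift A q y - shift A p y = (\<integral>t. indicator {p + y..q + y} t * a t \<partial>lborel)"
    using ac ab y by (simp add: shift_def ac_pair_def set_lebesgue_integral_def)
  also have "\<dots> = (LINT x:{p..q}|lborel. shift a x y)"
    unfolding set_lebesgue_integral_def
    by (subst lborel_integral_real_affine[where c=1 and t=y])
       (use y in \<open>auto simp: indicator_def shift_def add.commute intro!:
           Bochner_Integration.integral_cong\<close>)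
  finally show ?thesis .
qed

lemma nn_moment_source:
  assumes v: "weighted s N v" and G: "smooth_kernel s s 0 K G" and K: "0 \<le> K"
  shows "(\<lambda>y. - shift v x y + G x y) \<in> borel_measurable borel"
    and "nn_moment s (\<lambda>y. - shift v x y + G x y) \<le> ennreal ((N + K) * left_weight x ^ s)"
proof -
  have [measurable]: "(\<lambda>y. shift v x y) \<in> borel_measurable borel" by (rule shift_measurable[OF
      weighted_measurable[OF v]])
  have [measurable]: "G x \<in> borel_measurable borel" by (rule admissible_section_measurable[OF
      smooth_kernel_admissible[OF G]])
  show "(\<lambda>y. - shift v x y + G x y) \<in> borel_measurable borel" by measurable
  have N: "0 \<le> N" using v by (simp add: weighted_def)
  have "nn_moment s (\<lambda>y. - shift v x y + G x y) \<le> nn_moment s (\<lambda>y. - shift v x y) + nn_moment s (G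
      x)" by (rule nn_moment_add) measurable
  also have "nn_moment s (\<lambda>y. - shift v x y) = nn_moment s (shift v x)" by (simp add: nn_moment_def)
  also have "nn_moment s (shift v x) + nn_moment s (G x) \<le> ennreal (N * left_weight x ^ s) + ennreal
      (K * left_weight x ^ s)"
    by (rule add_mono[OF nn_moment_shift[OF v] smooth_kernel_nn_moment[OF G]])
  also have "\<dots> = ennreal ((N + K) * left_weight x ^ s)" using N K by (simp add: distrib_right flip:
      ennreal_plus)
  finally show "nn_moment s (\<lambda>y. - shift v x y + G x y) \<le> ennreal ((N + K) * left_weight x ^ s)" .
qed

text \<open>The summands bound what \<open>shift\<close>, \<open>char_int\<close> and
  \<open>tail_int\<close> contribute to the derivative of order \<open>Suc m\<close>, with the
  operators applied to a kernel of constant \<open>kernel_const N m\<close>.\<close>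

definition deriv_const :: "nat \<Rightarrow> real \<Rightarrow> real" where
  "deriv_const m N = N + (3 ^ m * kernel_const N m * N + 2 ^ m * kernel_const N m * N)"

text \<open>Order \<open>Suc m\<close> from \<open>m\<close> derivatives of the potential: the part
  \<open>G 0\<close> of the first derivative is built from integral operators and is
  \<open>m\<close> times differentiable, while the free term yields \<open>shift (w j)\<close>,
  which is absolutely continuous on the open half-line for \<open>j < m\<close> and merely
  integrable for \<open>j = m\<close>.\<close>

lemma marchenko_kernel_dy_witness:
  assumes C: "marchenko_kernel (w 0) P" and w: "potential s m N w"
  shows "\<exists>F. dy_witness {0<..} (Suc m) s (\<lambda>x. deriv_const m N * left_weight x ^ s) P F"
proof -
  have N: "0 \<le> N" using potential_nonneg[OF w] .
  have CN: "0 \<le> kernel_const N m" using kernel_const_nonneg[OF N] .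
  have P: "smooth_kernel s (s + 1) m (kernel_const N m) P" by (rule
      marchenko_kernel_smooth_kernel[OF C w order_refl])
  let ?K = "3 ^ m * kernel_const N m * N + 2 ^ m * kernel_const N m * N"
  have K: "0 \<le> ?K" using N CN by simp
  have wi: "integrable lborel (w i)" if "i \<le> m" for i using w that weighted_integrable by (auto
      simp: potential_def)
  have "smooth_kernel s s m ?K (\<lambda>x y. - char_int (w 0) P x y + tail_int (w 0) P x y)"
    by (intro smooth_kernel_add smooth_kernel_uminus smooth_kernel_char_int[OF w P CN]
        smooth_kernel_tail_int[OF w P CN]) (use N CN in auto)
  from smooth_kernel_y_chain[OF this] obtain G where G': "G 0 = (\<lambda>x y. - char_int (w 0) P x y +
      tail_int (w 0) P x y) \<and> (\<forall>i\<le>m. smooth_kernel s s 0 ?K (G i)) \<and>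
    (\<forall>i<m. \<forall>x. \<forall>y>0. (G i x has_real_derivative G (Suc i) x y) (at y))" ..
  have G: "G 0 = (\<lambda>x y. - char_int (w 0) P x y + tail_int (w 0) P x y)" "\<And>i. i \<le> m \<Longrightarrow> smooth_kernel s
      s 0 ?K (G i)"
    "\<And>i x y. i < m \<Longrightarrow> 0 < y \<Longrightarrow> (G i x has_real_derivative G (Suc i) x y) (at y)"
    using G' by (simp_all del: smooth_kernel.simps)
  have Gr: "admissible (G i)" if "i \<le> m" for i using smooth_kernel_admissible[OF G(2)[OF that]] .
  \<comment> \<open>The index is shifted by one: the derivative of order \<open>Suc j\<close> of
    \<open>P\<close> consists of the j-th derivatives of the free term and of
    \<open>G 0\<close>.\<close>
  define F where "F = case_nat P (\<lambda>j x y. - shift (w j) x y + G j x y)"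
  have FS: "F (Suc j) = (\<lambda>x y. - shift (w j) x y + G j x y)" for j by (simp add: F_def)
  have "ac_derivs {0<..} (Suc m) (\<lambda>i. F i x)" for x
    unfolding ac_derivs_def
  proof (intro allI impI ballI)
    fix i a b assume i: "i < Suc m" and "a \<in> {0<..}" "b \<in> {0<..}" and ab: "(a::real) \<le> b"
    then have a: "0 < a" by simp
    have i': "i \<le> m" using i by simp
    have int: "set_integrable lborel {a..b} (F (Suc i) x)"
      unfolding FS by (rule source_set_integrable_y[OF wi[OF i'] Gr[OF i']])
    have "F i x b - F i x a = (LINT t:{a..b}|lborel. F (Suc i) x t)"
    proof (cases i)
      case 0
      have "P x b - P x a = (LINT y:{a..b}|lborel. - w 0 (x + y) + (tail_int (w 0) P x y - char_int
          (w 0) P x y))"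
        by (rule marchenko_kernel_y_ac[OF C wi[of 0] a ab]) simp
      also have "\<dots> = (LINT t:{a..b}|lborel. F (Suc 0) x t)"
        unfolding set_lebesgue_integral_def using a
        by (intro Bochner_Integration.integral_cong) (auto simp: FS G(1) shift_def indicator_def)
      finally show ?thesis using 0 by (simp add: F_def)
    next
      case (Suc j)
      have j: "j < m" "Suc j \<le> m" using Suc i by auto
      have FTC: "has_bochner_integral lborel (\<lambda>y. G (Suc j) x y * indicator {a..b} y) (G j x b - G j
          x a)"
        by (rule has_bochner_integral_FTC_Icc_real[OF ab])
           (use G(3)[OF j(1)] a admissible_section_continuous'[OF Gr[OF j(2)]] in \<open>auto simp:
               continuous_on_eq_continuous_at\<close>)
      have 1: "shift (w j) x b - shift (w j) x a = (LINT y:{a..b}|lborel. shift (w (Suc j)) x y)"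
        by (rule ac_pair_shift_y[OF _ a ab]) (use w j in \<open>simp add: potential_def\<close>)
      have 2: "G j x b - G j x a = (LINT y:{a..b}|lborel. G (Suc j) x y)"
        using has_bochner_integral_iff[THEN iffD1, OF FTC] by (simp add: set_lebesgue_integral_def
            mult.commute)
      have s1: "set_integrable lborel {a..b} (shift (w (Suc j)) x)" unfolding set_integrable_def
        by (rule integrable_mult_indicator) (use shift_integrable[OF wi[OF j(2)], of x] in auto)
      have s2: "set_integrable lborel {a..b} (G (Suc j) x)" using admissible_section_integrable[OF
          Gr[OF j(2)]] by (simp add: set_integrable_def)
      have "F i x b - F i x a = (G j x b - G j x a) - (shift (w j) x b - shift (w j) x a)" by (simp
          add: Suc FS)
      also have "\<dots> = (LINT y:{a..b}|lborel. G (Suc j) x y - shift (w (Suc j)) x y)"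
        unfolding 1 2 by (rule set_integral_diff(2)[symmetric, OF s2 s1])
      finally show ?thesis by (simp add: Suc FS)
    qed
    with set_integral_lborel_lebesgue[OF int]
    show "set_integrable lebesgue {a..b} (F (Suc i) x) \<and> F i x b - F i x a = (LINT
        t:{a..b}|lebesgue. F (Suc i) x t)" by simp
  qed
  moreover have "F (Suc m) x y = 0" if "y \<notin> {0<..}" for x y
    using that admissible_zero[OF Gr[OF order_refl], of y x] by (simp add: FS shift_def)
  moreover have "F (Suc m) x \<in> borel_measurable borel" "nn_moment s (F (Suc m) x) \<le> ennreal
      (deriv_const m N * left_weight x ^ s)" for x
    using nn_moment_source[OF _ G(2)[OF order_refl] K, of N "w m" x] w by (auto simp: FS
        deriv_const_def potential_def)
  moreover have "0 \<le> deriv_const m N * left_weight x ^ s" for x using N K by (simp add: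
      deriv_const_def)
  ultimately have "dy_witness {0<..} (Suc m) s (\<lambda>x. deriv_const m N * left_weight x ^ s) P F" by
      (simp add: dy_witness_def F_def)
  then show ?thesis by (rule exI[of _ F])
qed

text \<open>As for \<open>y\<close>, with \<open>char_int\<close> as the only integral operator. The
  new point is differentiability in \<open>x\<close> at a prescribed \<open>x\<close>, for almost
  every \<open>y\<close>: it holds because the rough term depends on \<open>x + y\<close>
  only.\<close>

lemma marchenko_kernel_dx_witness:
  assumes C: "marchenko_kernel (w 0) P" and w: "potential s m N w"
  shows "\<exists>F. dx_witness {0<..} (Suc m) s (\<lambda>x. deriv_const m N * left_weight x ^ s) P F"
proof -
  have N: "0 \<le> N" using potential_nonneg[OF w] .
  have CN: "0 \<le> kernel_const N m" using kernel_const_nonneg[OF N] .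
  have P: "smooth_kernel s (s + 1) m (kernel_const N m) P" by (rule
      marchenko_kernel_smooth_kernel[OF C w order_refl])
  have rP: "admissible P" by (rule marchenko_kernel_admissible[OF C])
  let ?K = "3 ^ m * kernel_const N m * N"
  \<comment> \<open>The derivatives in \<open>x\<close> do not involve \<open>tail_int\<close>;
    their bound is enlarged to the common constant of both directions.\<close>
  have K: "0 \<le> ?K" "N + ?K \<le> deriv_const m N" using N CN by (simp_all add: deriv_const_def)
  have wi: "integrable lborel (w i)" if "i \<le> m" for i using w that weighted_integrable by (auto
      simp: potential_def)
  have w0: "integrable lborel (w 0)" by (rule wi) simp
  have "smooth_kernel s s m ?K (\<lambda>x y. - char_int (w 0) P x y)" by (intro smooth_kernel_uminus
      smooth_kernel_char_int[OF w P CN])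
  from smooth_kernel_x_chain[OF this] obtain G where G': "G 0 = (\<lambda>x y. - char_int (w 0) P x y) \<and>
      (\<forall>i\<le>m. smooth_kernel s s 0 ?K (G i)) \<and>
    (\<forall>i<m. \<forall>x. \<forall>y>0. ((\<lambda>x. G i x y) has_real_derivative G (Suc i) x y) (at x))" ..
  have G: "G 0 = (\<lambda>x y. - char_int (w 0) P x y)" "\<And>i. i \<le> m \<Longrightarrow> smooth_kernel s s 0 ?K (G i)"
    "\<And>i x y. i < m \<Longrightarrow> 0 < y \<Longrightarrow> ((\<lambda>x. G i x y) has_real_derivative G (Suc i) x y) (at x)"
    using G' by (simp_all del: smooth_kernel.simps)
  have Gr: "admissible (G i)" if "i \<le> m" for i using smooth_kernel_admissible[OF G(2)[OF that]] .
  define F where "F = case_nat P (\<lambda>j x y. - shift (w j) x y + G j x y)"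
  have FS: "F (Suc j) = (\<lambda>x y. - shift (w j) x y + G j x y)" for j by (simp add: F_def)
  have "ac_derivs UNIV (Suc m) (\<lambda>i x. F i x y)" if y: "0 < y" for y
    unfolding ac_derivs_def
  proof (intro allI impI ballI)
    fix i a b assume i: "i < Suc m" and ab: "(a::real) \<le> b"
    have i': "i \<le> m" using i by simp
    have int: "set_integrable lborel {a..b} (\<lambda>x. F (Suc i) x y)"
      unfolding FS by (rule source_set_integrable_x[OF wi[OF i'] Gr[OF i'] y])
    have "F i b y - F i a y = (LINT x:{a..b}|lborel. F (Suc i) x y)"
    proof (cases i)
      case 0
      have "P b y - P a y = (LINT x:{a..b}|lborel. - w 0 (x + y) - char_int (w 0) P x y)" by (rule
          marchenko_kernel_x_ac[OF C w0 ab y])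
      also have "\<dots> = (LINT x:{a..b}|lborel. F (Suc 0) x y)"
        unfolding set_lebesgue_integral_def using y
        by (intro Bochner_Integration.integral_cong) (auto simp: FS G(1) shift_def indicator_def)
      finally show ?thesis using 0 by (simp add: F_def)
    next
      case (Suc j)
      have j: "j < m" "Suc j \<le> m" using Suc i by auto
      have cG: "continuous_on UNIV (\<lambda>x. G (Suc j) x y)" using admissible_section_continuous[OF Gr[OF
          j(2)] y, of 0] by simp
      have FTC: "has_bochner_integral lborel (\<lambda>x. G (Suc j) x y * indicator {a..b} x) (G j b y - G j
          a y)"
        by (rule has_bochner_integral_FTC_Icc_real[OF ab])
           (use G(3)[OF j(1) y] cG in \<open>auto simp: continuous_on_eq_continuous_at\<close>)
      have 1: "shift (w j) b y - shift (w j) a y = (LINT x:{a..b}|lborel. shift (w (Suc j)) x y)"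
        by (rule ac_pair_shift_x[OF _ ab y]) (use w j in \<open>simp add: potential_def\<close>)
      have 2: "G j b y - G j a y = (LINT x:{a..b}|lborel. G (Suc j) x y)"
        using has_bochner_integral_iff[THEN iffD1, OF FTC] by (simp add: set_lebesgue_integral_def
            mult.commute)
      have s1: "set_integrable lborel {a..b} (\<lambda>x. shift (w (Suc j)) x y)"
        using translate_set_integrable(1)[OF wi[OF j(2)]] y by (simp add: shift_def)
      have s2: "set_integrable lborel {a..b} (\<lambda>x. G (Suc j) x y)"
        by (intro borel_integrable_atLeastAtMost' continuous_on_subset[OF cG]) simp
      have "F i b y - F i a y = (G j b y - G j a y) - (shift (w j) b y - shift (w j) a y)" by (simp
          add: Suc FS)
      also have "\<dots> = (LINT x:{a..b}|lborel. G (Suc j) x y - shift (w (Suc j)) x y)"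
        unfolding 1 2 by (rule set_integral_diff(2)[symmetric, OF s2 s1])
      finally show ?thesis by (simp add: Suc FS)
    qed
    with set_integral_lborel_lebesgue[OF int]
    show "set_integrable lebesgue {a..b} (\<lambda>x. F (Suc i) x y) \<and> F i b y - F i a y = (LINT
        x:{a..b}|lebesgue. F (Suc i) x y)" by simp
  qed
  moreover have "AE y in lebesgue. y \<in> {0<..} \<longrightarrow> ((\<lambda>x'. F m x' y) has_real_derivative F (Suc m) x y)
      (at x)" for x
  proof -
    \<comment> \<open>\<open>F m\<close> is split into a function \<open>A\<close> of
      \<open>x + y\<close> that is only absolutely continuous and a part \<open>H\<close>
      differentiable in \<open>x\<close> everywhere. \<open>A\<close> has a derivative at almost
      every \<open>u\<close>, hence, for fixed \<open>x\<close>, at \<open>u = x + y\<close> for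
      almost every \<open>y\<close>. For \<open>m = 0\<close> the kernel itself is split by the
      Marchenko equation and \<open>A\<close> is the tail of the potential; for
      \<open>m = Suc j\<close> it is \<open>- w j\<close>.\<close>
    obtain A H where A: "AE u in lborel. (A has_real_derivative - w m u) (at u)"
      and H: "\<And>y. 0 < y \<Longrightarrow> ((\<lambda>x'. H x' y) has_real_derivative G m x y) (at x)"
      and FA: "\<And>x y. 0 < y \<Longrightarrow> F m x y = A (x + y) + H x y"
    proof (cases m)
      case 0
      have "ac_pair (tail (w 0)) (\<lambda>t. - w 0 t)" using tail_ac[OF w0] by (simp add: ac_pair_def)
      then have A: "AE u in lborel. (tail (w 0) has_real_derivative - w 0 u) (at u)"
        by (rule ac_pair_derivative_AE) (use w0 in simp)
      have "((\<lambda>x'. double_int (w 0) P x' y) has_real_derivative - char_int (w 0) P x y) (at x)" if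
          y: "0 < y" for y
      proof (rule deriv_of_ac_continuous[where S=UNIV])
        show "continuous_on UNIV (\<lambda>x. - char_int (w 0) P x y)"
          using admissible_section_continuous[OF admissible_uminus[OF admissible_char_int[OF rP w0]]
              y, of 0] by simp
      qed (auto intro: double_int_x_ac[OF rP w0])
      then show ?thesis using that[of "tail (w 0)" "double_int (w 0) P"] A marchenko_kernel_eq[OF C]
          0 by (simp add: F_def G(1))
    next
      case (Suc j)
      have "ac_pair (w j) (w m)" using w Suc by (simp add: potential_def)
      then have "AE u in lborel. (w j has_real_derivative w m u) (at u)" by (rule
          ac_pair_derivative_AE[OF _ wi]) simp
      then have A: "AE u in lborel. ((\<lambda>u. - w j u) has_real_derivative - w m u) (at u)"
        by eventually_elim (rule DERIV_minus)
      show ?thesis using that[OF A, of "G j"] G(3)[of j] Suc by (simp add: FS shift_def)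
    qed
    have "AE y in lborel. (A has_real_derivative - w m (x + y)) (at (x + y))" using AE_affine[OF A,
        of 1 x] by simp
    then have "AE y in lborel. y \<in> {0<..} \<longrightarrow> ((\<lambda>x'. F m x' y) has_real_derivative F (Suc m) x y) (at
        x)"
    proof eventually_elim
      case (elim y)
      show ?case
      proof
        assume "y \<in> {0<..}"
        then have y: "0 < y" by simp
        have "((\<lambda>x'. A (x' + y)) has_real_derivative - w m (x + y)) (at x)" using elim
            DERIV_shift[of A "- w m (x + y)" x y] by simp
        from DERIV_add[OF this H[OF y]] show "((\<lambda>x'. F m x' y) has_real_derivative F (Suc m) x y)
            (at x)"
          using y by (simp add: FA FS shift_def)
      qed
    qed
    then show ?thesis by (rule AE_completion)
  qed
  moreover have "F (Suc m) x y = 0" if "y \<notin> {0<..}" for x y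
    using that admissible_zero[OF Gr[OF order_refl], of y x] by (simp add: FS shift_def)
  moreover have "F (Suc m) x \<in> borel_measurable borel" "nn_moment s (F (Suc m) x) \<le> ennreal
      (deriv_const m N * left_weight x ^ s)" for x
  proof -
    have wm: "weighted s N (w m)" using w by (simp add: potential_def)
    show "F (Suc m) x \<in> borel_measurable borel" using nn_moment_source(1)[OF wm G(2)[OF order_refl]
        K(1)] by (simp add: FS)
    have "nn_moment s (F (Suc m) x) \<le> ennreal ((N + ?K) * left_weight x ^ s)" using
        nn_moment_source(2)[OF wm G(2)[OF order_refl] K(1)] by (simp add: FS)
    also have "\<dots> \<le> ennreal (deriv_const m N * left_weight x ^ s)" by (intro ennreal_leI
        mult_right_mono K) simp
    finally show "nn_moment s (F (Suc m) x) \<le> ennreal (deriv_const m N * left_weight x ^ s)" .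
  qed
  moreover have "0 \<le> deriv_const m N * left_weight x ^ s" for x using N K by simp
  ultimately have "dx_witness {0<..} (Suc m) s (\<lambda>x. deriv_const m N * left_weight x ^ s) P F" by
      (simp add: dx_witness_def F_def)
  then show ?thesis by (rule exI[of _ F])
qed

section \<open>From kernels back to the Marchenko functions\<close>

lemma dy_witness_cong: "dy_witness S n s C B F \<Longrightarrow> (\<And>x y. y \<in> S \<Longrightarrow> B x y = B' x y) \<Longrightarrow> dy_witness S n s C
    B' F"
  by (simp add: dy_witness_def)

lemma dx_witness_cong: "dx_witness S n s C B F \<Longrightarrow> (\<And>x y. y \<in> S \<Longrightarrow> B x y = B' x y) \<Longrightarrow> dx_witness S n s C
    B' F"
  by (simp add: dx_witness_def)

lemma plus_marchenko_kernel:
  assumes M: "marchenko_plus V B" and V: "integrable lebesgue V"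
    and w: "potential s m N w" and Vw: "AE y in lborel. V y = w 0 y"
  shows "marchenko_kernel (w 0) (\<lambda>x y. indicator {0<..} y * B x y)"
  by (rule marchenko_eq_marchenko_kernel[OF marchenko_plus_eq[OF M] V weighted_integrable[OF
      potential_0[OF w]] Vw])

lemma minus_marchenko_kernel:
  assumes M: "marchenko_minus V B" and V: "integrable lebesgue V"
    and w: "potential s m N w" and Vw: "AE y in lborel. V y = w 0 y"
  obtains w' where "potential s m N w'" "marchenko_kernel (w' 0) (\<lambda>x y. indicator {0<..} y * B (- x)
      (- y))"
proof -
  let ?w = "\<lambda>i t. (- 1) ^ i * w i (- t)"
  have w': "potential s m N ?w" by (rule potential_reflect[OF w])
  have "AE y in lborel. V (- y) = ?w 0 y" using AE_affine[OF Vw, of "-1" 0] by simp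
  from marchenko_eq_marchenko_kernel[OF marchenko_minus_eq[OF M] integrable_lebesgue_uminus[OF V]
      weighted_integrable[OF potential_0[OF w']] this]
  show ?thesis using that[OF w'] by simp
qed

lemma left_weight_minus: "left_weight (- x) = 1 + max 0 x" by (simp add: left_weight_def)

lemma potential_integrable:
  assumes w: "potential s m N w" and Vw: "AE y in lborel. V y = w 0 y"
  shows "integrable lebesgue V"
proof -
  have i: "integrable lborel (w 0)" by (rule weighted_integrable[OF potential_0[OF w]])
  then have "integrable lebesgue (w 0)" using integrable_completion[of "w 0" lborel] by (auto dest:
      borel_measurable_integrable)
  then show ?thesis
  proof (rule integrable_lebesgue_cong_AE)
    have "AE y in lborel. w 0 y = V y" using Vw by eventually_elim simp
    then show "AE y in lebesgue. w 0 y = V y" by (rule AE_completion)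
  qed
qed

lemma marchenko_moment_le:
  assumes V: "V \<in> weighted_L1 (real (s + 1))"
  shows "marchenko_plus V B \<Longrightarrow> moment_le s (B x) (norm_L1 (real (s + 1)) V * exp (norm_L1 (real (s +
      1)) V) * (1 + max 0 (- x)) ^ (s + 1))"
    and "marchenko_minus V B \<Longrightarrow> moment_le s (B x) (norm_L1 (real (s + 1)) V * exp (norm_L1 (real (s +
        1)) V) * (1 + max 0 x) ^ (s + 1))"
proof -
  define N where "N = norm_L1 (real (s + 1)) V"
  obtain w where w: "potential s 0 N w" "AE y in lborel. V y = w 0 y" using weighted_weighted[OF V]
      unfolding N_def .
  have N: "0 \<le> N" using potential_nonneg[OF w(1)] .
  have Vi: "integrable lebesgue V" by (rule potential_integrable[OF w])
  have nn: "0 \<le> N * exp N * left_weight x ^ (s + 1)" for x using N by (simp del: power_Suc)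
  show "moment_le s (B x) (norm_L1 (real (s + 1)) V * exp (norm_L1 (real (s + 1)) V) * (1 + max 0 (-
      x)) ^ (s + 1))" if M: "marchenko_plus V B"
  proof -
    define P where "P x y = indicator {0<..} y * B x y" for x y
    have C: "marchenko_kernel (w 0) P" using plus_marchenko_kernel[OF M Vi w] by (simp add:
        P_def[abs_def])
    have "moment_le s (B x) (N * exp N * left_weight x ^ (s + 1))"
    proof (rule moment_leI[OF _ admissible_section_measurable[OF marchenko_kernel_admissible[OF C]]
        marchenko_kernel_nn_moment[OF C potential_0[OF w(1)]] nn])
      show "AE y in lebesgue. B x y = P x y" using AE_lebesgue_neq[of 0]
        by eventually_elim (use M in \<open>auto simp: P_def indicator_def marchenko_plus_def\<close>)
    qed
    then show ?thesis by (simp add: N_def left_weight_def)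
  qed
  show "moment_le s (B x) (norm_L1 (real (s + 1)) V * exp (norm_L1 (real (s + 1)) V) * (1 + max 0 x)
      ^ (s + 1))" if M: "marchenko_minus V B"
  proof -
    define P where "P x y = indicator {0<..} y * B (- x) (- y)" for x y
    obtain w' where w': "potential s 0 N w'" "marchenko_kernel (w' 0) P" using
        minus_marchenko_kernel[OF M Vi w] by (auto simp: P_def[abs_def])
    have m: "P (- x) \<in> borel_measurable borel" by (rule admissible_section_measurable[OF
        marchenko_kernel_admissible[OF w'(2)]])
    have "moment_le s (B x) (N * exp N * left_weight (- x) ^ (s + 1))"
    proof (rule moment_leI[OF _ _ _ nn])
      \<comment> \<open>The trivial sign \<open>(- 1) ^ 0\<close> brings the reflected kernel into
        the form of \<open>measurable_reflect\<close> and \<open>nn_moment_reflect\<close>.\<close>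
      show "AE y in lebesgue. B x y = (- 1) ^ 0 * P (- x) (- y)" using AE_lebesgue_neq[of 0]
        by eventually_elim (use M in \<open>auto simp: P_def indicator_def marchenko_minus_def\<close>)
      show "(\<lambda>y. (- 1) ^ 0 * P (- x) (- y)) \<in> borel_measurable borel" by (rule measurable_reflect[OF
          m])
      show "nn_moment s (\<lambda>y. (- 1) ^ 0 * P (- x) (- y)) \<le> ennreal (N * exp N * left_weight (- x) ^
          (s + 1))"
        unfolding nn_moment_reflect[OF m] by (rule marchenko_kernel_nn_moment[OF w'(2)
            potential_0[OF w'(1)]])
    qed
    then show ?thesis by (simp add: N_def left_weight_minus)
  qed
qed

lemma marchenko_deriv_moment_le:
  assumes n: "1 \<le> n" and V: "V \<in> weighted_W1 (n - 1) (real (s + 1))"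
  shows "marchenko_plus V B \<Longrightarrow> has_dy {0<..} n B \<and> has_dx {0<..} n B \<and>
          (\<forall>x. moment_le s (\<lambda>y. dy n B x y)
                 (deriv_const (n - 1) (norm_W1 (n - 1) (real (s + 1)) V) * (1 + max 0 (- x)) ^ s) \<and>
               moment_le s (\<lambda>y. dx n B x y)
                 (deriv_const (n - 1) (norm_W1 (n - 1) (real (s + 1)) V) * (1 + max 0 (- x)) ^ s))"
    and "marchenko_minus V B \<Longrightarrow> has_dy {..<0} n B \<and> has_dx {..<0} n B \<and>
          (\<forall>x. moment_le s (\<lambda>y. dy n B x y)
                 (deriv_const (n - 1) (norm_W1 (n - 1) (real (s + 1)) V) * (1 + max 0 x) ^ s) \<and>
               moment_le s (\<lambda>y. dx n B x y)
                 (deriv_const (n - 1) (norm_W1 (n - 1) (real (s + 1)) V) * (1 + max 0 x) ^ s))"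
proof -
  define N where "N = norm_W1 (n - 1) (real (s + 1)) V"
  obtain w where w: "potential s (n - 1) N w" "AE y in lborel. V y = w 0 y" using
      potential_weighted[OF V] unfolding N_def .
  have Vi: "integrable lebesgue V" by (rule potential_integrable[OF w])
  have Sn: "Suc (n - 1) = n" using n by simp
  let ?C = "\<lambda>x. deriv_const (n - 1) N * left_weight x ^ s"
  show "has_dy {0<..} n B \<and> has_dx {0<..} n B \<and>
          (\<forall>x. moment_le s (\<lambda>y. dy n B x y) (deriv_const (n - 1) (norm_W1 (n - 1) (real (s + 1)) V)
              * (1 + max 0 (- x)) ^ s) \<and>
               moment_le s (\<lambda>y. dx n B x y) (deriv_const (n - 1) (norm_W1 (n - 1) (real (s + 1)) V)
                   * (1 + max 0 (- x)) ^ s))"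
    if M: "marchenko_plus V B"
  proof -
    have C: "marchenko_kernel (w 0) (\<lambda>x y. indicator {0<..} y * B x y)" by (rule
        plus_marchenko_kernel[OF M Vi w])
    obtain F where F: "dy_witness {0<..} n s ?C (\<lambda>x y. indicator {0<..} y * B x y) F"
      using marchenko_kernel_dy_witness[OF C w(1)] unfolding Sn by blast
    obtain H where H: "dx_witness {0<..} n s ?C (\<lambda>x y. indicator {0<..} y * B x y) H"
      using marchenko_kernel_dx_witness[OF C w(1)] unfolding Sn by blast
    have F': "dy_witness {0<..} n s ?C B F" by (rule dy_witness_cong[OF F]) simp
    have H': "dx_witness {0<..} n s ?C B H" by (rule dx_witness_cong[OF H]) simp
    have S: "{0<..} = {0<..} \<or> {0<..} = {..<0::real}" by simp
    have B: "B x y = 0" if "y \<notin> {0<..}" "y \<noteq> 0" for x y using M that by (simp add: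
        marchenko_plus_def)
    show ?thesis using dy_witness_imp[OF S n F' B] dx_witness_imp[OF S n H' B] by (simp add: N_def
        left_weight_def)
  qed
  show "has_dy {..<0} n B \<and> has_dx {..<0} n B \<and>
          (\<forall>x. moment_le s (\<lambda>y. dy n B x y) (deriv_const (n - 1) (norm_W1 (n - 1) (real (s + 1)) V)
              * (1 + max 0 x) ^ s) \<and>
               moment_le s (\<lambda>y. dx n B x y) (deriv_const (n - 1) (norm_W1 (n - 1) (real (s + 1)) V)
                   * (1 + max 0 x) ^ s))"
    if M: "marchenko_minus V B"
  proof -
    obtain w' where w': "potential s (n - 1) N w'" and C: "marchenko_kernel (w' 0) (\<lambda>x y. indicator
        {0<..} y * B (- x) (- y))"
      using minus_marchenko_kernel[OF M Vi w] .
    obtain F where F: "dy_witness {0<..} n s ?C (\<lambda>x y. indicator {0<..} y * B (- x) (- y)) F"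
      using marchenko_kernel_dy_witness[OF C w'] unfolding Sn by blast
    obtain H where H: "dx_witness {0<..} n s ?C (\<lambda>x y. indicator {0<..} y * B (- x) (- y)) H"
      using marchenko_kernel_dx_witness[OF C w'] unfolding Sn by blast
    have F1: "dy_witness {0<..} n s ?C (\<lambda>x y. B (- x) (- y)) F" by (rule dy_witness_cong[OF F]) simp
    have H1: "dx_witness {0<..} n s ?C (\<lambda>x y. B (- x) (- y)) H" by (rule dx_witness_cong[OF H]) simp
    note F' = dy_witness_reflect[OF F1] and H' = dx_witness_reflect[OF H1 n]
    have S: "{..<0} = {0<..} \<or> {..<0} = {..<0::real}" by simp
    have B: "B x y = 0" if "y \<notin> {..<0}" "y \<noteq> 0" for x y using M that by (simp add:
        marchenko_minus_def)
    show ?thesis using dy_witness_imp[OF S n F' B] dx_witness_imp[OF S n H' B] by (simp add: N_def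
        left_weight_minus)
  qed
qed

theorem lemma4p5:
  fixes s :: nat
  shows
    "(\<exists>c :: real \<Rightarrow> real. \<forall>V \<in> weighted_L1 (real (s + 1)). \<forall>B.
        (marchenko_plus V B \<longrightarrow>
          (\<forall>x. moment_le s (B x) (c (norm_L1 (real (s + 1)) V) * (1 + max 0 (- x)) ^ (s + 1)))) \<and>
        (marchenko_minus V B \<longrightarrow>
          (\<forall>x. moment_le s (B x) (c (norm_L1 (real (s + 1)) V) * (1 + max 0 x) ^ (s + 1)))))
     \<and>
     (\<forall>n\<ge>1. \<exists>c :: real \<Rightarrow> real. \<forall>V \<in> weighted_W1 (n - 1) (real (s + 1)). \<forall>B.
        (marchenko_plus V B \<longrightarrow>
          has_dy {0<..} n B \<and> has_dx {0<..} n B \<and>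
          (\<forall>x. moment_le s (\<lambda>y. dy n B x y)
                 (c (norm_W1 (n - 1) (real (s + 1)) V) * (1 + max 0 (- x)) ^ s) \<and>
               moment_le s (\<lambda>y. dx n B x y)
                 (c (norm_W1 (n - 1) (real (s + 1)) V) * (1 + max 0 (- x)) ^ s))) \<and>
        (marchenko_minus V B \<longrightarrow>
          has_dy {..<0} n B \<and> has_dx {..<0} n B \<and>
          (\<forall>x. moment_le s (\<lambda>y. dy n B x y)
                 (c (norm_W1 (n - 1) (real (s + 1)) V) * (1 + max 0 x) ^ s) \<and>
               moment_le s (\<lambda>y. dx n B x y)
                 (c (norm_W1 (n - 1) (real (s + 1)) V) * (1 + max 0 x) ^ s))))"
proof (intro conjI allI impI)
  show "\<exists>c :: real \<Rightarrow> real. \<forall>V \<in> weighted_L1 (real (s + 1)). \<forall>B.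
        (marchenko_plus V B \<longrightarrow>
          (\<forall>x. moment_le s (B x) (c (norm_L1 (real (s + 1)) V) * (1 + max 0 (- x)) ^ (s + 1)))) \<and>
        (marchenko_minus V B \<longrightarrow>
          (\<forall>x. moment_le s (B x) (c (norm_L1 (real (s + 1)) V) * (1 + max 0 x) ^ (s + 1))))"
    by (intro exI[of _ "\<lambda>N. N * exp N"] ballI allI conjI impI) (blast intro: marchenko_moment_le)+
next
  fix n :: nat assume n: "1 \<le> n"
  show "\<exists>c :: real \<Rightarrow> real. \<forall>V \<in> weighted_W1 (n - 1) (real (s + 1)). \<forall>B.
        (marchenko_plus V B \<longrightarrow>
          has_dy {0<..} n B \<and> has_dx {0<..} n B \<and>
          (\<forall>x. moment_le s (\<lambda>y. dy n B x y)
                 (c (norm_W1 (n - 1) (real (s + 1)) V) * (1 + max 0 (- x)) ^ s) \<and>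
               moment_le s (\<lambda>y. dx n B x y)
                 (c (norm_W1 (n - 1) (real (s + 1)) V) * (1 + max 0 (- x)) ^ s))) \<and>
        (marchenko_minus V B \<longrightarrow>
          has_dy {..<0} n B \<and> has_dx {..<0} n B \<and>
          (\<forall>x. moment_le s (\<lambda>y. dy n B x y)
                 (c (norm_W1 (n - 1) (real (s + 1)) V) * (1 + max 0 x) ^ s) \<and>
               moment_le s (\<lambda>y. dx n B x y)
                 (c (norm_W1 (n - 1) (real (s + 1)) V) * (1 + max 0 x) ^ s)))"
    using marchenko_deriv_moment_le[OF n] by (intro exI[of _ "deriv_const (n - 1)"] ballI allI conjI
        impI) blast+
qed

end
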